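(* There exists a flexible pentagonal bipyramid obtained by the Nelson construction from two flexible octahedra of Type III, such that the resulting (non-degenerate) motion has Galois group $\langle (1,1,1,1,1)\rangle$.
   Context: For $n\ge4$, $\mathbb{B}_n$ is the graph with vertex set $V=\{1,\dots,n,\mathsf T,\mathsf B\}$ and edges $\{i,i+1\}$ (mod $n$), $\{i,\mathsf T\}$, $\{i,\mathsf B\}$. $\mathbb{B}_4$ is called an octahedron (graph on six vertices with three disjoint non-edges). A realization is a map $\rho:V\to\mathbb{R}^3$ with $\rho(u)\ne\rho(v)$ for every edge; it induces edge lengths $\lambda_{uv}=\|\rho(u)-\rho(v)\|$. A flex of $\rho$ is a continuous map $f:[0,1)\to(\mathbb{R}^3)^V$ with $f(0)=\rho$, each $f(t)$ a realization with the same edge lengths as $\rho$, and $f(t_1),f(t_2)$ not congruent under direct isometries for $t_1\neq t_2$. A bipyramid with given edge lengths is flexible if it has infinitely many pairwise non-congruent realizations (equivalently some realization has a flex). A flat pose is a configuration in the motion in which all vertices are coplanar. Type III flexible octahedra (Bricard): the edge lengths in each of the three induced $4$-cycles satisfy a linear relation (a signed sum, with signs $\pm1$, vanishes) and the motion has two flat poses. Nelson construction: let $\mathbb{O}_{\mathsf k}$ be an octahedron on $\{1,2,3,0,\mathsf T,\mathsf B\}$ with non-edges $\{1,3\},\{2,0\},\{\mathsf T,\mathsf B\}$ and $\mathbb{O}_{\mathsf p}$ an octahedron on $\{3,4,5,0,\mathsf T,\mathsf B\}$ with non-edges $\{3,5\},\{4,0\},\{\mathsf T,\mathsf B\}$.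 A pair of realizations $(\rho_{\mathsf k},\rho_{\mathsf p})$ is a fitting pair if $\rho_{\mathsf k}(i)=\rho_{\mathsf p}(i)$ for $i\in\{0,3,\mathsf T,\mathsf B\}$ and $\rho_{\mathsf k}(0),\rho_{\mathsf k}(1),\rho_{\mathsf p}(5)$ are collinear. If there are flexes $f_{\mathsf k},f_{\mathsf p}$ of $\rho_{\mathsf k},\rho_{\mathsf p}$ with $(f_{\mathsf k}(t),f_{\mathsf p}(t))$ a fitting pair for all $t$, then combining them and forgetting vertex $0$ gives a flex of the pentagonal bipyramid $\mathbb{B}_5$ on $1,2,3,4,5,\mathsf T,\mathsf B$; this is a flexible pentagonal bipyramid obtained by the Nelson construction. Galois group: let $\mathcal{E}_5=\{(1,2),(2,3),(3,4),(4,5),(5,1)\}$. The oriented volume of $(a_1,\dots,a_4)$ is $\frac16\det(a_1-a_4,a_2-a_4,a_3-a_4)$. $\mathrm{CM}^*_5$ is the Zariski closure of the image of $(\mathbb{R}^3)^V\to\mathbb{R}^{\binom V2}\times\mathbb{R}^{\mathcal{E}_5}$, $\rho\mapsto((d_{vw}),(s_e))$, with $d_{vw}=\|\rho(v)-\rho(w)\|^2$ and $s_{i,i+1}$ the oriented volume of the images of $(i,i+1,\mathsf T,\mathsf B)$. $K_\lambda=\mathrm{CM}^*_5\cap\{d_{vw}=\lambda_{vw}^2\ \forall\text{ edges}\}$. A motion $\mathcal{M}$ is a one-dimensional (irreducible) component of $K_\lambda$ whose general point comes from a realization inducing $\lambda$; it is non-degenerate if the vertices of each $3$-cycle are non-collinear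 and $d_{vw}$ is non-constant on $\mathcal{M}$ for all non-edges. The Galois group of a non-degenerate motion is $\mathscr{G}=\mathrm{Gal}(\mathbb{R}(\mathcal{M})/\mathbb{R}(d_{\mathsf T\mathsf B}))$ (automorphisms of the function field $\mathbb{R}(\mathcal{M})$ fixing $\mathbb{R}(d_{\mathsf T\mathsf B})$); each $\varphi\in\mathscr{G}$ satisfies $\varphi(s_e)=\pm s_e$ and is identified with the tuple in $\mathbb{Z}_2^{\mathcal{E}_5}$ with entry $1$ at $e$ iff $\varphi(s_e)=-s_e$. The motion resulting from the Nelson construction is the one containing the configurations along the constructed flex. *)

theory Defs
  imports "HOL-Analysis.Analysis" "HOL-Algebra.Algebra" "HOL-Library.Z2"
begin

section \<open>Bipyramids, realizations and flexes\<close>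

text \<open>
  The bipyramid over an n-gon has its vertices in the type \<open>'n vertex\<close>, where \<open>'n\<close> is the
  numeral type \<open>n\<close> (the integers modulo n). The successor \<open>i + 1\<close> is therefore cyclic,
  and in the type \<open>5\<close> the numeral \<open>5\<close> denotes \<open>0\<close>. The octahedron is the case \<open>4\<close>.
\<close>

datatype 'n vertex = Rim 'n | Apex_T | Apex_B

lemma UNIV_vertex: "(UNIV :: 'n vertex set) = insert Apex_T (insert Apex_B (range Rim))"
proof -
  have "v \<in> insert Apex_T (insert Apex_B (range Rim))" for v :: "'n vertex"
    by (cases v) auto
  then show ?thesis by blast
qed

instance vertex :: (finite) finite
  by standard (simp add: UNIV_vertex)

definition adj :: "'n::comm_ring_1 vertex \<Rightarrow> 'n vertex \<Rightarrow> bool" where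
  "adj u v \<longleftrightarrow> (\<exists>i. {u, v} = {Rim i, Rim (i + 1)} \<or> {u, v} = {Rim i, Apex_T} \<or> {u, v} = {Rim i, Apex_B})"

definition realization :: "('n::comm_ring_1 vertex \<Rightarrow> real ^ 3) \<Rightarrow> bool" where
  "realization \<rho> \<longleftrightarrow> (\<forall>u v. adj u v \<longrightarrow> \<rho> u \<noteq> \<rho> v)"

text \<open>Edge lengths are functions of two vertices of which only the values on edges are ever used.\<close>

definition edge_length :: "('n vertex \<Rightarrow> real ^ 3) \<Rightarrow> 'n vertex \<Rightarrow> 'n vertex \<Rightarrow> real" where
  "edge_length \<rho> u v = norm (\<rho> u - \<rho> v)"

definition induces ::
    "('n::comm_ring_1 vertex \<Rightarrow> real ^ 3) \<Rightarrow> ('n vertex \<Rightarrow> 'n vertex \<Rightarrow> real) \<Rightarrow> bool" where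
  "induces \<rho> l \<longleftrightarrow> (\<forall>u v. adj u v \<longrightarrow> edge_length \<rho> u v = l u v)"

definition directly_congruent ::
    "('n vertex \<Rightarrow> real ^ 3) \<Rightarrow> ('n vertex \<Rightarrow> real ^ 3) \<Rightarrow> bool" where
  "directly_congruent \<rho> \<sigma> \<longleftrightarrow>
     (\<exists>(Q :: real ^ 3 ^ 3) b. rotation_matrix Q \<and> (\<forall>v. \<sigma> v = Q *v \<rho> v + b))"

definition flex ::
    "('n::{finite,comm_ring_1} vertex \<Rightarrow> real ^ 3) \<Rightarrow> (real \<Rightarrow> 'n vertex \<Rightarrow> real ^ 3) \<Rightarrow> bool" where
  "flex \<rho> f \<longleftrightarrow>
     continuous_on {0..<1} f \<and> f 0 = \<rho> \<and>
     (\<forall>t\<in>{0..<1}. realization (f t) \<and> induces (f t) (edge_length \<rho>)) \<and>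
     (\<forall>t\<^sub>1\<in>{0..<1}. \<forall>t\<^sub>2\<in>{0..<1}. t\<^sub>1 \<noteq> t\<^sub>2 \<longrightarrow> \<not> directly_congruent (f t\<^sub>1) (f t\<^sub>2))"

definition flexible :: "('n::comm_ring_1 vertex \<Rightarrow> 'n vertex \<Rightarrow> real) \<Rightarrow> bool" where
  "flexible l \<longleftrightarrow>
     (\<exists>S. infinite S \<and> (\<forall>\<rho>\<in>S. realization \<rho> \<and> induces \<rho> l) \<and>
          pairwise (\<lambda>\<rho> \<sigma>. \<not> directly_congruent \<rho> \<sigma>) S)"


section \<open>Real algebraic sets\<close>

definition zariski_closed :: "'a::euclidean_space set \<Rightarrow> bool" where
  "zariski_closed S \<longleftrightarrow>
     (\<exists>P. (\<forall>f\<in>P. real_polynomial_function f) \<and> S = {x. \<forall>f\<in>P. f x = 0})"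

definition irreducible_set :: "'a::euclidean_space set \<Rightarrow> bool" where
  "irreducible_set S \<longleftrightarrow> zariski_closed S \<and> S \<noteq> {} \<and>
     (\<forall>A B. zariski_closed A \<and> zariski_closed B \<and> S = A \<union> B \<longrightarrow> S = A \<or> S = B)"

definition irreducible_component :: "'a::euclidean_space set \<Rightarrow> 'a set \<Rightarrow> bool" where
  "irreducible_component K M \<longleftrightarrow> irreducible_set M \<and> M \<subseteq> K \<and>
     (\<forall>M'. irreducible_set M' \<and> M \<subseteq> M' \<and> M' \<subseteq> K \<longrightarrow> M' = M)"

text \<open>Krull dimension; it is only meaningful for nonempty closed sets.\<close>

definition zariski_dim :: "'a::euclidean_space set \<Rightarrow> enat" where
  "zariski_dim S = Sup {enat n |n. \<exists>Z :: nat \<Rightarrow> 'a set.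
     (\<forall>i\<le>n. irreducible_set (Z i) \<and> Z i \<subseteq> S) \<and> (\<forall>i<n. Z i \<subset> Z (Suc i))}"


section \<open>The function field of an irreducible algebraic set\<close>

text \<open>
  The fraction field of the coordinate ring: a rational function is a class of pairs of
  polynomial functions \<open>(f, g)\<close>, standing for \<open>f / g\<close>, with \<open>g\<close> not identically zero on the set.
  This is a field when the set is irreducible.
\<close>

definition fractions :: "'a::euclidean_space set \<Rightarrow> (('a \<Rightarrow> real) \<times> ('a \<Rightarrow> real)) set" where
  "fractions M = {(f, g). real_polynomial_function f \<and> real_polynomial_function g \<and> (\<exists>x\<in>M. g x \<noteq> 0)}"

definition fraction_rel ::
    "'a::euclidean_space set \<Rightarrow> ((('a \<Rightarrow> real) \<times> ('a \<Rightarrow> real)) \<times> (('a \<Rightarrow> real) \<times> ('a \<Rightarrow> real))) set" where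
  "fraction_rel M = {((f, g), (f', g')). (f, g) \<in> fractions M \<and> (f', g') \<in> fractions M \<and>
     (\<forall>x\<in>M. f x * g' x = f' x * g x)}"

type_synonym 'a ratfun = "(('a \<Rightarrow> real) \<times> ('a \<Rightarrow> real)) set"

definition ratfun :: "'a::euclidean_space set \<Rightarrow> ('a \<Rightarrow> real) \<Rightarrow> ('a \<Rightarrow> real) \<Rightarrow> 'a ratfun" where
  "ratfun M f g = fraction_rel M `` {(f, g)}"

definition function_field :: "'a::euclidean_space set \<Rightarrow> 'a ratfun ring" where
  "function_field M =
     \<lparr>carrier = fractions M // fraction_rel M,
      monoid.mult = (\<lambda>A B. \<Union>(f, g)\<in>A. \<Union>(f', g')\<in>B. ratfun M (\<lambda>x. f x * f' x) (\<lambda>x. g x * g' x)),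
      monoid.one = ratfun M (\<lambda>x. 1) (\<lambda>x. 1),
      ring.zero = ratfun M (\<lambda>x. 0) (\<lambda>x. 1),
      ring.add = (\<lambda>A B. \<Union>(f, g)\<in>A. \<Union>(f', g')\<in>B.
               ratfun M (\<lambda>x. f x * g' x + f' x * g x) (\<lambda>x. g x * g' x))\<rparr>"

definition regular_fun :: "'a::euclidean_space set \<Rightarrow> ('a \<Rightarrow> real) \<Rightarrow> 'a ratfun" where
  "regular_fun M f = ratfun M f (\<lambda>x. 1)"


section \<open>Squared distances and oriented volumes\<close>

typedef 'n vpair = "{e :: 'n vertex set. card e = 2}"
  by (rule exI[of _ "{Apex_T, Apex_B}"]) simp

instance vpair :: (finite) finite
proof
  have "inj (Rep_vpair :: 'a vpair \<Rightarrow> _)"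
    by (simp add: inj_def Rep_vpair_inject)
  then show "finite (UNIV :: 'a vpair set)"
    by (rule finite_imageD[OF finite_subset[OF subset_UNIV finite]])
qed

text \<open>
  The second factor holds the oriented volumes: the pair \<open>(i, i + 1)\<close> of consecutive rim
  vertices is indexed by \<open>i\<close>.
\<close>

type_synonym 'n cm_space = "(real ^ 'n vpair) \<times> (real ^ 'n)"

definition d_coord :: "'n::finite vertex \<Rightarrow> 'n vertex \<Rightarrow> 'n cm_space \<Rightarrow> real" where
  "d_coord u v p = fst p $ Abs_vpair {u, v}"

definition s_coord :: "'n::finite \<Rightarrow> 'n cm_space \<Rightarrow> real" where
  "s_coord i p = snd p $ i"

definition oriented_volume :: "real ^ 3 \<Rightarrow> real ^ 3 \<Rightarrow> real ^ 3 \<Rightarrow> real ^ 3 \<Rightarrow> real" where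
  "oriented_volume a b c d = (1 / 6) * det (vector [a - d, b - d, c - d] :: real ^ 3 ^ 3)"

definition cm_point :: "('n::{finite,comm_ring_1} vertex \<Rightarrow> real ^ 3) \<Rightarrow> 'n cm_space" where
  "cm_point \<rho> =
     (\<chi> e. THE r. \<exists>u v. Rep_vpair e = {u, v} \<and> r = (norm (\<rho> u - \<rho> v))\<^sup>2,
      \<chi> i. oriented_volume (\<rho> (Rim i)) (\<rho> (Rim (i + 1))) (\<rho> Apex_T) (\<rho> Apex_B))"

lemma d_coord_cm_point:
  assumes "u \<noteq> v"
  shows "d_coord u v (cm_point \<rho>) = (norm (\<rho> u - \<rho> v))\<^sup>2"
proof -
  have "Rep_vpair (Abs_vpair {u, v}) = {u, v}"
    using assms by (intro Abs_vpair_inverse) simp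
  then have "d_coord u v (cm_point \<rho>) =
      (THE r. \<exists>u' v'. {u, v} = {u', v'} \<and> r = (norm (\<rho> u' - \<rho> v'))\<^sup>2)"
    by (simp add: d_coord_def cm_point_def)
  also have "\<dots> = (norm (\<rho> u - \<rho> v))\<^sup>2"
    by (rule the_equality) (auto simp: doubleton_eq_iff norm_minus_commute)
  finally show ?thesis .
qed

lemma s_coord_cm_point:
  "s_coord i (cm_point \<rho>) =
     oriented_volume (\<rho> (Rim i)) (\<rho> (Rim (i + 1))) (\<rho> Apex_T) (\<rho> Apex_B)"
  by (simp add: s_coord_def cm_point_def)


section \<open>Motions\<close>

definition CM_var :: "'n::{finite,comm_ring_1} cm_space set" where
  "CM_var = zariski_closed hull (range cm_point)"

definition K_var :: "('n::{finite,comm_ring_1} vertex \<Rightarrow> 'n vertex \<Rightarrow> real) \<Rightarrow> 'n cm_space set" where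
  "K_var l = CM_var \<inter> {p. \<forall>u v. adj u v \<longrightarrow> d_coord u v p = (l u v)\<^sup>2}"

text \<open>The general point of \<open>M\<close> is any point outside a suitable proper closed subset \<open>M \<inter> Z\<close>.\<close>

definition motion ::
    "('n::{finite,comm_ring_1} vertex \<Rightarrow> 'n vertex \<Rightarrow> real) \<Rightarrow> 'n cm_space set \<Rightarrow> bool" where
  "motion l M \<longleftrightarrow> irreducible_component (K_var l) M \<and> zariski_dim M = 1 \<and>
     (\<exists>Z. zariski_closed Z \<and> \<not> M \<subseteq> Z \<and>
        (\<forall>p\<in>M - Z. \<exists>\<rho>. realization \<rho> \<and> induces \<rho> l \<and> p = cm_point \<rho>))"

text \<open>
  Collinearity of the vertices of a 3-cycle depends on the edge lengths only, so it does not
  matter which realization in the motion is inspected.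
\<close>

definition nondegenerate ::
    "('n::{finite,comm_ring_1} vertex \<Rightarrow> 'n vertex \<Rightarrow> real) \<Rightarrow> 'n cm_space set \<Rightarrow> bool" where
  "nondegenerate l M \<longleftrightarrow>
     (\<forall>\<rho> u v w. realization \<rho> \<and> induces \<rho> l \<and> cm_point \<rho> \<in> M \<and> adj u v \<and> adj v w \<and> adj w u
        \<longrightarrow> \<not> collinear {\<rho> u, \<rho> v, \<rho> w}) \<and>
     (\<forall>u v. u \<noteq> v \<and> \<not> adj u v \<longrightarrow> \<not> d_coord u v constant_on M)"

definition contains_flex ::
    "'n::{finite,comm_ring_1} cm_space set \<Rightarrow> (real \<Rightarrow> 'n vertex \<Rightarrow> real ^ 3) \<Rightarrow> bool" where
  "contains_flex M f \<longleftrightarrow> (\<forall>t\<in>{0..<1}. cm_point (f t) \<in> M)"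


section \<open>Octahedra of Type III\<close>

definition induced_4_cycle ::
    "'n::comm_ring_1 vertex \<Rightarrow> 'n vertex \<Rightarrow> 'n vertex \<Rightarrow> 'n vertex \<Rightarrow> bool" where
  "induced_4_cycle a b c d \<longleftrightarrow> distinct [a, b, c, d] \<and>
     adj a b \<and> adj b c \<and> adj c d \<and> adj d a \<and> \<not> adj a c \<and> \<not> adj b d"

text \<open>
  A coplanar realization is determined up to direct congruence by its squared distances, so
  counting points of \<open>M\<close> counts flat poses up to congruence.
\<close>

definition flat_poses ::
    "('n::{finite,comm_ring_1} vertex \<Rightarrow> 'n vertex \<Rightarrow> real) \<Rightarrow> 'n cm_space set \<Rightarrow> 'n cm_space set" where
  "flat_poses l M =
     {p \<in> M. \<exists>\<rho>. realization \<rho> \<and> induces \<rho> l \<and> p = cm_point \<rho> \<and> coplanar (range \<rho>)}"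

definition type_III :: "(4 vertex \<Rightarrow> 4 vertex \<Rightarrow> real) \<Rightarrow> 4 cm_space set \<Rightarrow> bool" where
  "type_III l M \<longleftrightarrow> flexible l \<and> motion l M \<and>
     (\<forall>a b c d. induced_4_cycle a b c d \<longrightarrow>
        (\<exists>\<epsilon>\<^sub>1\<in>{1, -1}. \<exists>\<epsilon>\<^sub>2\<in>{1, -1}. \<exists>\<epsilon>\<^sub>3\<in>{1, -1}. \<exists>\<epsilon>\<^sub>4\<in>{1, -1}.
           \<epsilon>\<^sub>1 * l a b + \<epsilon>\<^sub>2 * l b c + \<epsilon>\<^sub>3 * l c d + \<epsilon>\<^sub>4 * l d a = 0)) \<and>
     card (flat_poses l M) = 2"


section \<open>The Nelson construction\<close>

text \<open>
  The first octahedron has the rim 1, 2, 3, 0, which is the rim of \<open>4 vertex\<close> with its own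
  numerals. The second one has the rim 3, 4, 5, 0: here the label 0 is \<open>Rim 0\<close> and the labels
  3, 4, 5 are \<open>Rim 1\<close>, \<open>Rim 2\<close>, \<open>Rim 3\<close>.
\<close>

definition fitting_pair :: "(4 vertex \<Rightarrow> real ^ 3) \<Rightarrow> (4 vertex \<Rightarrow> real ^ 3) \<Rightarrow> bool" where
  "fitting_pair \<rho>\<^sub>k \<rho>\<^sub>p \<longleftrightarrow>
     \<rho>\<^sub>k (Rim 0) = \<rho>\<^sub>p (Rim 0) \<and> \<rho>\<^sub>k (Rim 3) = \<rho>\<^sub>p (Rim 1) \<and>
     \<rho>\<^sub>k Apex_T = \<rho>\<^sub>p Apex_T \<and> \<rho>\<^sub>k Apex_B = \<rho>\<^sub>p Apex_B \<and>
     collinear {\<rho>\<^sub>k (Rim 0), \<rho>\<^sub>k (Rim 1), \<rho>\<^sub>p (Rim 3)}"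

definition combine ::
    "(4 vertex \<Rightarrow> real ^ 3) \<Rightarrow> (4 vertex \<Rightarrow> real ^ 3) \<Rightarrow> 5 vertex \<Rightarrow> real ^ 3" where
  "combine \<rho>\<^sub>k \<rho>\<^sub>p v =
     (case v of
        Apex_T \<Rightarrow> \<rho>\<^sub>k Apex_T
      | Apex_B \<Rightarrow> \<rho>\<^sub>k Apex_B
      | Rim i \<Rightarrow>
          (if i = 1 then \<rho>\<^sub>k (Rim 1) else if i = 2 then \<rho>\<^sub>k (Rim 2) else if i = 3 then \<rho>\<^sub>k (Rim 3)
           else if i = 4 then \<rho>\<^sub>p (Rim 2) else \<rho>\<^sub>p (Rim 3)))"

definition nelson_construction ::
    "(4 vertex \<Rightarrow> real ^ 3) \<Rightarrow> (real \<Rightarrow> 4 vertex \<Rightarrow> real ^ 3) \<Rightarrow>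
     (4 vertex \<Rightarrow> real ^ 3) \<Rightarrow> (real \<Rightarrow> 4 vertex \<Rightarrow> real ^ 3) \<Rightarrow>
     (5 vertex \<Rightarrow> real ^ 3) \<Rightarrow> (real \<Rightarrow> 5 vertex \<Rightarrow> real ^ 3) \<Rightarrow> bool" where
  "nelson_construction \<rho>\<^sub>k f\<^sub>k \<rho>\<^sub>p f\<^sub>p \<rho> f \<longleftrightarrow>
     flex \<rho>\<^sub>k f\<^sub>k \<and> flex \<rho>\<^sub>p f\<^sub>p \<and> (\<forall>t\<in>{0..<1}. fitting_pair (f\<^sub>k t) (f\<^sub>p t)) \<and>
     \<rho> = combine \<rho>\<^sub>k \<rho>\<^sub>p \<and> f = (\<lambda>t. combine (f\<^sub>k t) (f\<^sub>p t)) \<and> flex \<rho> f"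


section \<open>The Galois group of a motion\<close>

definition base_field :: "5 cm_space set \<Rightarrow> 5 cm_space ratfun set" where
  "base_field M = generate_field (function_field M)
     (insert (regular_fun M (d_coord Apex_T Apex_B)) (range (\<lambda>c. regular_fun M (\<lambda>x. c))))"

definition galois_group :: "5 cm_space set \<Rightarrow> (5 cm_space ratfun \<Rightarrow> 5 cm_space ratfun) monoid" where
  "galois_group M = (BijGroup (carrier (function_field M)))
     \<lparr>carrier := {\<phi> \<in> Bij (carrier (function_field M)).
        \<phi> \<in> ring_iso (function_field M) (function_field M) \<and> (\<forall>x\<in>base_field M. \<phi> x = x)}\<rparr>"

definition s_fun :: "5 cm_space set \<Rightarrow> 5 \<Rightarrow> 5 cm_space ratfun" where
  "s_fun M i = regular_fun M (s_coord i)"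

definition galois_tuple ::
    "5 cm_space set \<Rightarrow> (5 cm_space ratfun \<Rightarrow> 5 cm_space ratfun) \<Rightarrow> bit ^ 5" where
  "galois_tuple M \<phi> =
     (\<chi> i. if \<phi> (s_fun M i) = \<ominus>\<^bsub>function_field M\<^esub> (s_fun M i) then 1 else 0)"

definition Z2_tuples :: "(bit ^ 5) monoid" where
  "Z2_tuples = \<lparr>carrier = UNIV, monoid.mult = (+), one = 0\<rparr>"

definition has_galois_group :: "5 cm_space set \<Rightarrow> (bit ^ 5) set \<Rightarrow> bool" where
  "has_galois_group M H \<longleftrightarrow>
     (\<forall>\<phi>\<in>carrier (galois_group M). \<forall>i.
        \<phi> (s_fun M i) = s_fun M i \<or> \<phi> (s_fun M i) = \<ominus>\<^bsub>function_field M\<^esub> (s_fun M i)) \<and>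
     galois_tuple M \<in> iso (galois_group M) (Z2_tuples\<lparr>carrier := H\<rparr>)"

end

theory Submission
  imports Defs
begin

text \<open>
  In a Type III octahedron all tetrahedra \<open>(i, i + 1, T, B)\<close> become flat at the same two squared axis
  lengths \<open>x1\<close> and \<open>x2\<close>. Every squared volume is then a constant multiple of
  \<open>(x - x1) * (x2 - x)\<close>, and the motion is a rational curve over the ellipse
  \<open>y\<^sup>2 = (x - x1) * (x2 - x)\<close> on which the oriented volumes are constant multiples of \<open>y\<close> and all
  distances are rational in \<open>x\<close>. The function field is \<open>\<real>(x, y)\<close>, and the only non-trivial automorphism
  over \<open>\<real>(x)\<close> changes the sign of \<open>y\<close>, hence of all oriented volumes at once.

  Both octahedra share the tetrahedron \<open>(0, 3, T, B)\<close>, hence the same \<open>x1\<close> and \<open>x2\<close>. In the flat pose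
  the line \<open>01\<close> is the mirror image of the line \<open>03\<close> in a bisector of the angle \<open>T0B\<close>, and so is the
  line \<open>05\<close>; choosing the same bisector for both octahedra makes 0, 1, 5 collinear throughout the motion.
  The numerical example is obtained from \<open>|0T| = 3\<close>, \<open>|0B| = |03| = |3B| = 7\<close>, \<open>|3T| = 8\<close>, for which
  \<open>x1 = 25\<close> and \<open>x2 = 97\<close>.
\<close>

section \<open>Polynomial functions and Zariski closed sets\<close>

text \<open>The obstacle is that \<open>CM_var\<close> is a Zariski closure without known equations,
  whereas a motion has to be a whole component of \<open>K_var\<close>. Two families of polynomial
  identities are carried over from realizations to the closure: one for the square of each oriented
  volume, one for the product of two consecutive volumes. They suffice because the edges and the
  axis fix each volume up to sign, and on an irreducible set a sign can be chosen once for all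
  points, so a single point of the ellipse decides it. The diagonals are then quotients whose
  denominators stay nonzero between \<open>x1\<close> and \<open>x2\<close>. Irreducibility and
  dimension come from the rational charts: a polynomial on the curve vanishes identically or at
  finitely many points. The numbers are rational because the triangles with sides 3, 7, 8 and 7, 7,
  7, glued along the edge from 0 to 3, both have an area that is a rational multiple of the square
  root of 3; unfolding them in the plane to opposite sides or to the same side of that edge gives 97
  and 25.\<close>

lemma zariski_closed_zero_set:
  assumes "real_polynomial_function f"
  shows "zariski_closed {x. f x = 0}"
  unfolding zariski_closed_def using assms by (intro exI[of _ "{f}"]) auto

lemma zariski_closed_INT:
  assumes "\<And>i. i \<in> I \<Longrightarrow> zariski_closed (S i)"
  shows "zariski_closed {x. \<forall>i\<in>I. x \<in> S i}"
proof -
  define P where "P i = (SOME P. (\<forall>f\<in>P. real_polynomial_function f) \<and> S i = {x. \<forall>f\<in>P. f x = 0})" for i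
  have P: "(\<forall>f\<in>P i. real_polynomial_function f) \<and> S i = {x. \<forall>f\<in>P i. f x = 0}" if "i \<in> I" for i
    using assms[OF that] unfolding zariski_closed_def P_def by (rule someI_ex)
  show ?thesis unfolding zariski_closed_def
  proof (intro exI conjI)
    show "\<forall>f\<in>\<Union>i\<in>I. P i. real_polynomial_function f" using P by blast
    show "{x. \<forall>i\<in>I. x \<in> S i} = {x. \<forall>f\<in>\<Union>i\<in>I. P i. f x = 0}"
    proof (rule Set.set_eqI)
      fix x
      have "x \<in> S i \<longleftrightarrow> (\<forall>f\<in>P i. f x = 0)" if "i \<in> I" for i using P[OF that] by blast
      then show "x \<in> {x. \<forall>i\<in>I. x \<in> S i} \<longleftrightarrow> x \<in> {x. \<forall>f\<in>\<Union>i\<in>I. P i. f x = 0}" by simp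
    qed
  qed
qed

lemma zariski_closed_Int:
  assumes "zariski_closed S" "zariski_closed T"
  shows "zariski_closed (S \<inter> T)"
proof -
  have "{x. \<forall>i\<in>{S, T}. x \<in> i} = S \<inter> T" by auto
  then show ?thesis using zariski_closed_INT[of "{S, T}" "\<lambda>i. i"] assms by auto
qed

lemma zariski_closed_Un:
  assumes "zariski_closed S" "zariski_closed T"
  shows "zariski_closed (S \<union> T)"
proof -
  obtain P where P: "\<forall>f\<in>P. real_polynomial_function f" "S = {x. \<forall>f\<in>P. f x = 0}"
    using assms(1) unfolding zariski_closed_def by auto
  obtain Q where Q: "\<forall>f\<in>Q. real_polynomial_function f" "T = {x. \<forall>f\<in>Q. f x = 0}"
    using assms(2) unfolding zariski_closed_def by auto
  show ?thesis unfolding zariski_closed_def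
  proof (intro exI conjI)
    show "\<forall>h\<in>{\<lambda>x. f x * g x |f g. f \<in> P \<and> g \<in> Q}. real_polynomial_function h"
      using P(1) Q(1) by (auto intro!: real_polynomial_function.intros(4))
    show "S \<union> T = {x. \<forall>h\<in>{\<lambda>x. f x * g x |f g. f \<in> P \<and> g \<in> Q}. h x = 0}"
    proof (intro subset_antisym subsetI)
      fix x assume x: "x \<in> {x. \<forall>h\<in>{\<lambda>x. f x * g x |f g. f \<in> P \<and> g \<in> Q}. h x = 0}"
      have "f x * g x = 0" if "f \<in> P" "g \<in> Q" for f g
      proof -
        have "(\<lambda>x. f x * g x) \<in> {\<lambda>x. f x * g x |f g. f \<in> P \<and> g \<in> Q}" using that by blast
        then show ?thesis using x by (simp only: mem_Collect_eq Ball_def) blast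
      qed
      then have "(\<forall>f\<in>P. f x = 0) \<or> (\<forall>g\<in>Q. g x = 0)" by (metis mult_eq_0_iff)
      then show "x \<in> S \<union> T" using P(2) Q(2) by blast
    next
      fix x assume "x \<in> S \<union> T"
      then have "(\<forall>f\<in>P. f x = 0) \<or> (\<forall>g\<in>Q. g x = 0)" using P(2) Q(2) by blast
      then show "x \<in> {x. \<forall>h\<in>{\<lambda>x. f x * g x |f g. f \<in> P \<and> g \<in> Q}. h x = 0}" by fastforce
    qed
  qed
qed

lemma zariski_closed_empty: "zariski_closed {}"
  unfolding zariski_closed_def by (rule exI[of _ "{\<lambda>x. 1}"]) auto

lemma zariski_closed_singleton: "zariski_closed {a}"
proof -
  have "real_polynomial_function (\<lambda>x. x \<bullet> b - a \<bullet> b)" for b :: 'a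
    using real_polynomial_function_diff[OF real_polynomial_function.intros(1)[OF bounded_linear_inner_left]
        real_polynomial_function.intros(2)] .
  then have "zariski_closed {x. \<forall>b\<in>Basis. x \<in> {x. x \<bullet> b - a \<bullet> b = 0}}"
    by (intro zariski_closed_INT zariski_closed_zero_set)
  moreover have "{x. \<forall>b\<in>Basis. x \<in> {x. x \<bullet> b - a \<bullet> b = 0}} = {a}"
    by (auto simp: euclidean_eq_iff[where 'a='a])
  ultimately show ?thesis by simp
qed

lemma zariski_closed_finite: "finite S \<Longrightarrow> zariski_closed S"
proof (induction S rule: finite_induct)
  case (insert a S)
  then show ?case using zariski_closed_Un[OF zariski_closed_singleton[of a]] by simp
qed (simp add: zariski_closed_empty)

text \<open>The upper bound on \<open>CM_var\<close>: an identity checked on all realizations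
  persists on the closure.\<close>

lemma vanishes_on_zariski_hull:
  assumes "real_polynomial_function f" "\<And>x. x \<in> S \<Longrightarrow> f x = 0" "x \<in> zariski_closed hull S"
  shows "f x = 0"
proof -
  have "zariski_closed hull S \<subseteq> {x. f x = 0}"
    using assms by (intro hull_minimal zariski_closed_zero_set) auto
  then show ?thesis using assms by auto
qed

lemma irreducible_set_singleton: "irreducible_set {a}"
  unfolding irreducible_set_def
proof (intro conjI allI impI)
  fix A B assume "zariski_closed A \<and> zariski_closed B \<and> {a} = A \<union> B"
  then have "A \<subseteq> {a}" "B \<subseteq> {a}" "a \<in> A \<or> a \<in> B" by blast+
  then show "{a} = A \<or> {a} = B" by blast
qed (auto simp: zariski_closed_singleton)

lemma finite_irreducible_set:
  assumes "irreducible_set S" "finite S"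
  obtains a where "S = {a}"
proof -
  obtain a where "a \<in> S" using assms unfolding irreducible_set_def by auto
  then have "S = {a} \<union> (S - {a})" by auto
  then have "S = {a} \<or> S = S - {a}"
    using assms(1) zariski_closed_singleton zariski_closed_finite[of "S - {a}"] assms(2)
    unfolding irreducible_set_def by blast
  then show ?thesis using \<open>a \<in> S\<close> that by blast
qed

text \<open>Primality of the vanishing ideal. It later serves to choose a sign for the whole set at
  once and to cancel a factor that is not identically zero.\<close>

lemma irreducible_set_mult_zero:
  assumes "irreducible_set M" "real_polynomial_function f" "real_polynomial_function g"
    and "\<And>x. x \<in> M \<Longrightarrow> f x * g x = 0"
  shows "(\<forall>x\<in>M. f x = 0) \<or> (\<forall>x\<in>M. g x = 0)"
proof -
  have "zariski_closed (M \<inter> {x. f x = 0})" "zariski_closed (M \<inter> {x. g x = 0})"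
    using assms unfolding irreducible_set_def
    by (auto intro!: zariski_closed_Int zariski_closed_zero_set)
  moreover have "M = (M \<inter> {x. f x = 0}) \<union> (M \<inter> {x. g x = 0})" using assms(4) by auto
  ultimately have "M = M \<inter> {x. f x = 0} \<or> M = M \<inter> {x. g x = 0}"
    using assms(1) unfolding irreducible_set_def by blast
  then show ?thesis by blast
qed

section \<open>Rational curves\<close>

text \<open>The denominator has no real zero, so these are total functions and no domain of
  definition has to be tracked; division accordingly asks for a nowhere vanishing divisor.\<close>

definition rational_fun :: "(real \<Rightarrow> real) \<Rightarrow> bool" where
  "rational_fun f \<longleftrightarrow> (\<exists>p q. (\<forall>t. poly q t \<noteq> 0) \<and> (\<forall>t. f t = poly p t / poly q t))"

lemma rational_fun_const: "rational_fun (\<lambda>t. c)"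
  unfolding rational_fun_def by (rule exI[of _ "[:c:]"], rule exI[of _ 1]) simp

lemma rational_fun_id: "rational_fun (\<lambda>t. t)"
  unfolding rational_fun_def by (rule exI[of _ "[:0, 1:]"], rule exI[of _ 1]) simp

lemma rational_fun_add:
  assumes "rational_fun f" "rational_fun g"
  shows "rational_fun (\<lambda>t. f t + g t)"
proof -
  obtain p q where pq: "\<forall>t. poly q t \<noteq> 0" "\<forall>t. f t = poly p t / poly q t"
    using assms(1) unfolding rational_fun_def by auto
  obtain r s where rs: "\<forall>t. poly s t \<noteq> 0" "\<forall>t. g t = poly r t / poly s t"
    using assms(2) unfolding rational_fun_def by auto
  show ?thesis unfolding rational_fun_def
    by (rule exI[of _ "p * s + r * q"], rule exI[of _ "q * s"]) (use pq rs in \<open>simp add: field_simps\<close>)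
qed

lemma rational_fun_mult:
  assumes "rational_fun f" "rational_fun g"
  shows "rational_fun (\<lambda>t. f t * g t)"
proof -
  obtain p q where pq: "\<forall>t. poly q t \<noteq> 0" "\<forall>t. f t = poly p t / poly q t"
    using assms(1) unfolding rational_fun_def by auto
  obtain r s where rs: "\<forall>t. poly s t \<noteq> 0" "\<forall>t. g t = poly r t / poly s t"
    using assms(2) unfolding rational_fun_def by auto
  show ?thesis unfolding rational_fun_def
    by (rule exI[of _ "p * r"], rule exI[of _ "q * s"]) (use pq rs in \<open>simp add: field_simps\<close>)
qed

lemma rational_fun_inverse:
  assumes "rational_fun f" "\<And>t. f t \<noteq> 0"
  shows "rational_fun (\<lambda>t. inverse (f t))"
proof -
  obtain p q where pq: "\<forall>t. poly q t \<noteq> 0" "\<forall>t. f t = poly p t / poly q t"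
    using assms(1) unfolding rational_fun_def by auto
  show ?thesis unfolding rational_fun_def
  proof (intro exI conjI allI)
    show "poly p t \<noteq> 0" for t using pq(2) assms(2)[of t] by auto
    show "inverse (f t) = poly q t / poly p t" for t by (simp add: pq(2)[rule_format])
  qed
qed

lemma rational_fun_divide:
  assumes "rational_fun f" "rational_fun g" "\<And>t. g t \<noteq> 0"
  shows "rational_fun (\<lambda>t. f t / g t)"
  using rational_fun_mult[OF assms(1) rational_fun_inverse[OF assms(2,3)]]
  by (simp add: divide_inverse)

lemma rational_fun_diff:
  assumes "rational_fun f" "rational_fun g"
  shows "rational_fun (\<lambda>t. f t - g t)"
  using rational_fun_add[OF assms(1) rational_fun_mult[OF rational_fun_const[of "-1"] assms(2)]] by simp

lemma rational_fun_power:
  assumes "rational_fun f"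
  shows "rational_fun (\<lambda>t. f t ^ n)"
  by (induction n) (auto intro!: rational_fun_mult assms rational_fun_const)

lemma rational_fun_sum:
  assumes "\<And>i. i \<in> I \<Longrightarrow> rational_fun (f i)"
  shows "rational_fun (\<lambda>t. \<Sum>i\<in>I. f i t)"
  using assms by (induction I rule: infinite_finite_induct) (auto intro: rational_fun_const rational_fun_add)

lemmas rational_fun_intros = rational_fun_const rational_fun_id rational_fun_add rational_fun_mult
  rational_fun_divide rational_fun_diff rational_fun_power rational_fun_sum

lemma rational_fun_zeros:
  assumes "rational_fun f"
  shows "finite {t. f t = 0} \<or> (\<forall>t. f t = 0)"
proof -
  obtain p q where pq: "\<forall>t. poly q t \<noteq> 0" "\<forall>t. f t = poly p t / poly q t"
    using assms(1) unfolding rational_fun_def by auto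
  then have "f t = 0 \<longleftrightarrow> poly p t = 0" for t by auto
  then show ?thesis using poly_roots_finite[of p] by (cases "p = 0") auto
qed

lemma rational_fun_poly:
  assumes "real_polynomial_function f" "\<And>b. b \<in> Basis \<Longrightarrow> rational_fun (\<lambda>t. \<gamma> t \<bullet> b)"
  shows "rational_fun (\<lambda>t. f (\<gamma> t))"
  using assms(1)
proof induction
  case (linear f)
  have "f (\<gamma> t) = (\<Sum>b\<in>Basis. (\<gamma> t \<bullet> b) * f b)" for t
  proof -
    interpret bounded_linear f by (rule linear)
    have "f (\<gamma> t) = f (\<Sum>b\<in>Basis. (\<gamma> t \<bullet> b) *\<^sub>R b)" by (simp add: euclidean_representation)
    then show ?thesis by (simp add: sum scaleR)
  qed
  then show ?case using assms(2) by (simp add: rational_fun_intros)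
qed (auto intro: rational_fun_intros)

lemma rational_fun_poly_real:
  assumes "real_polynomial_function f"
  shows "rational_fun f"
  using rational_fun_poly[OF assms, of "\<lambda>t. t"] by (simp add: rational_fun_id)

text \<open>
  Two charts are needed because a real conic such as the ellipse is not the image of
  a single everywhere defined rational parametrisation of the line.
\<close>

locale rational_curve =
  fixes M :: "'a::euclidean_space set" and \<gamma> \<gamma>' :: "real \<Rightarrow> 'a"
  assumes rational: "\<And>b. b \<in> Basis \<Longrightarrow> rational_fun (\<lambda>t. \<gamma> t \<bullet> b)"
    and rational': "\<And>b. b \<in> Basis \<Longrightarrow> rational_fun (\<lambda>t. \<gamma>' t \<bullet> b)"
    and charts: "\<And>t. t \<noteq> 0 \<Longrightarrow> \<gamma>' t = \<gamma> (inverse t)"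
    and cover: "M = insert (\<gamma>' 0) (range \<gamma>)"
    and closed: "zariski_closed M"
    and infinite: "infinite M"
begin

text \<open>Along \<open>\<gamma>\<close> a polynomial becomes a rational function of one variable.
  The point \<open>\<gamma>' 0\<close> is reached through the second chart: vanishing for all
  nonzero parameters means infinitely many zeros, hence also a zero at 0.\<close>

lemma zeros:
  assumes "real_polynomial_function f"
  shows "finite {p \<in> M. f p = 0} \<or> (\<forall>p\<in>M. f p = 0)"
proof (cases "\<forall>t. f (\<gamma> t) = 0")
  case True
  have "- {0} \<subseteq> {t. f (\<gamma>' t) = 0}" using charts True by auto
  moreover have "\<not> finite (- {0 :: real})" by (simp add: infinite_UNIV_char_0)
  ultimately have "\<not> finite {t. f (\<gamma>' t) = 0}" using finite_subset by blast
  then have "f (\<gamma>' 0) = 0"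
    using rational_fun_zeros[OF rational_fun_poly[OF assms rational']] by auto
  then show ?thesis using True cover by auto
next
  case False
  then have "finite {t. f (\<gamma> t) = 0}"
    using rational_fun_zeros[OF rational_fun_poly[OF assms rational]] by auto
  moreover have "{p \<in> M. f p = 0} \<subseteq> insert (\<gamma>' 0) (\<gamma> ` {t. f (\<gamma> t) = 0})"
    using cover by auto
  ultimately show ?thesis by (meson finite.insertI finite_imageI finite_subset)
qed

text \<open>One equation that is not identically zero on \<open>M\<close> already leaves finitely
  many points. Together with \<open>infinite\<close> this gives irreducibility and
  dimension.\<close>

lemma closed_subset:
  assumes "zariski_closed Z" "Z \<subset> M"
  shows "finite Z"
proof -
  obtain P where P: "\<forall>f\<in>P. real_polynomial_function f" "Z = {x. \<forall>f\<in>P. f x = 0}"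
    using assms(1) unfolding zariski_closed_def by auto
  then obtain f where f: "f \<in> P" "\<not> (\<forall>p\<in>M. f p = 0)" using assms(2) by blast
  then have "finite {p \<in> M. f p = 0}" using zeros P by blast
  then show ?thesis by (rule finite_subset[rotated]) (use P f assms in auto)
qed

lemma irreducible: "irreducible_set M"
  unfolding irreducible_set_def
proof (intro conjI allI impI)
  show "zariski_closed M" by (rule closed)
  show "M \<noteq> {}" using infinite by auto
  fix A B assume AB: "zariski_closed A \<and> zariski_closed B \<and> M = A \<union> B"
  show "M = A \<or> M = B"
  proof (rule ccontr)
    assume "\<not> (M = A \<or> M = B)"
    then have "A \<subset> M" "B \<subset> M" using AB by auto
    then have "finite A" "finite B" using closed_subset AB by auto
    then show False using AB infinite by auto
  qed
qed

lemma dim: "zariski_dim M = 1"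
proof -
  have le: "n \<le> 1" if Z: "\<forall>i\<le>n. irreducible_set (Z i) \<and> Z i \<subseteq> M" "\<forall>i<n. Z i \<subset> Z (Suc i)"
    for n and Z :: "nat \<Rightarrow> 'a set"
  proof (rule ccontr)
    assume n: "\<not> n \<le> 1"
    \<comment> \<open>In a longer chain \<open>Z 1\<close> would be finite and irreducible, hence a
      single point, leaving only the empty set for \<open>Z 0\<close>.\<close>
    then have "Z 0 \<subset> Z 1" "Z 1 \<subset> Z 2" "Z 2 \<subseteq> M" "irreducible_set (Z 0)" "irreducible_set (Z 1)"
      using Z[rule_format, of 0] Z(2)[rule_format, of 1] Z(1)[rule_format, of 0] Z(1)[rule_format, of 1]
        Z(1)[rule_format, of 2] Z(2)[rule_format, of 0] by (auto simp: numeral_2_eq_2)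
    moreover from this have "finite (Z 1)"
      by (intro closed_subset) (auto simp: irreducible_set_def)
    ultimately obtain a where "Z 1 = {a}" using finite_irreducible_set by metis
    then have "Z 0 = {}" using \<open>Z 0 \<subset> Z 1\<close> by auto
    then show False using \<open>irreducible_set (Z 0)\<close> by (simp add: irreducible_set_def)
  qed
  obtain a where a: "a \<in> M" using infinite by (metis finite.emptyI ex_in_conv)
  define Z where "Z = (\<lambda>i. if i = (0::nat) then {a} else M)"
  have "\<forall>i\<le>1. irreducible_set (Z i) \<and> Z i \<subseteq> M"
    using irreducible irreducible_set_singleton a by (auto simp: Z_def)
  moreover have "{a} \<noteq> M" using infinite by auto
  then have "\<forall>i<1. Z i \<subset> Z (Suc i)" using a by (auto simp: Z_def)
  ultimately have "enat 1 \<in> {enat n |n. \<exists>Z :: nat \<Rightarrow> 'a set.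
     (\<forall>i\<le>n. irreducible_set (Z i) \<and> Z i \<subseteq> M) \<and> (\<forall>i<n. Z i \<subset> Z (Suc i))}"
    by blast
  then have "enat 1 \<le> zariski_dim M" unfolding zariski_dim_def by (rule Sup_upper)
  moreover have "zariski_dim M \<le> enat 1"
    unfolding zariski_dim_def by (rule Sup_least) (use le in auto)
  ultimately show ?thesis by (simp add: one_enat_def)
qed

end

section \<open>Cayley--Menger relations of a bipyramid\<close>

lemma real_polynomial_function_d_coord: "real_polynomial_function (d_coord u v)"
  unfolding d_coord_def
  by (intro real_polynomial_function.intros(1) bounded_linear_compose[OF bounded_linear_vec_nth]
      bounded_linear_fst)

lemma real_polynomial_function_s_coord: "real_polynomial_function (s_coord i)"
  unfolding s_coord_def
  by (intro real_polynomial_function.intros(1) bounded_linear_compose[OF bounded_linear_vec_nth]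
      bounded_linear_snd)

lemma vpair_cases:
  obtains u v where "u \<noteq> v" "e = Abs_vpair {u, v}"
proof -
  obtain u v where "Rep_vpair e = {u, v}" "u \<noteq> v"
    using Rep_vpair[of e] by (auto simp: card_2_iff)
  then show ?thesis using that[of u v] Rep_vpair_inverse[of e] by simp
qed

lemma cm_space_eqI:
  fixes p q :: "'n::finite cm_space"
  assumes "\<And>u v. u \<noteq> v \<Longrightarrow> d_coord u v p = d_coord u v q" "\<And>i. s_coord i p = s_coord i q"
  shows "p = q"
proof (rule prod_eqI)
  show "fst p = fst q" unfolding vec_eq_iff
  proof
    fix e :: "'n vpair"
    show "fst p $ e = fst q $ e" using assms(1) by (cases e rule: vpair_cases) (simp add: d_coord_def)
  qed
  show "snd p = snd q" using assms(2) by (simp add: vec_eq_iff s_coord_def)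
qed

lemma cm_space_Basis_cases:
  fixes b :: "'n::finite cm_space"
  assumes "b \<in> Basis"
  obtains u v where "u \<noteq> v" "\<And>p. p \<bullet> b = d_coord u v p" | i where "\<And>p. p \<bullet> b = s_coord i p"
proof -
  from assms consider e where "b = (axis e 1, 0)" | i where "b = (0, axis i 1)"
    by (auto simp: Basis_prod_def Basis_vec_def)
  then show thesis
  proof cases
    case 1
    obtain u v where uv: "u \<noteq> v" "e = Abs_vpair {u, v}" by (rule vpair_cases)
    show thesis by (rule that(1)[OF uv(1)]) (simp add: 1 uv inner_prod_def inner_axis d_coord_def)
  next
    case 2
    show thesis by (rule that(2)[of i]) (simp add: 2 inner_prod_def inner_axis s_coord_def)
  qed
qed

text \<open>
  With \<open>a\<^sub>i = \<rho> i - \<rho> B\<close> and \<open>e = \<rho> T - \<rho> B\<close>, the functions below are \<open>a\<^sub>i \<bullet> e\<close>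
  and the Gram entries of the vectors \<open>a\<^sub>i \<times> e\<close>, which are the projections of the rim vertices along
  the axis, rotated by a right angle and scaled by the length of \<open>e\<close>.
\<close>

definition axial :: "'n::finite \<Rightarrow> 'n cm_space \<Rightarrow> real" where
  "axial i p = (d_coord (Rim i) Apex_B p + d_coord Apex_T Apex_B p - d_coord (Rim i) Apex_T p) / 2"

definition radial :: "'n::finite \<Rightarrow> 'n cm_space \<Rightarrow> real" where
  "radial i p = d_coord Apex_T Apex_B p * d_coord (Rim i) Apex_B p - (axial i p)\<^sup>2"

definition cross_gram :: "'n::finite \<Rightarrow> 'n \<Rightarrow> 'n cm_space \<Rightarrow> real" where
  "cross_gram i j p = d_coord Apex_T Apex_B p *
     (d_coord (Rim i) Apex_B p + d_coord (Rim j) Apex_B p - d_coord (Rim i) (Rim j) p) / 2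
     - axial i p * axial j p"

lemmas polynomial_intros = real_polynomial_function.intros(2,3,4) real_polynomial_function_diff
  real_polynomial_function_power real_polynomial_function_d_coord real_polynomial_function_s_coord

lemma real_polynomial_function_divide_const:
  assumes "real_polynomial_function f"
  shows "real_polynomial_function (\<lambda>x. f x / c)"
  using real_polynomial_function.intros(4)[OF assms real_polynomial_function.intros(2)[of "inverse c"]]
  by (simp add: divide_inverse)

lemma real_polynomial_function_axial: "real_polynomial_function (axial i)"
  unfolding axial_def by (intro real_polynomial_function_divide_const polynomial_intros)

lemma real_polynomial_function_radial: "real_polynomial_function (radial i)"
  unfolding radial_def by (intro polynomial_intros real_polynomial_function_axial)

lemma real_polynomial_function_cross_gram: "real_polynomial_function (cross_gram i j)"
  unfolding cross_gram_def
  by (intro real_polynomial_function_divide_const polynomial_intros real_polynomial_function_axial)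

lemma power2_norm_diff_inner: "(norm (a - b))\<^sup>2 = a \<bullet> a + b \<bullet> b - 2 * (a \<bullet> b)"
  for a b :: "'a::real_inner"
  by (simp add: power2_norm_eq_inner inner_diff_left inner_diff_right inner_commute)

lemma axial_cm_point:
  "axial i (cm_point \<rho>) = (\<rho> (Rim i) - \<rho> Apex_B) \<bullet> (\<rho> Apex_T - \<rho> Apex_B)"
  by (simp add: axial_def d_coord_cm_point power2_norm_diff_inner inner_diff_left inner_diff_right
      inner_commute field_simps)

lemma radial_cm_point:
  "radial i (cm_point \<rho>) =
     cross3 (\<rho> (Rim i) - \<rho> Apex_B) (\<rho> Apex_T - \<rho> Apex_B) \<bullet>
     cross3 (\<rho> (Rim i) - \<rho> Apex_B) (\<rho> Apex_T - \<rho> Apex_B)"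
  by (simp add: radial_def axial_cm_point d_coord_cm_point dot_cross power2_norm_eq_inner
      power2_eq_square[of "_ \<bullet> _"] inner_commute)

lemma cross_gram_cm_point:
  assumes "i \<noteq> j"
  shows "cross_gram i j (cm_point \<rho>) =
     cross3 (\<rho> (Rim i) - \<rho> Apex_B) (\<rho> Apex_T - \<rho> Apex_B) \<bullet>
     cross3 (\<rho> (Rim j) - \<rho> Apex_B) (\<rho> Apex_T - \<rho> Apex_B)"
proof -
  have *: "(norm (a - c))\<^sup>2 + (norm (b - c))\<^sup>2 - (norm (a - b))\<^sup>2 = 2 * ((a - c) \<bullet> (b - c))"
    for a b c :: "real ^ 3"
    by (simp add: power2_norm_diff_inner inner_diff_left inner_diff_right inner_commute)
  show ?thesis
    using assms by (simp add: cross_gram_def axial_cm_point d_coord_cm_point dot_cross *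
        power2_norm_eq_inner[of "\<rho> Apex_T - \<rho> Apex_B"] inner_commute)
qed

text \<open>Both inner products are orthogonal to \<open>e\<close>, so their cross product is a
  multiple of \<open>e\<close>; the factor is six times an oriented volume. This links the Gram
  entries to the volumes.\<close>

lemma cross_cross_common:
  "cross3 (cross3 a e) (cross3 b e) = det (vector [a, b, e]) *\<^sub>R e"
  by (simp add: cross_cross_det det_3 algebra_simps)

lemma six_s_coord_cm_point:
  "det (vector [\<rho> (Rim i) - \<rho> Apex_B, \<rho> (Rim (i + 1)) - \<rho> Apex_B, \<rho> Apex_T - \<rho> Apex_B]) =
     6 * s_coord i (cm_point \<rho>)"
  by (simp add: s_coord_cm_point oriented_volume_def)

text \<open>Lagrange's identity for the rotated projections of two consecutive rim vertices: edges
  and axis determine the volume up to sign.\<close>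

lemma s_coord_square_cm_point:
  fixes \<rho> :: "'n::{finite,comm_ring_1} vertex \<Rightarrow> real ^ 3"
  defines "p \<equiv> cm_point \<rho>"
  shows "36 * d_coord Apex_T Apex_B p * (s_coord i p)\<^sup>2 =
    radial i p * radial (i + 1) p - (cross_gram i (i + 1) p)\<^sup>2"
proof -
  define a where "a = \<rho> (Rim i) - \<rho> Apex_B"
  define b where "b = \<rho> (Rim (i + 1)) - \<rho> Apex_B"
  define e where "e = \<rho> Apex_T - \<rho> Apex_B"
  have "cross3 (cross3 a e) (cross3 b e) \<bullet> cross3 (cross3 a e) (cross3 b e) =
      (det (vector [a, b, e]))\<^sup>2 * (e \<bullet> e)"
    unfolding cross_cross_common by (simp add: power2_eq_square)
  then have "(cross3 a e \<bullet> cross3 a e) * (cross3 b e \<bullet> cross3 b e) - (cross3 a e \<bullet> cross3 b e)\<^sup>2 =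
      (6 * s_coord i p)\<^sup>2 * (e \<bullet> e)"
    unfolding a_def b_def e_def p_def six_s_coord_cm_point
    by (simp add: dot_cross[of "cross3 _ _"] power2_eq_square inner_commute)
  then show ?thesis
    unfolding a_def b_def e_def p_def
    by (simp add: radial_cm_point cross_gram_cm_point d_coord_cm_point power2_norm_eq_inner
        power_mult_distrib)
qed

text \<open>The Binet-Cauchy identity for three consecutive rim vertices. Divided by
  \<open>radial (i + 1) p\<close>, it yields the diagonal from \<open>Rim i\<close> to
  \<open>Rim (i + 2)\<close>; the assumption on 2 makes these two vertices distinct.\<close>

lemma s_coord_mult_cm_point:
  fixes \<rho> :: "'n::{finite,comm_ring_1} vertex \<Rightarrow> real ^ 3"
  defines "p \<equiv> cm_point \<rho>"
  assumes "(2 :: 'n) \<noteq> 0"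
  shows "radial (i + 1) p * cross_gram i (i + 2) p =
    cross_gram i (i + 1) p * cross_gram (i + 1) (i + 2) p
    - 36 * d_coord Apex_T Apex_B p * (s_coord i p * s_coord (i + 1) p)"
proof -
  define a where "a = \<rho> (Rim i) - \<rho> Apex_B"
  define b where "b = \<rho> (Rim (i + 1)) - \<rho> Apex_B"
  define c where "c = \<rho> (Rim (i + 2)) - \<rho> Apex_B"
  define e where "e = \<rho> Apex_T - \<rho> Apex_B"
  have [simp]: "i + 1 + 1 = i + 2" by (simp add: add.assoc)
  have "cross3 (cross3 a e) (cross3 b e) \<bullet> cross3 (cross3 b e) (cross3 c e) =
      det (vector [a, b, e]) * det (vector [b, c, e]) * (e \<bullet> e)"
    unfolding cross_cross_common by simp
  moreover have "det (vector [a, b, e]) = 6 * s_coord i p"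
    "det (vector [b, c, e]) = 6 * s_coord (i + 1) p"
    using six_s_coord_cm_point[of \<rho> i] six_s_coord_cm_point[of \<rho> "i + 1"]
    by (simp_all add: a_def b_def c_def e_def p_def)
  ultimately have "(cross3 a e \<bullet> cross3 b e) * (cross3 b e \<bullet> cross3 c e)
      - (cross3 a e \<bullet> cross3 c e) * (cross3 b e \<bullet> cross3 b e) =
      36 * (s_coord i p * s_coord (i + 1) p) * (e \<bullet> e)"
    by (simp add: dot_cross[of "cross3 _ _"])
  then show ?thesis
    unfolding a_def b_def c_def e_def p_def
    using assms(2) by (simp add: radial_cm_point cross_gram_cm_point d_coord_cm_point power2_norm_eq_inner
        algebra_simps)
qed

lemma CM_var_cm_point: "cm_point \<rho> \<in> CM_var"
  unfolding CM_var_def by (rule hull_inc) simp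

lemma s_coord_square_CM_var:
  assumes "p \<in> CM_var"
  shows "36 * d_coord Apex_T Apex_B p * (s_coord i p)\<^sup>2 =
    radial i p * radial (i + 1) p - (cross_gram i (i + 1) p)\<^sup>2"
proof -
  have "36 * d_coord Apex_T Apex_B p * (s_coord i p)\<^sup>2 -
    (radial i p * radial (i + 1) p - (cross_gram i (i + 1) p)\<^sup>2) = 0"
    by (rule vanishes_on_zariski_hull[OF _ _ assms[unfolded CM_var_def]])
      (auto intro!: polynomial_intros real_polynomial_function_radial real_polynomial_function_cross_gram
        simp: s_coord_square_cm_point)
  then show ?thesis by simp
qed

lemma s_coord_mult_CM_var:
  fixes p :: "'n::{finite,comm_ring_1} cm_space"
  assumes "p \<in> CM_var" "(2 :: 'n) \<noteq> 0"
  shows "radial (i + 1) p * cross_gram i (i + 2) p =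
    cross_gram i (i + 1) p * cross_gram (i + 1) (i + 2) p
    - 36 * d_coord Apex_T Apex_B p * (s_coord i p * s_coord (i + 1) p)"
proof -
  have "radial (i + 1) p * cross_gram i (i + 2) p -
    (cross_gram i (i + 1) p * cross_gram (i + 1) (i + 2) p
    - 36 * d_coord Apex_T Apex_B p * (s_coord i p * s_coord (i + 1) p)) = 0"
    by (rule vanishes_on_zariski_hull[OF _ _ assms(1)[unfolded CM_var_def]])
      (use assms(2) in \<open>auto intro!: polynomial_intros real_polynomial_function_radial real_polynomial_function_cross_gram
        simp: s_coord_mult_cm_point\<close>)
  then show ?thesis by simp
qed

lemma adj_rim_apex: "adj (Rim i) Apex_T" "adj (Rim i) Apex_B" "adj (Rim i) (Rim (i + 1))"
  unfolding adj_def by blast+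

section \<open>Motions along an ellipse\<close>

text \<open>
  The hypotheses describe a one-parameter family of configurations in which all tetrahedra at the axis
  become flat simultaneously, namely at the squared axis lengths \<open>x1\<close> and \<open>x2\<close>.
\<close>

locale elliptic_motion =
  fixes l :: "'n::{finite,comm_ring_1} vertex \<Rightarrow> 'n vertex \<Rightarrow> real" and x1 x2 :: real and k :: "'n \<Rightarrow> real"
  assumes two_nz: "(2 :: 'n) \<noteq> 0"
    and nonadj: "\<And>u v :: 'n vertex. u \<noteq> v \<Longrightarrow> \<not> adj u v \<Longrightarrow>
      {u, v} = {Apex_T, Apex_B} \<or> (\<exists>i. {u, v} = {Rim i, Rim (i + 2)})"
    and x1_pos: "0 < x1" and x1_less: "x1 < x2"
    and k_nz: "\<And>i. k i \<noteq> 0"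
    and off_axis: "\<And>x i. x1 \<le> x \<Longrightarrow> x \<le> x2 \<Longrightarrow>
      x * (l (Rim i) Apex_B)\<^sup>2 - (((l (Rim i) Apex_B)\<^sup>2 + x - (l (Rim i) Apex_T)\<^sup>2) / 2)\<^sup>2 \<noteq> 0"
    and config: "\<And>x y. y\<^sup>2 = (x - x1) * (x2 - x) \<Longrightarrow>
      \<exists>\<rho>. realization \<rho> \<and> induces \<rho> l \<and> (norm (\<rho> Apex_T - \<rho> Apex_B))\<^sup>2 = x \<and>
          (\<forall>i. s_coord i (cm_point \<rho>) = k i * y)"
begin

section \<open>The curve and its coordinates on the ellipse\<close>

abbreviation ax :: "'n cm_space \<Rightarrow> real" where "ax \<equiv> d_coord Apex_T Apex_B"

text \<open>Explicit equations stand in for those of \<open>CM_var\<close>. The second family fixes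
  the ratios of the volumes with their signs, which the squares leave open; the last family
  determines the diagonals.\<close>

definition equations :: "('n cm_space \<Rightarrow> real) set" where
  "equations =
    {\<lambda>p. d_coord u v p - (l u v)\<^sup>2 |u v. adj u v} \<union>
    range (\<lambda>i p. k 0 * s_coord i p - k i * s_coord 0 p) \<union>
    {\<lambda>p. (s_coord 0 p)\<^sup>2 - (k 0)\<^sup>2 * ((ax p - x1) * (x2 - ax p))} \<union>
    range (\<lambda>i p. radial (i + 1) p * cross_gram i (i + 2) p -
      (cross_gram i (i + 1) p * cross_gram (i + 1) (i + 2) p
        - 36 * ax p * (s_coord i p * s_coord (i + 1) p)))"

definition M :: "'n cm_space set" where
  "M = {p. \<forall>f\<in>equations. f p = 0}"

lemma M_iff:
  "p \<in> M \<longleftrightarrow> (\<forall>u v. adj u v \<longrightarrow> d_coord u v p = (l u v)\<^sup>2) \<and>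
    (\<forall>i. k 0 * s_coord i p = k i * s_coord 0 p) \<and>
    (s_coord 0 p)\<^sup>2 = (k 0)\<^sup>2 * ((ax p - x1) * (x2 - ax p)) \<and>
    (\<forall>i. radial (i + 1) p * cross_gram i (i + 2) p =
      cross_gram i (i + 1) p * cross_gram (i + 1) (i + 2) p
        - 36 * ax p * (s_coord i p * s_coord (i + 1) p))"
proof -
  have 1: "(\<forall>f\<in>{\<lambda>p. d_coord u v p - (l u v)\<^sup>2 |u v. adj u v}. f p = 0) \<longleftrightarrow>
    (\<forall>u v. adj u v \<longrightarrow> d_coord u v p - (l u v)\<^sup>2 = 0)" by fastforce
  show ?thesis
    unfolding M_def equations_def mem_Collect_eq ball_Un 1 by auto
qed

lemma zariski_closed_M: "zariski_closed M"
  unfolding zariski_closed_def M_def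
proof (rule exI[of _ equations], intro conjI ballI refl)
  fix f assume "f \<in> equations"
  then show "real_polynomial_function f"
    unfolding equations_def
    by (auto intro!: polynomial_intros real_polynomial_function_radial real_polynomial_function_cross_gram)
qed

lemma M_edge: "p \<in> M \<Longrightarrow> adj u v \<Longrightarrow> d_coord u v p = (l u v)\<^sup>2"
  using M_iff by blast

lemma M_edges:
  assumes "p \<in> M"
  shows "d_coord (Rim i) Apex_T p = (l (Rim i) Apex_T)\<^sup>2" "d_coord (Rim i) Apex_B p = (l (Rim i) Apex_B)\<^sup>2"
    "d_coord (Rim i) (Rim (i + 1)) p = (l (Rim i) (Rim (i + 1)))\<^sup>2"
  using M_edge[OF assms] adj_rim_apex by blast+

definition Y :: "'n cm_space \<Rightarrow> real" where "Y p = s_coord 0 p / k 0"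

lemma M_s_coord: "p \<in> M \<Longrightarrow> s_coord i p = k i * Y p"
  using M_iff[of p] k_nz[of 0] by (simp add: Y_def field_simps)

lemma M_Y_square: "p \<in> M \<Longrightarrow> (Y p)\<^sup>2 = (ax p - x1) * (x2 - ax p)"
  using M_iff[of p] k_nz[of 0] by (simp add: Y_def field_simps)

text \<open>A real square is nonnegative, so real points lie only over the interval on which
  \<open>off_axis\<close> keeps the denominators nonzero.\<close>

lemma M_X_bounds:
  assumes "p \<in> M"
  shows "x1 \<le> ax p" "ax p \<le> x2"
proof -
  have "(ax p - x1) * (x2 - ax p) \<ge> 0" using M_Y_square[OF assms] by (metis zero_le_power2)
  then show "x1 \<le> ax p" "ax p \<le> x2" using x1_less by (auto simp: zero_le_mult_iff)
qed

section \<open>Gram entries and diagonals as functions of the squared axis length\<close>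

definition axial_at :: "'n \<Rightarrow> real \<Rightarrow> real" where
  "axial_at i x = ((l (Rim i) Apex_B)\<^sup>2 + x - (l (Rim i) Apex_T)\<^sup>2) / 2"

definition radial_at :: "'n \<Rightarrow> real \<Rightarrow> real" where
  "radial_at i x = x * (l (Rim i) Apex_B)\<^sup>2 - (axial_at i x)\<^sup>2"

definition gram_at :: "'n \<Rightarrow> real \<Rightarrow> real" where
  "gram_at i x = x * ((l (Rim i) Apex_B)\<^sup>2 + (l (Rim (i + 1)) Apex_B)\<^sup>2 - (l (Rim i) (Rim (i + 1)))\<^sup>2) / 2
     - axial_at i x * axial_at (i + 1) x"

text \<open>Numerator of \<open>cross_gram i (i + 2)\<close> over the denominator
  \<open>radial_at (i + 1)\<close>. The product of the two volumes is replaced by its value on the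
  ellipse, so that only the squared axis length remains.\<close>

definition gram2_at :: "'n \<Rightarrow> real \<Rightarrow> real" where
  "gram2_at i x = gram_at i x * gram_at (i + 1) x - 36 * x * (k i * k (i + 1)) * ((x - x1) * (x2 - x))"

lemma radial_at_nz: "x1 \<le> x \<Longrightarrow> x \<le> x2 \<Longrightarrow> radial_at i x \<noteq> 0"
  using off_axis unfolding radial_at_def axial_at_def by blast

lemma add_one_add_one: "i + 1 + 1 = (i + 2 :: 'n)"
  by (simp add: add.assoc)

lemma at_eqs:
  assumes "\<And>u v. adj u v \<Longrightarrow> d_coord u v p = (l u v)\<^sup>2"
  shows "axial i p = axial_at i (ax p)" "radial i p = radial_at i (ax p)"
    "cross_gram i (i + 1) p = gram_at i (ax p)" "cross_gram (i + 1) (i + 2) p = gram_at (i + 1) (ax p)"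
  using assms[OF adj_rim_apex(1)] assms[OF adj_rim_apex(2)] assms[OF adj_rim_apex(3)]
    assms[OF adj_rim_apex(3)[of "i + 1"], unfolded add_one_add_one]
  by (simp_all add: axial_def axial_at_def radial_def radial_at_def cross_gram_def gram_at_def add_one_add_one)

definition diag_at :: "'n \<Rightarrow> real \<Rightarrow> real" where
  "diag_at i x = (l (Rim i) Apex_B)\<^sup>2 + (l (Rim (i + 2)) Apex_B)\<^sup>2
     - 2 * (gram2_at i x / radial_at (i + 1) x + axial_at i x * axial_at (i + 2) x) / x"

lemma M_diag:
  assumes "p \<in> M"
  shows "d_coord (Rim i) (Rim (i + 2)) p = diag_at i (ax p)"
proof -
  note at = at_eqs[OF M_edge[OF assms]]
  have ax: "ax p > 0" using M_X_bounds[OF assms] x1_pos by linarith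
  have r: "radial_at (i + 1) (ax p) \<noteq> 0" using radial_at_nz M_X_bounds[OF assms] by blast
  have "radial (i + 1) p * cross_gram i (i + 2) p =
      cross_gram i (i + 1) p * cross_gram (i + 1) (i + 2) p
        - 36 * ax p * (s_coord i p * s_coord (i + 1) p)"
    using assms M_iff by blast
  moreover have "s_coord i p * s_coord (i + 1) p = k i * k (i + 1) * ((ax p - x1) * (x2 - ax p))"
    by (simp add: M_s_coord[OF assms] flip: M_Y_square[OF assms]) (simp add: power2_eq_square)
  ultimately have "cross_gram i (i + 2) p = gram2_at i (ax p) / radial_at (i + 1) (ax p)"
    using r by (simp add: at gram2_at_def eq_divide_eq mult.commute[of _ "radial_at (i + 1) (ax p)"])
  then have "ax p * ((l (Rim i) Apex_B)\<^sup>2 + (l (Rim (i + 2)) Apex_B)\<^sup>2 - d_coord (Rim i) (Rim (i + 2)) p) / 2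
      - axial_at i (ax p) * axial_at (i + 2) (ax p) = gram2_at i (ax p) / radial_at (i + 1) (ax p)"
    by (simp add: cross_gram_def at M_edges[OF assms])
  then have "ax p * ((l (Rim i) Apex_B)\<^sup>2 + (l (Rim (i + 2)) Apex_B)\<^sup>2 - d_coord (Rim i) (Rim (i + 2)) p) =
    2 * (gram2_at i (ax p) / radial_at (i + 1) (ax p) + axial_at i (ax p) * axial_at (i + 2) (ax p))"
    by (simp add: algebra_simps)
  then have "(l (Rim i) Apex_B)\<^sup>2 + (l (Rim (i + 2)) Apex_B)\<^sup>2 - d_coord (Rim i) (Rim (i + 2)) p =
    2 * (gram2_at i (ax p) / radial_at (i + 1) (ax p) + axial_at i (ax p) * axial_at (i + 2) (ax p)) / ax p"
    using ax by (simp add: eq_divide_eq mult.commute)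
  then show ?thesis by (simp add: diag_at_def)
qed

text \<open>On \<open>M\<close> the volumes are multiples of \<open>Y\<close> and the distances are
  constants or functions of \<open>ax\<close>.\<close>

lemma M_unique:
  assumes "p \<in> M" "q \<in> M" "ax p = ax q" "Y p = Y q"
  shows "p = q"
proof (rule cm_space_eqI)
  show "s_coord i p = s_coord i q" for i
    using assms by (simp add: M_s_coord)
  fix u v :: "'n vertex" assume "u \<noteq> v"
  show "d_coord u v p = d_coord u v q"
  proof (cases "adj u v")
    case True then show ?thesis using assms M_edge by simp
  next
    case False
    then consider "{u, v} = {Apex_T, Apex_B}" | i where "{u, v} = {Rim i, Rim (i + 2)}"
      using nonadj \<open>u \<noteq> v\<close> by blast
    then show ?thesis
    proof cases
      case 1 then show ?thesis using assms(3) by (simp add: d_coord_def)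
    next
      case 2
      have "d_coord (Rim i) (Rim (i + 2)) p = d_coord (Rim i) (Rim (i + 2)) q"
        using M_diag assms by simp
      then show ?thesis using 2 by (simp add: d_coord_def)
    qed
  qed
qed

lemma config_M:
  assumes "induces \<rho> l" "\<And>i. s_coord i (cm_point \<rho>) = k i * y"
    "y\<^sup>2 = (ax (cm_point \<rho>) - x1) * (x2 - ax (cm_point \<rho>))"
  shows "cm_point \<rho> \<in> M" "Y (cm_point \<rho>) = y"
proof -
  have "u \<noteq> v" if "adj u v" for u v :: "'n vertex"
    using that unfolding adj_def by (auto simp: doubleton_eq_iff)
  then have "\<forall>u v. adj u v \<longrightarrow> d_coord u v (cm_point \<rho>) = (l u v)\<^sup>2"
    using assms(1) by (auto simp: d_coord_cm_point induces_def edge_length_def)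
  then show "cm_point \<rho> \<in> M"
    unfolding M_iff using assms(2,3) s_coord_mult_cm_point[OF two_nz, of _ \<rho>]
    by (auto simp: power_mult_distrib)
  show "Y (cm_point \<rho>) = y" using assms(2) k_nz by (simp add: Y_def)
qed

lemma M_exists:
  assumes "y\<^sup>2 = (x - x1) * (x2 - x)"
  obtains \<rho> where "realization \<rho>" "induces \<rho> l" "cm_point \<rho> \<in> M" "ax (cm_point \<rho>) = x" "Y (cm_point \<rho>) = y"
proof -
  obtain \<rho> where \<rho>: "realization \<rho>" "induces \<rho> l" "(norm (\<rho> Apex_T - \<rho> Apex_B))\<^sup>2 = x"
    "\<forall>i. s_coord i (cm_point \<rho>) = k i * y"
    using config[OF assms] by blast
  have "ax (cm_point \<rho>) = x" using \<rho>(3) by (simp add: d_coord_cm_point)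
  moreover have "cm_point \<rho> \<in> M" "Y (cm_point \<rho>) = y"
    using config_M[of \<rho> y] \<rho> assms \<open>ax (cm_point \<rho>) = x\<close> by auto
  ultimately show ?thesis using that \<rho> by blast
qed

text \<open>\<open>config\<close> provides a realization over every point of the ellipse, and
  \<open>M_unique\<close> identifies its image with the given point. Hence the flat poses are
  realized too.\<close>

lemma M_realizable:
  assumes "p \<in> M"
  obtains \<rho> where "realization \<rho>" "induces \<rho> l" "p = cm_point \<rho>"
proof -
  obtain \<rho> where "realization \<rho>" "induces \<rho> l" "cm_point \<rho> \<in> M" "ax (cm_point \<rho>) = ax p"
    "Y (cm_point \<rho>) = Y p"
    using M_exists[OF M_Y_square[OF assms]] .
  then show ?thesis using that M_unique[OF assms] by simp
qed

lemma M_subset_K_var: "M \<subseteq> K_var l"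
proof
  fix p assume p: "p \<in> M"
  then obtain \<rho> where "p = cm_point \<rho>" using M_realizable by blast
  then show "p \<in> K_var l" using M_edge[OF p] CM_var_cm_point by (auto simp: K_var_def)
qed

section \<open>Rational parametrisation of the curve\<close>

definition point :: "real \<Rightarrow> real \<Rightarrow> 'n cm_space" where
  "point x y = (THE p. p \<in> M \<and> ax p = x \<and> Y p = y)"

lemma point:
  assumes "y\<^sup>2 = (x - x1) * (x2 - x)"
  shows "point x y \<in> M" "ax (point x y) = x" "Y (point x y) = y"
proof -
  have "\<exists>!p. p \<in> M \<and> ax p = x \<and> Y p = y" using M_exists[OF assms] M_unique by metis
  from theI'[OF this] show "point x y \<in> M" "ax (point x y) = x" "Y (point x y) = y"
    unfolding point_def by auto
qed

lemma point_eq: "p \<in> M \<Longrightarrow> ax p = x \<Longrightarrow> Y p = y \<Longrightarrow> point x y = p"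
  unfolding point_def by (rule the_equality) (auto intro: M_unique)

text \<open>The top of the ellipse, the sample point at which no volume vanishes.\<close>

lemma midpoint_eq: "((x2 - x1) / 2)\<^sup>2 = ((x1 + x2) / 2 - x1) * (x2 - (x1 + x2) / 2)"
  by (simp add: power2_eq_square field_simps)

lemma ax_image: "{x1..x2} \<subseteq> ax ` M"
proof
  fix x assume "x \<in> {x1..x2}"
  then have "(sqrt ((x - x1) * (x2 - x)))\<^sup>2 = (x - x1) * (x2 - x)" by simp
  from point[OF this] show "x \<in> ax ` M" by force
qed

lemma rational_at:
  assumes "rational_fun x"
  shows "rational_fun (\<lambda>t. axial_at i (x t))" "rational_fun (\<lambda>t. radial_at i (x t))"
    "rational_fun (\<lambda>t. gram_at i (x t))" "rational_fun (\<lambda>t. gram2_at i (x t))"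
  unfolding axial_at_def radial_at_def gram_at_def gram2_at_def
  by (auto intro!: rational_fun_intros assms)

lemma rational_point:
  assumes "rational_fun x" "rational_fun y" and xy: "\<And>t. (y t)\<^sup>2 = (x t - x1) * (x2 - x t)"
    and "b \<in> Basis"
  shows "rational_fun (\<lambda>t. point (x t) (y t) \<bullet> b)"
proof -
  have d: "rational_fun (\<lambda>t. d_coord u v (point (x t) (y t)))" if uv: "u \<noteq> v" for u v
  proof (cases "adj u v")
    case True
    then show ?thesis using M_edge[OF point(1)[OF xy]] by (simp add: rational_fun_const)
  next
    case False
    then consider "{u, v} = {Apex_T, Apex_B}" | i where "{u, v} = {Rim i, Rim (i + 2)}"
      using nonadj uv by blast
    then show ?thesis
    proof cases
      case 1
      then have "d_coord u v = ax" by (simp add: d_coord_def fun_eq_iff)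
      then show ?thesis using assms(1) by (simp add: point(2)[OF xy])
    next
      case 2
      then have "d_coord u v = d_coord (Rim i) (Rim (i + 2))" by (simp add: d_coord_def fun_eq_iff)
      moreover have "x1 \<le> x t" "x t \<le> x2" for t
        using M_X_bounds[OF point(1)[OF xy]] point(2)[OF xy] by simp_all
      then have "radial_at i (x t) \<noteq> 0" "x t \<noteq> 0" for i t
        using radial_at_nz x1_pos by (blast, smt (verit))
      then have "rational_fun (\<lambda>t. diag_at i (x t))"
        unfolding diag_at_def by (intro rational_fun_intros rational_at assms(1)) simp_all
      ultimately show ?thesis by (simp add: M_diag[OF point(1)[OF xy]] point(2)[OF xy])
    qed
  qed
  have s: "rational_fun (\<lambda>t. s_coord i (point (x t) (y t)))" for i
    using assms(2) by (auto simp: M_s_coord[OF point(1)[OF xy]] point(3)[OF xy] intro!: rational_fun_intros)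
  from \<open>b \<in> Basis\<close> show ?thesis
    by (cases rule: cm_space_Basis_cases) (simp_all add: d s)
qed

text \<open>Projection of the ellipse from its vertex \<open>(x2, 0)\<close>, with parameter
  \<open>t = y / (x2 - x)\<close>. Only that vertex is missed; replacing \<open>t\<close> by its
  inverse moves it to parameter 0 of \<open>\<gamma>'\<close>.\<close>

definition \<gamma> :: "real \<Rightarrow> 'n cm_space" where
  "\<gamma> t = point ((x1 + x2 * t\<^sup>2) / (1 + t\<^sup>2)) ((x2 - x1) * t / (1 + t\<^sup>2))"

definition \<gamma>' :: "real \<Rightarrow> 'n cm_space" where
  "\<gamma>' t = point ((x1 * t\<^sup>2 + x2) / (1 + t\<^sup>2)) ((x2 - x1) * t / (1 + t\<^sup>2))"

lemma one_plus_square_nz: "1 + t\<^sup>2 \<noteq> (0 :: real)"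
  using zero_le_power2[of t] by linarith

lemma chart_eq: "((x2 - x1) * t / (1 + t\<^sup>2))\<^sup>2 =
    ((x1 + x2 * t\<^sup>2) / (1 + t\<^sup>2) - x1) * (x2 - (x1 + x2 * t\<^sup>2) / (1 + t\<^sup>2))"
proof -
  have "(x1 + x2 * t\<^sup>2) / (1 + t\<^sup>2) - x1 = (x2 - x1) * t\<^sup>2 / (1 + t\<^sup>2)"
    "x2 - (x1 + x2 * t\<^sup>2) / (1 + t\<^sup>2) = (x2 - x1) / (1 + t\<^sup>2)"
    using one_plus_square_nz[of t] by (simp_all add: field_simps)
  then show ?thesis by (simp add: power2_eq_square)
qed

lemma chart_eq': "((x2 - x1) * t / (1 + t\<^sup>2))\<^sup>2 =
    ((x1 * t\<^sup>2 + x2) / (1 + t\<^sup>2) - x1) * (x2 - (x1 * t\<^sup>2 + x2) / (1 + t\<^sup>2))"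
proof -
  have "x2 - (x1 * t\<^sup>2 + x2) / (1 + t\<^sup>2) = (x2 - x1) * t\<^sup>2 / (1 + t\<^sup>2)"
    "(x1 * t\<^sup>2 + x2) / (1 + t\<^sup>2) - x1 = (x2 - x1) / (1 + t\<^sup>2)"
    using one_plus_square_nz[of t] by (simp_all add: field_simps)
  then show ?thesis by (simp add: power2_eq_square)
qed

sublocale rational_curve M \<gamma> \<gamma>'
proof
  show "rational_fun (\<lambda>t. \<gamma> t \<bullet> b)" if "b \<in> Basis" for b
    unfolding \<gamma>_def using that chart_eq one_plus_square_nz
    by (intro rational_point rational_fun_intros) auto
  show "rational_fun (\<lambda>t. \<gamma>' t \<bullet> b)" if "b \<in> Basis" for b
    unfolding \<gamma>'_def using that chart_eq' one_plus_square_nz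
    by (intro rational_point rational_fun_intros) auto
  show "\<gamma>' t = \<gamma> (inverse t)" if "t \<noteq> 0" for t
  proof -
    have "(x1 + x2 * (inverse t)\<^sup>2) / (1 + (inverse t)\<^sup>2) = (x1 * t\<^sup>2 + x2) / (1 + t\<^sup>2)"
      "(x2 - x1) * inverse t / (1 + (inverse t)\<^sup>2) = (x2 - x1) * t / (1 + t\<^sup>2)"
      using that one_plus_square_nz[of t] one_plus_square_nz[of "inverse t"]
      by (simp_all add: divide_simps) (simp_all add: power2_eq_square algebra_simps)
    then show ?thesis by (simp add: \<gamma>_def \<gamma>'_def)
  qed
  show "M = insert (\<gamma>' 0) (range \<gamma>)"
  proof (rule subset_antisym; rule subsetI)
    fix p assume p: "p \<in> M"
    show "p \<in> insert (\<gamma>' 0) (range \<gamma>)"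
    proof (cases "ax p = x2")
      case True
      then have "Y p = 0" using M_Y_square[OF p] by simp
      then have "p = \<gamma>' 0" using point_eq[OF p True] by (simp add: \<gamma>'_def)
      then show ?thesis by simp
    next
      case False
      define t where "t = Y p / (x2 - ax p)"
      have t2: "t\<^sup>2 = (ax p - x1) / (x2 - ax p)"
        using False M_Y_square[OF p] by (simp add: t_def power_divide) (simp add: power2_eq_square)
      have 1: "1 + t\<^sup>2 = (x2 - x1) / (x2 - ax p)" using False by (simp add: t2 field_simps)
      have "(x1 + x2 * t\<^sup>2) / (1 + t\<^sup>2) = ax p"
      proof -
        have "x1 + x2 * t\<^sup>2 = ax p * (x2 - x1) / (x2 - ax p)"
          using False by (simp add: t2 divide_simps) (simp add: algebra_simps)
        then show ?thesis using False x1_less by (simp add: 1)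
      qed
      moreover have "(x2 - x1) * t / (1 + t\<^sup>2) = Y p"
        using False x1_less by (simp add: 1) (simp add: t_def)
      ultimately have "p = \<gamma> t" using point_eq[OF p] by (simp add: \<gamma>_def)
      then show ?thesis by simp
    qed
  next
    fix p assume "p \<in> insert (\<gamma>' 0) (range \<gamma>)"
    then show "p \<in> M" using point(1)[OF chart_eq] point(1)[OF chart_eq'[of 0]]
      by (auto simp: \<gamma>_def \<gamma>'_def)
  qed
  show "zariski_closed M" by (rule zariski_closed_M)
  show "infinite M" using ax_image x1_less finite_subset by (metis finite_imageI infinite_Icc)
qed

text \<open>A larger irreducible set \<open>M'\<close> is only known to satisfy the identities
  inherited from the closure; the equations of \<open>M\<close> are recovered on it family by
  family.\<close>

lemma component: "irreducible_component (K_var l) M"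
  unfolding irreducible_component_def
proof (intro conjI allI impI irreducible M_subset_K_var)
  fix M' assume M': "irreducible_set M' \<and> M \<subseteq> M' \<and> M' \<subseteq> K_var l"
  then have irr: "irreducible_set M'" and sub: "M \<subseteq> M'" by auto
  have edge: "d_coord u v p = (l u v)\<^sup>2" if "p \<in> M'" "adj u v" for p u v
    using M' that by (auto simp: K_var_def)
  have CM: "p \<in> CM_var" if "p \<in> M'" for p using M' that by (auto simp: K_var_def)
  have poly: "real_polynomial_function (\<lambda>x. 36 * x * (k i)\<^sup>2 * ((x - x1) * (x2 - x)) -
      (radial_at i x * radial_at (i + 1) x - (gram_at i x)\<^sup>2))" for i
    unfolding radial_at_def gram_at_def axial_at_def
    by (intro polynomial_intros real_polynomial_function_divide_const
        real_polynomial_function.intros(1) bounded_linear_ident)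
  \<comment> \<open>Verified where configurations exist and extended to all \<open>x\<close> as a
    polynomial identity: points of \<open>M'\<close> are not known to be realizable, so their axis
    value may a priori leave the interval.\<close>
  have ident: "36 * x * (k i)\<^sup>2 * ((x - x1) * (x2 - x)) =
      radial_at i x * radial_at (i + 1) x - (gram_at i x)\<^sup>2" (is "?f x = ?g x") for i x
  proof -
    have "?f x = ?g x" if "x \<in> {x1..x2}" for x
    proof -
      have "(sqrt ((x - x1) * (x2 - x)))\<^sup>2 = (x - x1) * (x2 - x)" using that by simp
      then obtain \<rho> where \<rho>: "cm_point \<rho> \<in> M" "ax (cm_point \<rho>) = x" by (rule M_exists)
      then show ?thesis
        using s_coord_square_cm_point[of \<rho> i] at_eqs[OF M_edge[OF \<rho>(1)]] M_Y_square[OF \<rho>(1)]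
        by (simp add: M_s_coord[OF \<rho>(1)] power_mult_distrib)
    qed
    then have "{x1..x2} \<subseteq> {x. ?f x - ?g x = 0}" by auto
    then have "infinite {x. ?f x - ?g x = 0}" using infinite_Icc[OF x1_less] finite_subset by blast
    then show ?thesis using rational_fun_zeros[OF rational_fun_poly_real[OF poly[of i]]] by auto
  qed
  \<comment> \<open>The inherited relation carries a factor \<open>ax p\<close>. Irreducibility
    removes it, since \<open>M'\<close> contains a point over \<open>x1 > 0\<close>.\<close>
  have "ax p * ((s_coord i p)\<^sup>2 - (k i)\<^sup>2 * ((ax p - x1) * (x2 - ax p))) = 0" if "p \<in> M'" for p i
  proof -
    have "36 * (ax p * (s_coord i p)\<^sup>2) = 36 * (ax p * ((k i)\<^sup>2 * ((ax p - x1) * (x2 - ax p))))"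
      using s_coord_square_CM_var[OF CM[OF that], of i] ident[of "ax p" i]
      by (simp add: at_eqs[OF edge[OF that]] mult.assoc)
    then show ?thesis by (simp add: right_diff_distrib)
  qed
  then have "(\<forall>p\<in>M'. ax p = 0) \<or> (\<forall>p\<in>M'. (s_coord i p)\<^sup>2 - (k i)\<^sup>2 * ((ax p - x1) * (x2 - ax p)) = 0)" for i
    by (intro irreducible_set_mult_zero[OF irr] polynomial_intros) auto
  moreover have ex: "\<exists>p\<in>M. ax p = x \<and> Y p = y" if "y\<^sup>2 = (x - x1) * (x2 - x)" for x y
    using point[OF that] by blast
  have "\<not> (\<forall>p\<in>M'. ax p = 0)" using ex[of 0 x1] sub x1_pos by force
  ultimately have s2: "(s_coord i p)\<^sup>2 = (k i)\<^sup>2 * ((ax p - x1) * (x2 - ax p))" if "p \<in> M'" for i p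
    using that by (metis eq_iff_diff_eq_0)
  \<comment> \<open>Equal squares leave a sign for each volume relative to volume 0. It is constant
    on the irreducible \<open>M'\<close>, and the wrong sign fails at the top of the
    ellipse.\<close>
  have "(k 0 * s_coord i p - k i * s_coord 0 p) * (k 0 * s_coord i p + k i * s_coord 0 p) = 0"
    if "p \<in> M'" for i p
  proof -
    have "(k 0 * s_coord i p)\<^sup>2 = (k i * s_coord 0 p)\<^sup>2"
      by (simp add: power_mult_distrib s2[OF that])
    then show ?thesis by (simp add: power2_eq_square algebra_simps)
  qed
  then have "(\<forall>p\<in>M'. k 0 * s_coord i p - k i * s_coord 0 p = 0) \<or>
      (\<forall>p\<in>M'. k 0 * s_coord i p + k i * s_coord 0 p = 0)" for i
    by (intro irreducible_set_mult_zero[OF irr] polynomial_intros) auto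
  moreover have "\<not> (\<forall>p\<in>M'. k 0 * s_coord i p + k i * s_coord 0 p = 0)" for i
  proof -
    from ex[OF midpoint_eq] obtain p where p: "p \<in> M" "Y p = (x2 - x1) / 2" by blast
    then have "k 0 * s_coord i p + k i * s_coord 0 p = k 0 * k i * (x2 - x1)"
      by (simp add: M_s_coord)
    then show ?thesis using p sub k_nz x1_less by (metis eq_iff_diff_eq_0 less_irrefl mult_eq_0_iff subsetD)
  qed
  ultimately have s: "k 0 * s_coord i p = k i * s_coord 0 p" if "p \<in> M'" for i p
    using that by (metis eq_iff_diff_eq_0)
  have "M' \<subseteq> M"
    using edge s s2 s_coord_mult_CM_var[OF CM two_nz] by (auto simp: M_iff)
  then show "M' = M" using sub by auto
qed

text \<open>Since every point of \<open>M\<close> is realized, the exceptional closed set can be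
  taken empty.\<close>

lemma motion: "motion l M"
  unfolding motion_def
  using component dim M_realizable zariski_closed_empty irreducible
  by (auto simp: irreducible_set_def intro!: exI[of _ "{}"]) metis+

end

section \<open>Flexes, flat poses and non-degeneracy\<close>

lemma adj_simps [simp]:
  fixes i j :: "'n::comm_ring_1"
  shows "adj (Rim i) (Rim j) \<longleftrightarrow> j = i + 1 \<or> i = j + 1"
    "adj (Rim i) Apex_T" "adj (Rim i) Apex_B" "adj Apex_T (Rim i)" "adj Apex_B (Rim i)"
    "\<not> adj (Apex_T :: 'n vertex) Apex_B" "\<not> adj (Apex_B :: 'n vertex) Apex_T"
    "\<not> adj (Apex_T :: 'n vertex) Apex_T" "\<not> adj (Apex_B :: 'n vertex) Apex_B"
  unfolding adj_def by (auto simp: doubleton_eq_iff)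

lemma directly_congruent_norm:
  assumes "directly_congruent \<rho> \<sigma>"
  shows "norm (\<sigma> u - \<sigma> v) = norm (\<rho> u - \<rho> v)"
proof -
  obtain Q :: "real ^ 3 ^ 3" and b where Q: "rotation_matrix Q" "\<forall>v. \<sigma> v = Q *v \<rho> v + b"
    using assms unfolding directly_congruent_def by blast
  then have "orthogonal_transformation ((*v) Q)"
    by (simp add: rotation_matrix_def orthogonal_transformation_matrix matrix_of_matrix_vector_mul)
  moreover have "\<sigma> u - \<sigma> v = Q *v (\<rho> u - \<rho> v)"
    using Q(2) by (simp add: matrix_vector_mult_diff_distrib)
  ultimately show ?thesis by (simp add: orthogonal_transformation_norm)
qed

text \<open>Directly congruent configurations have equal axes, so an axis length that never repeats
  separates all times.\<close>

lemma flexI: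
  assumes "continuous_on {0..<1} f"
    and "\<And>t. t \<in> {0..<1} \<Longrightarrow> realization (f t) \<and> induces (f t) l"
    and "inj_on (\<lambda>t. norm (f t Apex_T - f t Apex_B)) {0..<1}"
  shows "flex (f 0) f"
proof -
  have "induces (f t) (edge_length (f 0))" if "t \<in> {0..<1}" for t
    using assms(2)[OF that] assms(2)[of 0] by (auto simp: induces_def)
  moreover have "\<not> directly_congruent (f s) (f t)" if "s \<in> {0..<1}" "t \<in> {0..<1}" "s \<noteq> t" for s t
    using inj_onD[OF assms(3) _ that(1,2)] that(3) directly_congruent_norm by metis
  ultimately show ?thesis using assms(1,2) unfolding flex_def by auto
qed

lemma coplanar_oriented_volume:
  assumes "coplanar S" "a \<in> S" "b \<in> S" "c \<in> S" "d \<in> S"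
  shows "oriented_volume a b c d = 0"
proof -
  obtain u v w where S: "S \<subseteq> affine hull {u, v, w}" using assms(1) unfolding coplanar_def by blast
  have repr: "\<exists>s t. x = u + s *\<^sub>R (v - u) + t *\<^sub>R (w - u)" if "x \<in> S" for x
  proof -
    have "x \<in> affine hull {u, v, w}" using S that by blast
    then obtain p q r where pqr: "p + q + r = 1" "x = p *\<^sub>R u + q *\<^sub>R v + r *\<^sub>R w"
      unfolding affine_hull_3 by blast
    have p: "p = 1 - q - r" using pqr(1) by linarith
    have "x = u + q *\<^sub>R (v - u) + r *\<^sub>R (w - u)"
      unfolding pqr(2) p by (simp add: algebra_simps)
    then show ?thesis by blast
  qed
  obtain s0 t0 where d: "d = u + s0 *\<^sub>R (v - u) + t0 *\<^sub>R (w - u)"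
    using repr[OF assms(5)] by blast
  have *: "\<exists>s t. x - d = s *\<^sub>R (v - u) + t *\<^sub>R (w - u)" if x: "x \<in> S" for x
  proof -
    obtain s t where x_eq: "x = u + s *\<^sub>R (v - u) + t *\<^sub>R (w - u)"
      using repr[OF x] by blast
    have "x - d = (s - s0) *\<^sub>R (v - u) + (t - t0) *\<^sub>R (w - u)"
      unfolding x_eq d by (simp add: scaleR_left_diff_distrib)
    then show ?thesis by blast
  qed
  obtain s1 t1 s2 t2 s3 t3 where
    "a - d = s1 *\<^sub>R (v - u) + t1 *\<^sub>R (w - u)" "b - d = s2 *\<^sub>R (v - u) + t2 *\<^sub>R (w - u)"
    "c - d = s3 *\<^sub>R (v - u) + t3 *\<^sub>R (w - u)"
    using *[OF assms(2)] *[OF assms(3)] *[OF assms(4)] by blast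
  moreover have "det (vector [s1 *\<^sub>R m + t1 *\<^sub>R n, s2 *\<^sub>R m + t2 *\<^sub>R n, s3 *\<^sub>R m + t3 *\<^sub>R n] :: real ^ 3 ^ 3) = 0"
    for m n :: "real ^ 3"
    by (simp add: det_3 algebra_simps)
  ultimately show ?thesis by (simp add: oriented_volume_def)
qed

lemma not_collinear_triangle:
  assumes "dist a b < dist a c + dist b c" "dist a c < dist a b + dist b c" "dist b c < dist a b + dist a c"
  shows "\<not> collinear {a, b, c :: 'a::euclidean_space}"
  using assms by (auto simp: collinear_between_cases between dist_commute)

context elliptic_motion
begin

lemma flexible: "flexible l"
proof -
  have "\<exists>\<rho>. realization \<rho> \<and> induces \<rho> l \<and> ax (cm_point \<rho>) = x" if "x \<in> {x1..x2}" for x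
  proof -
    obtain p where "p \<in> M" "ax p = x" using ax_image \<open>x \<in> {x1..x2}\<close> by blast
    then show ?thesis using M_realizable[OF \<open>p \<in> M\<close>] by metis
  qed
  then obtain R where R: "\<And>x. x \<in> {x1..x2} \<Longrightarrow> realization (R x) \<and> induces (R x) l \<and> ax (cm_point (R x)) = x"
    by metis
  have inj: "inj_on R {x1..x2}" using R by (metis inj_onI)
  have nc: "\<not> directly_congruent (R x) (R y)" if "x \<in> {x1..x2}" "y \<in> {x1..x2}" "x \<noteq> y" for x y
  proof
    assume "directly_congruent (R x) (R y)"
    then have "norm (R y Apex_T - R y Apex_B) = norm (R x Apex_T - R x Apex_B)"
      by (rule directly_congruent_norm)
    then have "ax (cm_point (R x)) = ax (cm_point (R y))" by (simp add: d_coord_cm_point)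
    then show False using R that by metis
  qed
  show ?thesis unfolding flexible_def
  proof (intro exI conjI)
    show "infinite (R ` {x1..x2})" using inj finite_imageD infinite_Icc[OF x1_less] by blast
    show "\<forall>\<rho>\<in>R ` {x1..x2}. realization \<rho> \<and> induces \<rho> l" using R by blast
    show "pairwise (\<lambda>\<rho> \<sigma>. \<not> directly_congruent \<rho> \<sigma>) (R ` {x1..x2})"
      unfolding pairwise_def using nc by blast
  qed
qed

text \<open>Coplanarity forces volume 0 to vanish, hence \<open>Y\<close>, and the ellipse meets the
  line \<open>Y = 0\<close> in two points. The hypothesis supplies a planar realization over each of
  them.\<close>

lemma card_flat_poses:
  assumes "\<And>x. x \<in> {x1, x2} \<Longrightarrow> \<exists>\<rho>. realization \<rho> \<and> induces \<rho> l \<and> cm_point \<rho> \<in> M \<and>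
    ax (cm_point \<rho>) = x \<and> coplanar (range \<rho>)"
  shows "card (flat_poses l M) = 2"
proof -
  have Y0: "Y p = 0" if "p \<in> M" "ax p \<in> {x1, x2}" for p using M_Y_square[OF that(1)] that(2) by auto
  have "flat_poses l M = {point x1 0, point x2 0}"
  proof (rule subset_antisym; rule subsetI)
    fix p assume "p \<in> flat_poses l M"
    then obtain \<rho> where p: "p \<in> M" "p = cm_point \<rho>" "coplanar (range \<rho>)" unfolding flat_poses_def by blast
    then have "s_coord 0 p = 0" by (auto simp: s_coord_cm_point intro!: coplanar_oriented_volume)
    then have "Y p = 0" by (simp add: Y_def)
    then have "ax p = x1 \<or> ax p = x2" using M_Y_square[OF p(1)] by auto
    then show "p \<in> {point x1 0, point x2 0}" using point_eq[OF p(1) _ \<open>Y p = 0\<close>] by auto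
  next
    fix p assume "p \<in> {point x1 0, point x2 0}"
    then obtain x where x: "x \<in> {x1, x2}" "p = point x 0" by auto
    then obtain \<rho> where \<rho>: "realization \<rho>" "induces \<rho> l" "cm_point \<rho> \<in> M" "ax (cm_point \<rho>) = x"
      "coplanar (range \<rho>)" using assms by blast
    then have "p = cm_point \<rho>" using point_eq[OF \<rho>(3,4) Y0] x by simp
    then show "p \<in> flat_poses l M" using \<rho> unfolding flat_poses_def by blast
  qed
  moreover have "ax (point x1 0) = x1" "ax (point x2 0) = x2" by (auto intro: point)
  then have "point x1 0 \<noteq> point x2 0" using x1_less by (metis less_irrefl)
  ultimately show ?thesis by simp
qed

lemma nondegenerate:
  assumes three: "(3 :: 'n) \<noteq> 0"
    and tri: "\<And>i A. A \<in> {Apex_T, Apex_B} \<Longrightarrow>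
      l (Rim i) (Rim (i + 1)) < l (Rim i) A + l (Rim (i + 1)) A \<and>
      l (Rim i) A < l (Rim i) (Rim (i + 1)) + l (Rim (i + 1)) A \<and>
      l (Rim (i + 1)) A < l (Rim i) (Rim (i + 1)) + l (Rim i) A"
    and diag: "\<And>i. \<exists>p\<in>M. \<exists>q\<in>M. d_coord (Rim i) (Rim (i + 2)) p \<noteq> d_coord (Rim i) (Rim (i + 2)) q"
  shows "nondegenerate l M"
  unfolding nondegenerate_def
proof (intro conjI allI impI)
  fix \<rho> :: "'n vertex \<Rightarrow> real ^ 3" and u v w :: "'n vertex"
  assume *: "realization \<rho> \<and> induces \<rho> l \<and> cm_point \<rho> \<in> M \<and> adj u v \<and> adj v w \<and> adj w u"
  then have ind: "induces \<rho> l" by blast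
  have nc: "\<not> collinear {\<rho> (Rim i), \<rho> (Rim (i + 1)), \<rho> A}" if "A \<in> {Apex_T, Apex_B}" for i A
  proof -
    have "l (Rim i) (Rim (i + 1)) = dist (\<rho> (Rim i)) (\<rho> (Rim (i + 1)))"
      "l (Rim i) A = dist (\<rho> (Rim i)) (\<rho> A)" "l (Rim (i + 1)) A = dist (\<rho> (Rim (i + 1))) (\<rho> A)"
      using ind that by (auto simp: induces_def edge_length_def dist_norm)
    then show ?thesis using tri[OF that, of i] by (intro not_collinear_triangle) auto
  qed
  have nc': "\<not> collinear {\<rho> (Rim i), \<rho> (Rim j), \<rho> A}"
    if "A \<in> {Apex_T, Apex_B}" "j = i + 1 \<or> i = j + 1" for i j A
    using nc[OF that(1), of i] nc[OF that(1), of j] that(2) by (auto simp: insert_commute)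
  have step: "y - x = 1 \<or> y - x = - 1" if "y = x + 1 \<or> x = y + 1" for x y :: 'n
    using that by (elim disjE) simp_all
  \<comment> \<open>Around a 3-cycle of rim vertices three steps 1 or -1 would sum to zero, but the
    possible sums are 1, -1, 3 and -3. Every other 3-cycle has exactly one apex.\<close>
  have no3: False if "j = i + 1 \<or> i = j + 1" "k = j + 1 \<or> j = k + 1" "i = k + 1 \<or> k = i + 1" for i j k :: 'n
  proof -
    have "(j - i) + (k - j) + (i - k) = 0" by simp
    moreover have "j - i = 1 \<or> j - i = - 1" "k - j = 1 \<or> k - j = - 1" "i - k = 1 \<or> i - k = - 1"
      using that step by blast+
    ultimately show False using three by (elim disjE) simp_all
  qed
  show "\<not> collinear {\<rho> u, \<rho> v, \<rho> w}"
  proof -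
    have perms: "\<not> collinear {\<rho> (Rim i), \<rho> A, \<rho> (Rim j)}" "\<not> collinear {\<rho> A, \<rho> (Rim i), \<rho> (Rim j)}"
      if "A \<in> {Apex_T, Apex_B}" "j = i + 1 \<or> i = j + 1" for i j A
      using nc'[OF that] by (simp_all add: insert_commute)
    have uv: "adj u v" and vw: "adj v w" and wu: "adj w u" using * by blast+
    consider (1) i j m where "u = Rim i" "v = Rim j" "w = Rim m"
      | (2) i j A where "u = Rim i" "v = Rim j" "w = A" "A \<in> {Apex_T, Apex_B}"
      | (3) i j A where "u = Rim i" "v = A" "w = Rim j" "A \<in> {Apex_T, Apex_B}"
      | (4) i j A where "u = A" "v = Rim i" "w = Rim j" "A \<in> {Apex_T, Apex_B}"
      using uv vw wu by (cases u; cases v; cases w) auto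
    then show ?thesis
    proof cases
      case 1
      then show ?thesis using no3[of j i m] uv vw wu by simp
    next
      case 2
      then have "j = i + 1 \<or> i = j + 1" using uv by simp
      then show ?thesis unfolding 2(1-3) by (rule nc'[OF 2(4)])
    next
      case 3
      then have "j = i + 1 \<or> i = j + 1" using wu by auto
      then show ?thesis unfolding 3(1-3) by (rule perms(1)[OF 3(4)])
    next
      case 4
      then have "j = i + 1 \<or> i = j + 1" using vw by simp
      then show ?thesis unfolding 4(1-3) by (rule perms(2)[OF 4(4)])
    qed
  qed
next
  fix u v :: "'n vertex" assume uv: "u \<noteq> v \<and> \<not> adj u v"
  then consider "{u, v} = {Apex_T, Apex_B}" | i where "{u, v} = {Rim i, Rim (i + 2)}"
    using nonadj by blast
  then show "\<not> d_coord u v constant_on M"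
  proof cases
    case 1
    then have "d_coord u v = ax" by (simp add: d_coord_def fun_eq_iff)
    moreover have "x1 \<in> ax ` M" "x2 \<in> ax ` M" using ax_image x1_less by auto
    then obtain p q where "p \<in> M" "ax p = x1" "q \<in> M" "ax q = x2" by blast
    ultimately show ?thesis using x1_less unfolding constant_on_def by (metis less_irrefl)
  next
    case 2
    then have "d_coord u v = d_coord (Rim i) (Rim (i + 2))" by (simp add: d_coord_def fun_eq_iff)
    moreover obtain p q where "p \<in> M" "q \<in> M"
      "d_coord (Rim i) (Rim (i + 2)) p \<noteq> d_coord (Rim i) (Rim (i + 2)) q"
      using diag[of i] by blast
    ultimately show ?thesis unfolding constant_on_def by metis
  qed
qed

end

section \<open>The function field of an irreducible set\<close>

locale irreducible_variety =
  fixes M :: "'a::euclidean_space set"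
  assumes irreducible_M: "irreducible_set M"
begin

abbreviation F :: "'a ratfun ring" where "F \<equiv> function_field M"

lemma fractions_iff:
  "(f, g) \<in> fractions M \<longleftrightarrow>
    real_polynomial_function f \<and> real_polynomial_function g \<and> (\<exists>x\<in>M. g x \<noteq> 0)"
  by (simp add: fractions_def)

lemma M_nonempty: "\<exists>x. x \<in> M"
  using irreducible_M unfolding irreducible_set_def by blast

text \<open>The coordinate ring is an integral domain.\<close>

lemma cancel:
  assumes "real_polynomial_function g" "\<exists>x\<in>M. g x \<noteq> 0" "real_polynomial_function h"
    "\<And>x. x \<in> M \<Longrightarrow> g x * h x = 0" "x \<in> M"
  shows "h x = 0"
  using irreducible_set_mult_zero[OF irreducible_M assms(1,3,4)] assms(2,5) by blast

lemma fractions_mult: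
  assumes "(f, g) \<in> fractions M" "(f', g') \<in> fractions M"
  shows "(\<lambda>x. f x * f' x, \<lambda>x. g x * g' x) \<in> fractions M"
proof -
  have "\<exists>x\<in>M. g x * g' x \<noteq> 0"
    using cancel[of g g'] assms unfolding fractions_iff by blast
  then show ?thesis using assms unfolding fractions_iff by auto
qed

lemma fractions_add:
  assumes "(f, g) \<in> fractions M" "(f', g') \<in> fractions M"
  shows "(\<lambda>x. f x * g' x + f' x * g x, \<lambda>x. g x * g' x) \<in> fractions M"
  using fractions_mult[OF assms] assms unfolding fractions_iff by auto

lemma fractions_const: "real_polynomial_function f \<Longrightarrow> (f, \<lambda>x. 1) \<in> fractions M"
  using M_nonempty unfolding fractions_iff by auto

lemma equiv_fraction_rel: "equiv (fractions M) (fraction_rel M)"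
proof (rule equivI)
  show "fraction_rel M \<subseteq> fractions M \<times> fractions M" by (auto simp: fraction_rel_def)
  show "refl_on (fractions M) (fraction_rel M)" by (auto simp: refl_on_def fraction_rel_def)
  show "sym (fraction_rel M)" by (auto simp: sym_def fraction_rel_def)
  show "trans (fraction_rel M)"
  proof (rule transI)
    fix a b c assume *: "(a, b) \<in> fraction_rel M" "(b, c) \<in> fraction_rel M"
    obtain f g f' g' f'' g'' where abc: "a = (f, g)" "b = (f', g')" "c = (f'', g'')"
      by (cases a, cases b, cases c) auto
    have fr: "(f, g) \<in> fractions M" "(f', g') \<in> fractions M" "(f'', g'') \<in> fractions M"
      and e1: "\<And>x. x \<in> M \<Longrightarrow> f x * g' x = f' x * g x"
      and e2: "\<And>x. x \<in> M \<Longrightarrow> f' x * g'' x = f'' x * g' x"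
      using * unfolding abc fraction_rel_def by auto
    \<comment> \<open>Transitivity requires cancelling the middle denominator \<open>g'\<close>;
      irreducibility of \<open>M\<close> enters here.\<close>
    have "f x * g'' x - f'' x * g x = 0" if "x \<in> M" for x
    proof (rule cancel[of g'])
      show "real_polynomial_function g'" "\<exists>x\<in>M. g' x \<noteq> 0" using fr unfolding fractions_iff by auto
      show "real_polynomial_function (\<lambda>x. f x * g'' x - f'' x * g x)"
        using fr unfolding fractions_iff by (intro polynomial_intros) auto
      show "g' x * (f x * g'' x - f'' x * g x) = 0" if "x \<in> M" for x
      proof -
        have "g' x * (f x * g'' x - f'' x * g x) = (f x * g' x) * g'' x - (f'' x * g' x) * g x"
          by (simp add: algebra_simps)
        then show ?thesis by (simp add: e1[OF that] e2[OF that, symmetric])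
      qed
    qed (rule that)
    then show "(a, c) \<in> fraction_rel M" using fr unfolding abc fraction_rel_def by auto
  qed
qed

lemma ratfun_eq_iff:
  assumes "(f, g) \<in> fractions M" "(f', g') \<in> fractions M"
  shows "ratfun M f g = ratfun M f' g' \<longleftrightarrow> (\<forall>x\<in>M. f x * g' x = f' x * g x)"
  unfolding ratfun_def
  using eq_equiv_class_iff[OF equiv_fraction_rel assms] assms by (simp add: fraction_rel_def)

lemma ratfun_carrier: "(f, g) \<in> fractions M \<Longrightarrow> ratfun M f g \<in> carrier F"
  by (simp add: function_field_def ratfun_def quotientI)

lemma carrier_cases:
  assumes "A \<in> carrier F"
  obtains f g where "(f, g) \<in> fractions M" "A = ratfun M f g"
  using assms by (auto simp: function_field_def ratfun_def elim!: quotientE)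

lemma mem_ratfun:
  assumes "(f, g) \<in> fractions M" "(a, b) \<in> ratfun M f g"
  shows "(a, b) \<in> fractions M" "\<And>x. x \<in> M \<Longrightarrow> f x * b x = a x * g x"
  using assms(2) by (auto simp: ratfun_def fraction_rel_def)

lemma self_mem_ratfun: "(f, g) \<in> fractions M \<Longrightarrow> (f, g) \<in> ratfun M f g"
  unfolding ratfun_def by (rule equiv_class_self[OF equiv_fraction_rel])

text \<open>All choices of representatives give the same class, so the union in the definition of
  the product collapses to that class.\<close>

lemma ratfun_mult:
  assumes "(f, g) \<in> fractions M" "(f', g') \<in> fractions M"
  shows "ratfun M f g \<otimes>\<^bsub>F\<^esub> ratfun M f' g' = ratfun M (\<lambda>x. f x * f' x) (\<lambda>x. g x * g' x)"
proof -
  have eq: "ratfun M (\<lambda>x. a x * a' x) (\<lambda>x. b x * b' x) = ratfun M (\<lambda>x. f x * f' x) (\<lambda>x. g x * g' x)"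
    if *: "(a, b) \<in> ratfun M f g" "(a', b') \<in> ratfun M f' g'" for a b a' b'
  proof -
    note m = mem_ratfun[OF assms(1) *(1)] mem_ratfun[OF assms(2) *(2)]
    have "a x * a' x * (g x * g' x) = f x * f' x * (b x * b' x)" if "x \<in> M" for x
    proof -
      have "a x * a' x * (g x * g' x) = (a x * g x) * (a' x * g' x)" by (simp add: algebra_simps)
      also have "\<dots> = (f x * b x) * (f' x * b' x)" by (simp add: m(2,4)[OF that])
      finally show ?thesis by (simp add: algebra_simps)
    qed
    then show ?thesis using ratfun_eq_iff[OF fractions_mult[OF m(1,3)] fractions_mult[OF assms]] by blast
  qed
  have "(\<Union>(f', g')\<in>ratfun M f' g'. ratfun M (\<lambda>x. a x * f' x) (\<lambda>x. b x * g' x)) =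
      ratfun M (\<lambda>x. f x * f' x) (\<lambda>x. g x * g' x)" if "(a, b) \<in> ratfun M f g" for a b
    by (rule UN_constant_eq[OF self_mem_ratfun[OF assms(2)]]) (use eq[OF that] in auto)
  then have "(\<Union>(f, g)\<in>ratfun M f g. \<Union>(f', g')\<in>ratfun M f' g'. ratfun M (\<lambda>x. f x * f' x) (\<lambda>x. g x * g' x)) =
      ratfun M (\<lambda>x. f x * f' x) (\<lambda>x. g x * g' x)"
    by (intro UN_constant_eq[OF self_mem_ratfun[OF assms(1)]]) auto
  then show ?thesis by (simp add: function_field_def)
qed

lemma ratfun_add:
  assumes "(f, g) \<in> fractions M" "(f', g') \<in> fractions M"
  shows "ratfun M f g \<oplus>\<^bsub>F\<^esub> ratfun M f' g' = ratfun M (\<lambda>x. f x * g' x + f' x * g x) (\<lambda>x. g x * g' x)"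
proof -
  have eq: "ratfun M (\<lambda>x. a x * b' x + a' x * b x) (\<lambda>x. b x * b' x) =
      ratfun M (\<lambda>x. f x * g' x + f' x * g x) (\<lambda>x. g x * g' x)"
    if *: "(a, b) \<in> ratfun M f g" "(a', b') \<in> ratfun M f' g'" for a b a' b'
  proof -
    note m = mem_ratfun[OF assms(1) *(1)] mem_ratfun[OF assms(2) *(2)]
    have "(a x * b' x + a' x * b x) * (g x * g' x) = (f x * g' x + f' x * g x) * (b x * b' x)" if "x \<in> M" for x
    proof -
      have "(a x * b' x + a' x * b x) * (g x * g' x) =
          (a x * g x) * (b' x * g' x) + (a' x * g' x) * (b x * g x)" by (simp add: algebra_simps)
      also have "\<dots> = (f x * b x) * (b' x * g' x) + (f' x * b' x) * (b x * g x)" by (simp add: m(2,4)[OF that])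
      finally show ?thesis by (simp add: algebra_simps)
    qed
    then show ?thesis using ratfun_eq_iff[OF fractions_add[OF m(1,3)] fractions_add[OF assms]] by blast
  qed
  have "(\<Union>(f', g')\<in>ratfun M f' g'. ratfun M (\<lambda>x. a x * g' x + f' x * b x) (\<lambda>x. b x * g' x)) =
      ratfun M (\<lambda>x. f x * g' x + f' x * g x) (\<lambda>x. g x * g' x)" if "(a, b) \<in> ratfun M f g" for a b
    by (rule UN_constant_eq[OF self_mem_ratfun[OF assms(2)]]) (use eq[OF that] in auto)
  then have "(\<Union>(f, g)\<in>ratfun M f g. \<Union>(f', g')\<in>ratfun M f' g'.
      ratfun M (\<lambda>x. f x * g' x + f' x * g x) (\<lambda>x. g x * g' x)) =
      ratfun M (\<lambda>x. f x * g' x + f' x * g x) (\<lambda>x. g x * g' x)"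
    by (intro UN_constant_eq[OF self_mem_ratfun[OF assms(1)]]) auto
  then show ?thesis by (simp add: function_field_def)
qed

lemma function_field_one: "\<one>\<^bsub>F\<^esub> = ratfun M (\<lambda>x. 1) (\<lambda>x. 1)"
  and function_field_zero: "\<zero>\<^bsub>F\<^esub> = ratfun M (\<lambda>x. 0) (\<lambda>x. 1)"
  by (simp_all add: function_field_def)

lemmas fr_const = fractions_const[OF real_polynomial_function.intros(2)]

lemma ratfun_closed:
  assumes "A \<in> carrier F" "B \<in> carrier F"
  shows "A \<otimes>\<^bsub>F\<^esub> B \<in> carrier F" "A \<oplus>\<^bsub>F\<^esub> B \<in> carrier F"
  using assms by (auto elim!: carrier_cases simp: ratfun_mult ratfun_add
      intro!: ratfun_carrier fractions_mult fractions_add)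

lemma cring_F: "cring F"
proof (rule cringI)
  show "abelian_group F"
  proof (rule abelian_groupI)
    show "\<zero>\<^bsub>F\<^esub> \<in> carrier F" unfolding function_field_zero by (intro ratfun_carrier fr_const)
    fix A assume A: "A \<in> carrier F"
    then obtain f g where f: "(f, g) \<in> fractions M" "A = ratfun M f g" by (rule carrier_cases)
    show "\<zero>\<^bsub>F\<^esub> \<oplus>\<^bsub>F\<^esub> A = A"
      unfolding f function_field_zero ratfun_add[OF fr_const f(1)]
      by (subst ratfun_eq_iff[OF fractions_add[OF fr_const f(1)] f(1)]) simp
    have f': "(\<lambda>x. - f x, g) \<in> fractions M"
      using f(1) real_polynomial_function.intros(4)[OF real_polynomial_function.intros(2)[of "-1"], of f]
      unfolding fractions_iff by simp
    have "ratfun M (\<lambda>x. - f x) g \<oplus>\<^bsub>F\<^esub> A = \<zero>\<^bsub>F\<^esub>"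
      unfolding f function_field_zero ratfun_add[OF f' f(1)]
      by (subst ratfun_eq_iff[OF fractions_add[OF f' f(1)] fr_const]) simp
    then show "\<exists>B\<in>carrier F. B \<oplus>\<^bsub>F\<^esub> A = \<zero>\<^bsub>F\<^esub>" using ratfun_carrier[OF f'] by blast
    fix B assume B: "B \<in> carrier F"
    then obtain a b where a: "(a, b) \<in> fractions M" "B = ratfun M a b" by (rule carrier_cases)
    show "A \<oplus>\<^bsub>F\<^esub> B \<in> carrier F" using ratfun_closed A B by blast
    show "A \<oplus>\<^bsub>F\<^esub> B = B \<oplus>\<^bsub>F\<^esub> A"
      unfolding f a ratfun_add[OF f(1) a(1)] ratfun_add[OF a(1) f(1)]
      by (subst ratfun_eq_iff[OF fractions_add[OF f(1) a(1)] fractions_add[OF a(1) f(1)]])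
        (simp add: algebra_simps)
    fix C assume "C \<in> carrier F"
    then obtain c d where c: "(c, d) \<in> fractions M" "C = ratfun M c d" by (rule carrier_cases)
    note 1 = fractions_add[OF f(1) a(1)] and 2 = fractions_add[OF a(1) c(1)]
    show "A \<oplus>\<^bsub>F\<^esub> B \<oplus>\<^bsub>F\<^esub> C = A \<oplus>\<^bsub>F\<^esub> (B \<oplus>\<^bsub>F\<^esub> C)"
      unfolding f a c ratfun_add[OF f(1) a(1)] ratfun_add[OF a(1) c(1)]
        ratfun_add[OF 1 c(1)] ratfun_add[OF f(1) 2]
      by (subst ratfun_eq_iff[OF fractions_add[OF 1 c(1)] fractions_add[OF f(1) 2]])
        (simp add: algebra_simps)
  qed
  show "comm_monoid F"
  proof (rule comm_monoidI)
    show "\<one>\<^bsub>F\<^esub> \<in> carrier F" unfolding function_field_one by (intro ratfun_carrier fr_const)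
    fix A assume A: "A \<in> carrier F"
    then obtain f g where f: "(f, g) \<in> fractions M" "A = ratfun M f g" by (rule carrier_cases)
    show "\<one>\<^bsub>F\<^esub> \<otimes>\<^bsub>F\<^esub> A = A" unfolding f function_field_one ratfun_mult[OF fr_const f(1)] by simp
    fix B assume B: "B \<in> carrier F"
    then obtain a b where a: "(a, b) \<in> fractions M" "B = ratfun M a b" by (rule carrier_cases)
    show "A \<otimes>\<^bsub>F\<^esub> B \<in> carrier F" using ratfun_closed A B by blast
    show "A \<otimes>\<^bsub>F\<^esub> B = B \<otimes>\<^bsub>F\<^esub> A"
      unfolding f a ratfun_mult[OF f(1) a(1)] ratfun_mult[OF a(1) f(1)] by (simp add: mult.commute)
    fix C assume "C \<in> carrier F"
    then obtain c d where c: "(c, d) \<in> fractions M" "C = ratfun M c d" by (rule carrier_cases)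
    note 1 = fractions_mult[OF f(1) a(1)] and 2 = fractions_mult[OF a(1) c(1)]
    show "A \<otimes>\<^bsub>F\<^esub> B \<otimes>\<^bsub>F\<^esub> C = A \<otimes>\<^bsub>F\<^esub> (B \<otimes>\<^bsub>F\<^esub> C)"
      unfolding f a c ratfun_mult[OF f(1) a(1)] ratfun_mult[OF a(1) c(1)]
        ratfun_mult[OF 1 c(1)] ratfun_mult[OF f(1) 2] by (simp add: mult.assoc)
  qed
  fix A B C assume "A \<in> carrier F" "B \<in> carrier F" "C \<in> carrier F"
  then obtain f g a b c d where f: "(f, g) \<in> fractions M" "A = ratfun M f g"
    and a: "(a, b) \<in> fractions M" "B = ratfun M a b"
    and c: "(c, d) \<in> fractions M" "C = ratfun M c d" by (metis carrier_cases)
  note 1 = fractions_add[OF f(1) a(1)] and 2 = fractions_mult[OF f(1) c(1)] and 3 = fractions_mult[OF a(1) c(1)]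
  show "(A \<oplus>\<^bsub>F\<^esub> B) \<otimes>\<^bsub>F\<^esub> C = A \<otimes>\<^bsub>F\<^esub> C \<oplus>\<^bsub>F\<^esub> B \<otimes>\<^bsub>F\<^esub> C"
    unfolding f a c ratfun_add[OF f(1) a(1)] ratfun_mult[OF 1 c(1)] ratfun_mult[OF f(1) c(1)]
      ratfun_mult[OF a(1) c(1)] ratfun_add[OF 2 3]
    by (subst ratfun_eq_iff[OF fractions_mult[OF 1 c(1)] fractions_add[OF 2 3]])
      (simp add: algebra_simps)
qed

interpretation cring F by (rule cring_F)

lemma field_F: "field F"
proof (rule cring_fieldI2)
  show "\<zero>\<^bsub>F\<^esub> \<noteq> \<one>\<^bsub>F\<^esub>"
    unfolding function_field_one function_field_zero
    using M_nonempty by (subst ratfun_eq_iff[OF fr_const fr_const]) auto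
  fix A assume A: "A \<in> carrier F" "A \<noteq> \<zero>\<^bsub>F\<^esub>"
  then obtain f g where f: "(f, g) \<in> fractions M" "A = ratfun M f g" by (metis carrier_cases)
  then have "\<exists>x\<in>M. f x \<noteq> 0"
    using A(2) unfolding f function_field_zero by (subst (asm) ratfun_eq_iff[OF f(1) fr_const]) auto
  then have g: "(g, f) \<in> fractions M" using f(1) unfolding fractions_iff by blast
  have "A \<otimes>\<^bsub>F\<^esub> ratfun M g f = \<one>\<^bsub>F\<^esub>"
    unfolding f ratfun_mult[OF f(1) g] function_field_one
    by (subst ratfun_eq_iff[OF fractions_mult[OF f(1) g] fr_const]) (simp add: mult.commute)
  then show "\<exists>B\<in>carrier F. A \<otimes>\<^bsub>F\<^esub> B = \<one>\<^bsub>F\<^esub>" using ratfun_carrier[OF g] by blast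
qed

interpretation field F by (rule field_F)

lemma regular_carrier: "real_polynomial_function f \<Longrightarrow> regular_fun M f \<in> carrier F"
  unfolding regular_fun_def by (intro ratfun_carrier fractions_const)

lemma regular_eq_iff:
  assumes "real_polynomial_function f" "real_polynomial_function g"
  shows "regular_fun M f = regular_fun M g \<longleftrightarrow> (\<forall>x\<in>M. f x = g x)"
  unfolding regular_fun_def using assms
  by (subst ratfun_eq_iff) (auto intro: fractions_const)

lemma regular_add:
  assumes "real_polynomial_function f" "real_polynomial_function g"
  shows "regular_fun M f \<oplus>\<^bsub>F\<^esub> regular_fun M g = regular_fun M (\<lambda>x. f x + g x)"
  unfolding regular_fun_def using assms by (subst ratfun_add) (auto intro: fractions_const)

lemma regular_mult:
  assumes "real_polynomial_function f" "real_polynomial_function g"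
  shows "regular_fun M f \<otimes>\<^bsub>F\<^esub> regular_fun M g = regular_fun M (\<lambda>x. f x * g x)"
  unfolding regular_fun_def using assms by (subst ratfun_mult) (auto intro: fractions_const)

lemma real_polynomial_function_uminus:
  assumes "real_polynomial_function f"
  shows "real_polynomial_function (\<lambda>x. - f x)"
  using real_polynomial_function_diff[OF real_polynomial_function.intros(2)[of 0] assms] by simp

lemma regular_uminus:
  assumes "real_polynomial_function f"
  shows "\<ominus>\<^bsub>F\<^esub> regular_fun M f = regular_fun M (\<lambda>x. - f x)"
proof -
  note f' = real_polynomial_function_uminus[OF assms]
  have "regular_fun M (\<lambda>x. - f x) \<oplus>\<^bsub>F\<^esub> regular_fun M f = \<zero>\<^bsub>F\<^esub>"
    unfolding regular_add[OF f' assms] function_field_zero by (simp add: regular_fun_def)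
  then show ?thesis using minus_equality regular_carrier assms f' by blast
qed

text \<open>Lets the image of a fraction under a homomorphism be recognised from the images of its
  numerator and denominator.\<close>

lemma ratfun_unique:
  assumes "(f, g) \<in> fractions M" "A \<in> carrier F" "A \<otimes>\<^bsub>F\<^esub> regular_fun M g = regular_fun M f"
  shows "A = ratfun M f g"
proof -
  obtain a b where a: "(a, b) \<in> fractions M" "A = ratfun M a b" using assms(2) by (rule carrier_cases)
  have p: "real_polynomial_function f" "real_polynomial_function g"
    using assms(1) by (simp_all add: fractions_iff)
  note g = fractions_const[OF p(2)] fractions_const[OF p(1)]
  have "\<forall>x\<in>M. a x * g x * 1 = f x * (b x * 1)"
    using assms(3) unfolding a regular_fun_def ratfun_mult[OF a(1) g(1)]
      ratfun_eq_iff[OF fractions_mult[OF a(1) g(1)] g(2)] by simp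
  then show ?thesis unfolding a ratfun_eq_iff[OF a(1) assms(1)] by simp
qed

section \<open>Homomorphisms of the function field and pullback along polynomial maps\<close>

lemma ring_hom_eqI:
  assumes "\<phi> \<in> ring_hom F F" "\<And>f. real_polynomial_function f \<Longrightarrow> \<phi> (regular_fun M f) = regular_fun M (f \<circ> \<theta>)"
    and \<theta>: "\<And>f. real_polynomial_function f \<Longrightarrow> real_polynomial_function (f \<circ> \<theta>)" "\<theta> ` M = M"
    and fg: "(f, g) \<in> fractions M"
  shows "\<phi> (ratfun M f g) = ratfun M (f \<circ> \<theta>) (g \<circ> \<theta>)"
proof (rule ratfun_unique)
  show "(f \<circ> \<theta>, g \<circ> \<theta>) \<in> fractions M" using fg \<theta> unfolding fractions_iff by (auto; metis imageE)
  show "\<phi> (ratfun M f g) \<in> carrier F" using assms(1) ratfun_carrier[OF fg] ring_hom_closed by metis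
  have p: "real_polynomial_function f" "real_polynomial_function g" using fg by (simp_all add: fractions_iff)
  note g = fractions_const[OF p(2)] fractions_const[OF p(1)]
  have "ratfun M f g \<otimes>\<^bsub>F\<^esub> regular_fun M g = regular_fun M f"
    unfolding regular_fun_def ratfun_mult[OF fg g(1)]
    by (subst ratfun_eq_iff[OF fractions_mult[OF fg g(1)] g(2)]) simp
  then have "\<phi> (ratfun M f g) \<otimes>\<^bsub>F\<^esub> \<phi> (regular_fun M g) = \<phi> (regular_fun M f)"
    using ring_hom_mult[OF assms(1) ratfun_carrier[OF fg] regular_carrier[OF p(2)]] by simp
  then show "\<phi> (ratfun M f g) \<otimes>\<^bsub>F\<^esub> regular_fun M (g \<circ> \<theta>) = regular_fun M (f \<circ> \<theta>)"
    using assms(2) p by simp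
qed

text \<open>Restricted to the carrier because \<open>Bij\<close> admits extensional maps
  only.\<close>

definition pullback :: "('a \<Rightarrow> 'a) \<Rightarrow> 'a ratfun \<Rightarrow> 'a ratfun" where
  "pullback \<theta> = (\<lambda>A\<in>carrier F. \<Union>(f, g)\<in>A. ratfun M (f \<circ> \<theta>) (g \<circ> \<theta>))"

context
  fixes \<theta> :: "'a \<Rightarrow> 'a"
  assumes \<theta>: "\<And>f. real_polynomial_function f \<Longrightarrow> real_polynomial_function (f \<circ> \<theta>)" "\<theta> ` M = M"
begin

lemma fractions_pullback: "(f, g) \<in> fractions M \<Longrightarrow> (f \<circ> \<theta>, g \<circ> \<theta>) \<in> fractions M"
  using \<theta> unfolding fractions_iff by (auto; metis imageE)

lemma pullback_ratfun:
  assumes "(f, g) \<in> fractions M"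
  shows "pullback \<theta> (ratfun M f g) = ratfun M (f \<circ> \<theta>) (g \<circ> \<theta>)"
proof -
  have "ratfun M (a \<circ> \<theta>) (b \<circ> \<theta>) = ratfun M (f \<circ> \<theta>) (g \<circ> \<theta>)" if "(a, b) \<in> ratfun M f g" for a b
  proof -
    note m = mem_ratfun[OF assms that]
    have "a (\<theta> x) * g (\<theta> x) = f (\<theta> x) * b (\<theta> x)" if "x \<in> M" for x
    proof -
      have "\<theta> x \<in> M" using that \<theta>(2) by blast
      then show ?thesis using m(2)[of "\<theta> x"] by simp
    qed
    then show ?thesis
      using ratfun_eq_iff[OF fractions_pullback[OF m(1)] fractions_pullback[OF assms]] by simp
  qed
  then have "(\<Union>(a, b)\<in>ratfun M f g. ratfun M (a \<circ> \<theta>) (b \<circ> \<theta>)) = ratfun M (f \<circ> \<theta>) (g \<circ> \<theta>)"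
    by (intro UN_constant_eq[OF self_mem_ratfun[OF assms]]) auto
  then show ?thesis using ratfun_carrier[OF assms] by (simp add: pullback_def)
qed

lemma pullback_regular:
  "real_polynomial_function f \<Longrightarrow> pullback \<theta> (regular_fun M f) = regular_fun M (f \<circ> \<theta>)"
  unfolding regular_fun_def by (subst pullback_ratfun[OF fractions_const]) (auto simp: comp_def)

lemma pullback_hom: "pullback \<theta> \<in> ring_hom F F"
proof (rule ring_hom_memI)
  show "pullback \<theta> \<one>\<^bsub>F\<^esub> = \<one>\<^bsub>F\<^esub>"
    unfolding function_field_one by (subst pullback_ratfun[OF fr_const]) (simp add: comp_def)
  fix A assume "A \<in> carrier F"
  then obtain f g where f: "(f, g) \<in> fractions M" "A = ratfun M f g" by (rule carrier_cases)
  show "pullback \<theta> A \<in> carrier F"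
    unfolding f pullback_ratfun[OF f(1)] by (intro ratfun_carrier fractions_pullback f)
  fix B assume "B \<in> carrier F"
  then obtain a b where a: "(a, b) \<in> fractions M" "B = ratfun M a b" by (rule carrier_cases)
  note f' = fractions_pullback[OF f(1)] and a' = fractions_pullback[OF a(1)]
  show "pullback \<theta> (A \<otimes>\<^bsub>F\<^esub> B) = pullback \<theta> A \<otimes>\<^bsub>F\<^esub> pullback \<theta> B"
    unfolding f a ratfun_mult[OF f(1) a(1)] pullback_ratfun[OF f(1)] pullback_ratfun[OF a(1)]
      pullback_ratfun[OF fractions_mult[OF f(1) a(1)]] ratfun_mult[OF f' a'] by (simp add: comp_def)
  show "pullback \<theta> (A \<oplus>\<^bsub>F\<^esub> B) = pullback \<theta> A \<oplus>\<^bsub>F\<^esub> pullback \<theta> B"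
    unfolding f a ratfun_add[OF f(1) a(1)] pullback_ratfun[OF f(1)] pullback_ratfun[OF a(1)]
      pullback_ratfun[OF fractions_add[OF f(1) a(1)]] ratfun_add[OF f' a'] by (simp add: comp_def)
qed

lemma pullback_involution:
  assumes "\<And>x. \<theta> (\<theta> x) = x" "A \<in> carrier F"
  shows "pullback \<theta> (pullback \<theta> A) = A"
proof -
  obtain f g where f: "(f, g) \<in> fractions M" "A = ratfun M f g" using assms(2) by (rule carrier_cases)
  show ?thesis
    unfolding f pullback_ratfun[OF f(1)] pullback_ratfun[OF fractions_pullback[OF f(1)]]
    by (simp add: comp_def assms(1))
qed

lemma pullback_iso:
  assumes "\<And>x. \<theta> (\<theta> x) = x"
  shows "pullback \<theta> \<in> ring_iso F F" "pullback \<theta> \<in> Bij (carrier F)"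
proof -
  have "pullback \<theta> \<in> carrier F \<rightarrow> carrier F" using pullback_hom by (simp add: ring_hom_def)
  then have bij: "bij_betw (pullback \<theta>) (carrier F) (carrier F)"
    using pullback_involution[OF assms] by (intro bij_betwI) auto
  then show "pullback \<theta> \<in> ring_iso F F" using pullback_hom by (simp add: ring_iso_def)
  show "pullback \<theta> \<in> Bij (carrier F)" using bij by (simp add: Bij_def pullback_def)
qed

end

lemma fixes_generate_field:
  assumes "\<phi> \<in> ring_hom F F" "\<And>x. x \<in> S \<Longrightarrow> \<phi> x = x" "S \<subseteq> carrier F" "x \<in> generate_field F S"
  shows "\<phi> x = x"
proof -
  interpret ring_hom_ring F F \<phi> by (intro ring_hom_ringI2 ring_axioms assms(1))
  have sub: "generate_field F S \<subseteq> carrier F" using generate_field_in_carrier[OF assms(3)] by blast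
  show ?thesis using assms(4)
  proof (induction rule: generate_field.induct)
    case (m_inv h)
    then have h: "h \<in> carrier F" "h \<noteq> \<zero>\<^bsub>F\<^esub>" using sub by auto
    then have u: "h \<in> Units F" by (simp add: field_Units)
    have "h \<otimes>\<^bsub>F\<^esub> \<phi> (inv\<^bsub>F\<^esub> h) = \<phi> (h \<otimes>\<^bsub>F\<^esub> inv\<^bsub>F\<^esub> h)"
      using hom_mult[OF h(1) Units_inv_closed[OF u]] m_inv.IH by simp
    also have "\<dots> = \<one>\<^bsub>F\<^esub>" using Units_r_inv[OF u] by simp
    finally have eq: "h \<otimes>\<^bsub>F\<^esub> \<phi> (inv\<^bsub>F\<^esub> h) = \<one>\<^bsub>F\<^esub>" .
    have closed: "\<phi> (inv\<^bsub>F\<^esub> h) \<in> carrier F" by (rule hom_closed[OF Units_inv_closed[OF u]])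
    show ?case
      using inv_unique'[OF h(1) closed eq] eq m_comm[OF h(1) closed] by simp
  qed (simp_all add: assms(2) subsetD[OF sub])
qed

end

section \<open>The Galois group\<close>

text \<open>As introduction rules for \<open>auto\<close> these unify with every function and diverge.\<close>

declare real_polynomial_function.intros [rule del]

text \<open>The effect of mirroring a realization: distances stay, orientations change.\<close>

definition reflect :: "'n::finite cm_space \<Rightarrow> 'n cm_space" where
  "reflect p = (fst p, - snd p)"

lemma d_coord_reflect [simp]: "d_coord u v (reflect p) = d_coord u v p"
  by (simp add: reflect_def d_coord_def)

lemma s_coord_reflect [simp]: "s_coord i (reflect p) = - s_coord i p"
  by (simp add: reflect_def s_coord_def)

lemma gram_reflect [simp]:
  "axial i (reflect p) = axial i p" "radial i (reflect p) = radial i p"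
  "cross_gram i j (reflect p) = cross_gram i j p"
  by (simp_all add: axial_def radial_def cross_gram_def)

lemma reflect_reflect [simp]: "reflect (reflect p) = p"
  by (simp add: reflect_def)

lemma real_polynomial_function_reflect:
  fixes f :: "'n::finite cm_space \<Rightarrow> real"
  assumes "real_polynomial_function f"
  shows "real_polynomial_function (f \<circ> reflect)"
proof -
  have "bounded_linear (reflect :: 'n cm_space \<Rightarrow> _)"
    unfolding reflect_def by (intro bounded_linear_Pair bounded_linear_fst bounded_linear_minus bounded_linear_snd)
  then show ?thesis
    using real_polynomial_function_compose[OF polynomial_function_bounded_linear assms] by blast
qed

context elliptic_motion
begin

sublocale irreducible_variety M
  by standard (rule irreducible)

interpretation field F by (rule field_F)

lemma reflect_image: "reflect ` M = M"
proof -
  have "reflect p \<in> M" if "p \<in> M" for p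
    using that unfolding M_iff by simp
  moreover from this have "p \<in> reflect ` M" if "p \<in> M" for p
    using that by (intro image_eqI[of _ _ "reflect p"]) auto
  ultimately show ?thesis by blast
qed

text \<open>\<open>diag_at\<close> with its denominators cleared, so that the diagonal satisfies an
  equation between polynomial functions on \<open>M\<close>.\<close>

definition diag_num :: "'n \<Rightarrow> real \<Rightarrow> real" where
  "diag_num i x = x * radial_at (i + 1) x * ((l (Rim i) Apex_B)\<^sup>2 + (l (Rim (i + 2)) Apex_B)\<^sup>2)
     - 2 * (gram2_at i x + radial_at (i + 1) x * axial_at i x * axial_at (i + 2) x)"

lemma M_diag_num:
  assumes "p \<in> M"
  shows "(ax p * radial_at (i + 1) (ax p)) * d_coord (Rim i) (Rim (i + 2)) p = diag_num i (ax p)"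
proof -
  have x: "ax p \<noteq> 0" and r: "radial_at (i + 1) (ax p) \<noteq> 0"
    using M_X_bounds[OF assms] x1_pos radial_at_nz by (linarith, blast)
  have "ax p * r * (a - 2 * (g / r + e) / ax p) = ax p * r * a - 2 * (g + r * e)"
    if "r \<noteq> 0" for a g e r using x that by (simp add: field_simps)
  from this[OF r] show ?thesis by (simp add: M_diag[OF assms] diag_at_def diag_num_def mult.assoc)
qed

lemma polynomial_at:
  "real_polynomial_function (\<lambda>x. x * radial_at i x)" "real_polynomial_function (diag_num i)"
  unfolding diag_num_def gram2_at_def gram_at_def radial_at_def axial_at_def
  by (intro polynomial_intros real_polynomial_function_divide_const
      real_polynomial_function.intros(1) bounded_linear_ident)+

lemma real_polynomial_function_ax:
  "real_polynomial_function u \<Longrightarrow> real_polynomial_function (\<lambda>p. u (ax p))"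
  using real_polynomial_function_compose[OF real_polynomial_function_d_coord[unfolded real_polynomial_function_eq], of u]
  by (simp add: comp_def)

lemma s_coord_nonzero: "\<exists>p\<in>M. s_coord i p \<noteq> 0"
proof -
  obtain p where "p \<in> M" "Y p = (x2 - x1) / 2" using point[OF midpoint_eq] by blast
  then show ?thesis using k_nz x1_less by (intro bexI[of _ p]) (auto simp: M_s_coord)
qed

lemma hom_ax:
  assumes \<phi>: "\<phi> \<in> ring_hom F F"
    and const: "\<And>c. \<phi> (regular_fun M (\<lambda>x. c)) = regular_fun M (\<lambda>x. c)"
    and ax: "\<phi> (regular_fun M ax) = regular_fun M ax"
    and u: "real_polynomial_function u"
  shows "\<phi> (regular_fun M (\<lambda>p. u (ax p))) = regular_fun M (\<lambda>p. u (ax p))"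
  using u
proof induction
  case (linear u)
  interpret bounded_linear u by (rule linear)
  have c: "real_polynomial_function (\<lambda>p :: 'n cm_space. u 1)" by (rule real_polynomial_function.intros(2))
  note p = real_polynomial_function_d_coord[of Apex_T Apex_B]
  have "u (ax p) = ax p * u 1" for p using scaleR[of "ax p" 1] by simp
  then show ?case
    using ring_hom_mult[OF \<phi> regular_carrier[OF p] regular_carrier[OF c]] const ax
    by (simp add: regular_mult[OF p c])
next
  case (const c)
  show ?case by (rule assms(2))
next
  case (add u v)
  note u = real_polynomial_function_ax[OF add(1)] and v = real_polynomial_function_ax[OF add(2)]
  show ?case
    using ring_hom_add[OF \<phi> regular_carrier[OF u] regular_carrier[OF v]] add(3,4) by (simp add: regular_add[OF u v])
next
  case (mult u v)
  note u = real_polynomial_function_ax[OF mult(1)] and v = real_polynomial_function_ax[OF mult(2)]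
  show ?case
    using ring_hom_mult[OF \<phi> regular_carrier[OF u] regular_carrier[OF v]] mult(3,4) by (simp add: regular_mult[OF u v])
qed

text \<open>
  The function field is generated over \<open>\<real>(d\<^sub>T\<^sub>B)\<close> by a single oriented volume, so an
  automorphism is determined by the sign that it gives to this volume.
\<close>

lemma hom_regular:
  assumes \<phi>: "\<phi> \<in> ring_hom F F"
    and const: "\<And>c. \<phi> (regular_fun M (\<lambda>x. c)) = regular_fun M (\<lambda>x. c)"
    and ax: "\<phi> (regular_fun M ax) = regular_fun M ax"
    and \<theta>: "\<theta> = id \<or> \<theta> = reflect"
    and s0: "\<phi> (regular_fun M (s_coord 0)) = regular_fun M (s_coord 0 \<circ> \<theta>)"
    and f: "real_polynomial_function f"
  shows "\<phi> (regular_fun M f) = regular_fun M (f \<circ> \<theta>)"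
proof -
  have d_\<theta>: "d_coord u v \<circ> \<theta> = d_coord u v" for u v :: "'n vertex" using \<theta> by (auto simp: fun_eq_iff)
  have poly_\<theta>: "real_polynomial_function (g \<circ> \<theta>)" if "real_polynomial_function g" for g
    using \<theta> real_polynomial_function_reflect[OF that] that by (elim disjE) simp_all
  \<comment> \<open>\<open>P\<close> is closed under sums, products and changes away from
    \<open>M\<close>, so only the coordinate functions need separate treatment.\<close>
  define P where "P g \<longleftrightarrow> real_polynomial_function g \<and> \<phi> (regular_fun M g) = regular_fun M (g \<circ> \<theta>)" for g
  have P_const: "P (\<lambda>x. c)" for c using const by (simp add: P_def comp_def real_polynomial_function.intros(2))
  have P_add: "P (\<lambda>x. g x + h x)" and P_mult: "P (\<lambda>x. g x * h x)" if gh: "P g" "P h" for g h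
  proof -
    have g: "real_polynomial_function g" "\<phi> (regular_fun M g) = regular_fun M (g \<circ> \<theta>)"
      and h: "real_polynomial_function h" "\<phi> (regular_fun M h) = regular_fun M (h \<circ> \<theta>)"
      using gh by (auto simp: P_def)
    show "P (\<lambda>x. g x + h x)"
      using ring_hom_add[OF \<phi> regular_carrier[OF g(1)] regular_carrier[OF h(1)]] g h
      by (simp add: P_def regular_add poly_\<theta> real_polynomial_function.intros(3) comp_def[of "\<lambda>x. g x + h x"])
    show "P (\<lambda>x. g x * h x)"
      using ring_hom_mult[OF \<phi> regular_carrier[OF g(1)] regular_carrier[OF h(1)]] g h
      by (simp add: P_def regular_mult poly_\<theta> real_polynomial_function.intros(4) comp_def[of "\<lambda>x. g x * h x"])
  qed
  have P_cong: "P h" if "P g" "real_polynomial_function h" "\<And>p. p \<in> M \<Longrightarrow> h p = g p" for g h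
  proof -
    have "\<theta> p \<in> M" if "p \<in> M" for p using \<theta> that reflect_image by auto
    then have "regular_fun M (h \<circ> \<theta>) = regular_fun M (g \<circ> \<theta>)" "regular_fun M h = regular_fun M g"
      using that poly_\<theta> by (auto simp: P_def regular_eq_iff)
    then show ?thesis using that by (simp add: P_def)
  qed
  have P_ax: "P (\<lambda>p. u (ax p))" if "real_polynomial_function u" for u
  proof -
    have "(\<lambda>p. u (ax p)) \<circ> \<theta> = (\<lambda>p. u (ax p))" using \<theta> by (auto simp: fun_eq_iff)
    then show ?thesis using hom_ax[OF \<phi> const ax that] real_polynomial_function_ax[OF that] by (simp add: P_def)
  qed
  have P_s: "P (s_coord i)" for i
  proof (rule P_cong)
    show "P (\<lambda>p. k i / k 0 * s_coord 0 p)"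
      using s0 real_polynomial_function_s_coord by (intro P_mult P_const) (simp add: P_def)
  qed (auto simp: M_s_coord k_nz real_polynomial_function_s_coord)
  have P_d: "P (d_coord u v)" if uv: "u \<noteq> v" for u v
  proof (cases "adj u v")
    case True
    show ?thesis
      by (rule P_cong[OF P_const[of "(l u v)\<^sup>2"]]) (use True M_edge real_polynomial_function_d_coord in auto)
  next
    case False
    then consider "{u, v} = {Apex_T, Apex_B}" | i where "{u, v} = {Rim i, Rim (i + 2)}"
      using nonadj uv by blast
    then show ?thesis
    proof cases
      case 1
      then have "d_coord u v = ax" by (simp add: d_coord_def fun_eq_iff)
      then show ?thesis using ax d_\<theta> real_polynomial_function_d_coord by (simp add: P_def)
    next
      case 2
      \<comment> \<open>The diagonal is the quotient of \<open>N\<close> by \<open>D\<close>. Both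
        are polynomials in \<open>ax\<close>, hence fixed, and cancelling \<open>D\<close> in the
        field shows that the diagonal is fixed.\<close>
      define D where "D = (\<lambda>p. ax p * radial_at (i + 1) (ax p))"
      define N where "N = (\<lambda>p. diag_num i (ax p))"
      define d where "d = d_coord (Rim i) (Rim (i + 2))"
      have d: "d_coord u v = d" using 2 by (simp add: d_def d_coord_def fun_eq_iff)
      have poly: "real_polynomial_function D" "real_polynomial_function N" "real_polynomial_function d"
        unfolding D_def N_def d_def
        using real_polynomial_function_ax[OF polynomial_at(1)[of "i + 1"]]
          real_polynomial_function_ax[OF polynomial_at(2)[of i]] real_polynomial_function_d_coord by auto
      have ax_\<theta>: "ax (\<theta> p) = ax p" for p using \<theta> by auto
      have "P D" "P N" unfolding D_def N_def by (intro P_ax polynomial_at)+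
      then have "\<phi> (regular_fun M D) = regular_fun M D" "\<phi> (regular_fun M N) = regular_fun M N"
        by (simp_all add: P_def D_def N_def comp_def ax_\<theta>)
      moreover have DN: "regular_fun M D \<otimes>\<^bsub>F\<^esub> regular_fun M d = regular_fun M N"
        unfolding regular_mult[OF poly(1,3)]
          regular_eq_iff[OF real_polynomial_function.intros(4)[OF poly(1,3)] poly(2)]
        by (simp add: D_def N_def d_def M_diag_num)
      ultimately have "regular_fun M D \<otimes>\<^bsub>F\<^esub> \<phi> (regular_fun M d) = regular_fun M D \<otimes>\<^bsub>F\<^esub> regular_fun M d"
        using ring_hom_mult[OF \<phi> regular_carrier[OF poly(1)] regular_carrier[OF poly(3)]] by simp
      moreover have "regular_fun M D \<noteq> \<zero>\<^bsub>F\<^esub>"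
      proof -
        obtain p where p: "p \<in> M" using M_nonempty by blast
        then have "D p \<noteq> 0" using M_X_bounds[OF p] x1_pos radial_at_nz by (auto simp: D_def)
        then have "regular_fun M D \<noteq> regular_fun M (\<lambda>x. 0)"
          using p poly by (auto simp: regular_eq_iff real_polynomial_function.intros(2))
        then show ?thesis by (simp add: function_field_zero regular_fun_def)
      qed
      ultimately have "\<phi> (regular_fun M d) = regular_fun M d"
        using m_lcancel regular_carrier[OF poly(1)] regular_carrier[OF poly(3)]
          ring_hom_closed[OF \<phi> regular_carrier[OF poly(3)]] by blast
      then show ?thesis using poly(3) d d_\<theta>[of u v] by (simp add: P_def)
    qed
  qed
  have P_sum: "P (\<lambda>x. \<Sum>b\<in>B. g b x)" if "\<And>b. b \<in> B \<Longrightarrow> P (g b)" for B :: "'n cm_space set" and g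
    using that by (induction B rule: infinite_finite_induct) (auto intro: P_const P_add)
  have "P f" using f
  proof induction
    case (linear f)
    interpret bounded_linear f by (rule linear)
    have eq: "(\<lambda>p. \<Sum>b\<in>Basis. (p \<bullet> b) * f b) = f"
    proof
      fix p
      have "f p = f (\<Sum>b\<in>Basis. (p \<bullet> b) *\<^sub>R b)" by (simp add: euclidean_representation)
      then show "(\<Sum>b\<in>Basis. (p \<bullet> b) * f b) = f p" by (simp add: sum scaleR)
    qed
    have "P (\<lambda>p. p \<bullet> b)" if "b \<in> Basis" for b
      using that P_d P_s by (cases rule: cm_space_Basis_cases) auto
    then have "P (\<lambda>p. \<Sum>b\<in>Basis. (p \<bullet> b) * f b)" by (intro P_sum P_mult[OF _ P_const])
    then show ?case unfolding eq .
  qed (auto intro: P_const P_add P_mult)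
  then show ?thesis by (simp add: P_def)
qed

text \<open>The squared volume is a polynomial in \<open>ax\<close>, hence fixed; the image of the
  volume is a square root of it, and over an irreducible set only the two signs remain.\<close>

lemma hom_s_coord:
  assumes \<phi>: "\<phi> \<in> ring_hom F F"
    and const: "\<And>c. \<phi> (regular_fun M (\<lambda>x. c)) = regular_fun M (\<lambda>x. c)"
    and ax: "\<phi> (regular_fun M ax) = regular_fun M ax"
  obtains \<theta> where "\<theta> = id \<or> \<theta> = reflect" "\<phi> (regular_fun M (s_coord 0)) = regular_fun M (s_coord 0 \<circ> \<theta>)"
proof -
  let ?s = "s_coord 0 :: 'n cm_space \<Rightarrow> real"
  note s = real_polynomial_function_s_coord[of 0]
  define u where "u x = (k 0)\<^sup>2 * ((x - x1) * (x2 - x))" for x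
  have u: "real_polynomial_function u"
    unfolding u_def
    by (intro polynomial_intros real_polynomial_function.intros(1) bounded_linear_ident)
  have ss_poly: "real_polynomial_function (\<lambda>p. ?s p * ?s p)" by (intro polynomial_intros)
  have "\<phi> (regular_fun M (\<lambda>p. u (ax p))) = regular_fun M (\<lambda>p. u (ax p))"
    by (rule hom_ax[OF \<phi> const ax u])
  moreover have "regular_fun M (\<lambda>p. u (ax p)) = regular_fun M (\<lambda>p. ?s p * ?s p)"
    unfolding regular_eq_iff[OF real_polynomial_function_ax[OF u] ss_poly]
    by (simp add: u_def M_s_coord flip: M_Y_square) (simp add: power2_eq_square algebra_simps)
  ultimately have sq: "\<phi> (regular_fun M ?s) \<otimes>\<^bsub>F\<^esub> \<phi> (regular_fun M ?s) = regular_fun M (\<lambda>p. ?s p * ?s p)"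
    using ring_hom_mult[OF \<phi> regular_carrier[OF s] regular_carrier[OF s]] by (simp add: regular_mult s)
  have "\<phi> (regular_fun M ?s) \<in> carrier F" using ring_hom_closed[OF \<phi> regular_carrier[OF s]] .
  then obtain a b where ab: "(a, b) \<in> fractions M" "\<phi> (regular_fun M ?s) = ratfun M a b"
    by (rule carrier_cases)
  have ss: "(\<lambda>p. ?s p * ?s p, \<lambda>x. 1) \<in> fractions M" by (intro fractions_const polynomial_intros)
  have ab_poly: "real_polynomial_function a" "real_polynomial_function b" using ab(1) by (simp_all add: fractions_iff)
  have "\<forall>p\<in>M. a p * a p = ?s p * ?s p * (b p * b p)"
    using sq unfolding ab(2) ratfun_mult[OF ab(1) ab(1)] unfolding regular_fun_def
      ratfun_eq_iff[OF fractions_mult[OF ab(1) ab(1)] ss] by simp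
  then have "(\<forall>p\<in>M. a p - ?s p * b p = 0) \<or> (\<forall>p\<in>M. a p + ?s p * b p = 0)"
    by (intro irreducible_set_mult_zero[OF irreducible] polynomial_intros ab_poly) (simp add: algebra_simps)
  then show thesis
  proof
    assume "\<forall>p\<in>M. a p - ?s p * b p = 0"
    then have "ratfun M a b = regular_fun M ?s"
      unfolding regular_fun_def ratfun_eq_iff[OF ab(1) fractions_const[OF s]] by simp
    then show thesis using that[of id] ab by simp
  next
    assume *: "\<forall>p\<in>M. a p + ?s p * b p = 0"
    have s': "real_polynomial_function (?s \<circ> reflect)" by (rule real_polynomial_function_reflect[OF s])
    have "ratfun M a b = regular_fun M (?s \<circ> reflect)"
      unfolding regular_fun_def ratfun_eq_iff[OF ab(1) fractions_const[OF s']]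
      using * by (simp add: add_eq_0_iff)
    then show thesis using that[of reflect] ab by simp
  qed
qed

end

lemma forall_5: "(\<forall>i::5. P i) \<longleftrightarrow> P 0 \<and> P 1 \<and> P 2 \<and> P 3 \<and> P 4"
proof -
  have "UNIV = {0, 1, 2, 3, 4 :: 5}"
  proof (rule sym, rule card_subset_eq)
    show "card {0, 1, 2, 3, 4 :: 5} = card (UNIV :: 5 set)" by simp
  qed auto
  then show ?thesis by (metis UNIV_I insertE insertI1 insert_iff singletonD)
qed

section \<open>Computation of the Galois group in the pentagonal case\<close>

locale pentagonal_motion = elliptic_motion l x1 x2 k
  for l :: "5 vertex \<Rightarrow> 5 vertex \<Rightarrow> real" and x1 x2 k
begin

lemma pullback_props:
  assumes "\<theta> = id \<or> \<theta> = reflect"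
  shows "\<And>f. real_polynomial_function f \<Longrightarrow> real_polynomial_function (f \<circ> \<theta>)" "\<theta> ` M = M" "\<And>x. \<theta> (\<theta> x) = x"
  using assms real_polynomial_function_reflect reflect_image by auto

text \<open>\<open>hom_s_coord\<close> and \<open>hom_regular\<close> leave two candidates for an
  automorphism over the base field; both occur, since the pullbacks are involutive and do not change
  \<open>ax\<close> or constants.\<close>

lemma galois_carrier: "carrier (galois_group M) = {pullback id, pullback reflect}"
proof (rule subset_antisym; rule subsetI)
  fix \<phi> assume "\<phi> \<in> carrier (galois_group M)"
  then have \<phi>: "\<phi> \<in> Bij (carrier F)" "\<phi> \<in> ring_hom F F" and fixed: "\<And>x. x \<in> base_field M \<Longrightarrow> \<phi> x = x"
    by (auto simp: galois_group_def ring_iso_def)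
  have base: "\<phi> (regular_fun M (\<lambda>x. c)) = regular_fun M (\<lambda>x. c)" "\<phi> (regular_fun M ax) = regular_fun M ax" for c
    by (rule fixed, unfold base_field_def, rule generate_field.incl, simp)+
  obtain \<theta> where \<theta>: "\<theta> = id \<or> \<theta> = reflect" "\<phi> (regular_fun M (s_coord 0)) = regular_fun M (s_coord 0 \<circ> \<theta>)"
    using hom_s_coord[OF \<phi>(2) base] by blast
  note props = pullback_props[OF \<theta>(1)]
  have "\<phi> A = pullback \<theta> A" for A
  proof (cases "A \<in> carrier F")
    case True
    then obtain f g where "(f, g) \<in> fractions M" "A = ratfun M f g" by (rule carrier_cases)
    then show ?thesis
      using ring_hom_eqI[OF \<phi>(2) hom_regular[OF \<phi>(2) base \<theta>] props(1,2)] pullback_ratfun[OF props(1,2)]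
      by simp
  next
    case False
    then show ?thesis using \<phi>(1) by (simp add: Bij_def pullback_def extensional_def)
  qed
  then have "\<phi> = pullback \<theta>" by blast
  then show "\<phi> \<in> {pullback id, pullback reflect}" using \<theta>(1) by blast
next
  fix \<phi> assume "\<phi> \<in> {pullback id, pullback reflect}"
  then obtain \<theta> where \<theta>: "\<theta> = id \<or> \<theta> = reflect" "\<phi> = pullback \<theta>" by blast
  note props = pullback_props[OF \<theta>(1)]
  have "pullback \<theta> x = x" if "x \<in> base_field M" for x
  proof (rule fixes_generate_field[OF pullback_hom[OF props(1,2)] _ _ that[unfolded base_field_def]])
    let ?S = "insert (regular_fun M ax) (range (\<lambda>c. regular_fun M (\<lambda>x. c)))"
    show "pullback \<theta> y = y" if "y \<in> ?S" for y
    proof -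
      from that consider "y = regular_fun M ax" | c where "y = regular_fun M (\<lambda>x. c)" by blast
      then show ?thesis
      proof cases
        case 1
        have "ax \<circ> \<theta> = ax" using \<theta>(1) by (auto simp: fun_eq_iff)
        then show ?thesis
          using 1 pullback_regular[OF props(1,2) real_polynomial_function_d_coord[of Apex_T Apex_B]] by simp
      next
        case 2
        then show ?thesis
          using pullback_regular[OF props(1,2) real_polynomial_function.intros(2)[of c]] by (simp add: comp_def)
      qed
    qed
    show "?S \<subseteq> carrier F"
      by (simp add: image_subset_iff regular_carrier real_polynomial_function_d_coord
          real_polynomial_function.intros(2))
  qed
  then show "\<phi> \<in> carrier (galois_group M)"
    unfolding \<theta>(2) galois_group_def using pullback_iso[OF props] by simp
qed

lemma pullback_s_fun: "pullback id (s_fun M i) = s_fun M i" "pullback reflect (s_fun M i) = \<ominus>\<^bsub>F\<^esub> s_fun M i"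
proof -
  note s = real_polynomial_function_s_coord[of i]
  note 1 = pullback_props[of id, OF disjI1[OF refl]] and 2 = pullback_props[of reflect, OF disjI2[OF refl]]
  show "pullback id (s_fun M i) = s_fun M i"
    unfolding s_fun_def using pullback_regular[OF 1(1,2) s] by simp
  show "pullback reflect (s_fun M i) = \<ominus>\<^bsub>F\<^esub> s_fun M i"
    unfolding s_fun_def regular_uminus[OF s] using pullback_regular[OF 2(1,2) s] by (simp add: comp_def)
qed

text \<open>Ensures that the identity receives the tuple 0, as an entry is 1 whenever the image
  equals the negative.\<close>

lemma s_fun_neq_uminus: "s_fun M i \<noteq> \<ominus>\<^bsub>F\<^esub> s_fun M i"
proof -
  note s = real_polynomial_function_s_coord[of i]
  show ?thesis
    unfolding s_fun_def regular_uminus[OF s] regular_eq_iff[OF s real_polynomial_function_uminus[OF s]]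
    using s_coord_nonzero[of i] by auto
qed

lemma galois_tuple_pullback: "galois_tuple M (pullback id) = 0" "galois_tuple M (pullback reflect) = (\<chi> i. 1)"
  unfolding galois_tuple_def pullback_s_fun using s_fun_neq_uminus by (simp_all add: vec_eq_iff)

lemma galois_mult:
  "pullback id \<otimes>\<^bsub>galois_group M\<^esub> pullback id = pullback id"
  "pullback id \<otimes>\<^bsub>galois_group M\<^esub> pullback reflect = pullback reflect"
  "pullback reflect \<otimes>\<^bsub>galois_group M\<^esub> pullback id = pullback reflect"
  "pullback reflect \<otimes>\<^bsub>galois_group M\<^esub> pullback reflect = pullback id"
proof -
  note 1 = pullback_props[of id, OF disjI1[OF refl]] and 2 = pullback_props[of reflect, OF disjI2[OF refl]]
  have id: "pullback id A = A" if "A \<in> carrier F" for A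
  proof -
    obtain f g where "(f, g) \<in> fractions M" "A = ratfun M f g" using \<open>A \<in> carrier F\<close> by (rule carrier_cases)
    then show ?thesis using pullback_ratfun[OF 1(1,2)] by simp
  qed
  have "pullback \<theta> \<in> Bij (carrier F)" if "\<theta> = id \<or> \<theta> = reflect" for \<theta>
    using pullback_iso(2)[OF pullback_props[OF that]] .
  then have bij: "pullback id \<in> Bij (carrier F)" "pullback reflect \<in> Bij (carrier F)" by blast+
  have closed: "pullback reflect A \<in> carrier F" if "A \<in> carrier F" for A
    using ring_hom_closed[OF pullback_hom[OF 2(1,2)] that] by simp
  have outside: "pullback \<theta> A = undefined" if "A \<notin> carrier F" for \<theta> A
    using that by (simp add: pullback_def)
  have mult: "f \<otimes>\<^bsub>galois_group M\<^esub> g = compose (carrier F) f g" if "f \<in> Bij (carrier F)" "g \<in> Bij (carrier F)" for f g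
    using that by (simp add: galois_group_def BijGroup_def)
  show "pullback id \<otimes>\<^bsub>galois_group M\<^esub> pullback id = pullback id"
    unfolding mult[OF bij(1,1)] by (rule ext) (simp add: compose_def id outside)
  show "pullback id \<otimes>\<^bsub>galois_group M\<^esub> pullback reflect = pullback reflect"
    unfolding mult[OF bij(1,2)] by (rule ext) (simp add: compose_def id outside closed)
  show "pullback reflect \<otimes>\<^bsub>galois_group M\<^esub> pullback id = pullback reflect"
    unfolding mult[OF bij(2,1)] by (rule ext) (simp add: compose_def id outside)
  show "pullback reflect \<otimes>\<^bsub>galois_group M\<^esub> pullback reflect = pullback id"
    unfolding mult[OF bij(2,2)] by (rule ext) (simp add: compose_def id outside pullback_involution[OF 2])
qed

lemma generate_ones: "generate Z2_tuples {\<chi> i. 1} = {0, \<chi> i. 1}"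
proof (rule subset_antisym; rule subsetI)
  let ?v = "(\<chi> i. 1) :: bit ^ 5"
  have vv: "2 * x = 0" for x :: "bit ^ 5" by (simp add: vec_eq_iff)
  have "y = x" if "x + y = 0" for x y :: "bit ^ 5"
    using vv[of x] that add_left_imp_eq[of x y x] by (simp only: mult_2)
  then have inv: "inv\<^bsub>Z2_tuples\<^esub> x = x" for x
    unfolding m_inv_def by (intro the_equality) (simp_all add: Z2_tuples_def vv)
  fix x assume "x \<in> generate Z2_tuples {?v}"
  then show "x \<in> {0, ?v}"
  proof induction
    case (eng a b)
    then show ?case by (auto simp: Z2_tuples_def vv)
  qed (simp_all add: inv, simp add: Z2_tuples_def)
next
  fix x :: "bit ^ 5" assume "x \<in> {0, \<chi> i. 1}"
  then show "x \<in> generate Z2_tuples {\<chi> i. 1}"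
    using generate.one[of Z2_tuples "{\<chi> i. 1}"] generate.incl[of "\<chi> i. 1" "{\<chi> i. 1}" Z2_tuples]
    by (auto simp: Z2_tuples_def)
qed

lemma vector_ones: "vector [1, 1, 1, 1, 1] = ((\<chi> i. 1) :: bit ^ 5)"
  unfolding vector_def vec_eq_iff forall_5 by simp

lemma has_galois_group: "has_galois_group M (generate Z2_tuples {vector [1, 1, 1, 1, 1]})"
  unfolding has_galois_group_def vector_ones generate_ones
proof (intro conjI ballI allI)
  fix \<phi> i assume "\<phi> \<in> carrier (galois_group M)"
  then show "\<phi> (s_fun M i) = s_fun M i \<or> \<phi> (s_fun M i) = \<ominus>\<^bsub>F\<^esub> s_fun M i"
    unfolding galois_carrier using pullback_s_fun by auto
next
  have vv: "2 * (\<chi> i. 1) = (0 :: bit ^ 5)" by (simp add: vec_eq_iff)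
  have ne: "(0 :: bit ^ 5) \<noteq> (\<chi> i. 1)" by (simp add: vec_eq_iff)
  have "bij_betw (galois_tuple M) {pullback id, pullback reflect} {0, \<chi> i. 1}"
    using ne unfolding bij_betw_def by (auto simp: galois_tuple_pullback inj_on_def)
  then show "galois_tuple M \<in> iso (galois_group M) (Z2_tuples\<lparr>carrier := {0, \<chi> i. 1}\<rparr>)"
    unfolding iso_def hom_def galois_carrier
    by (auto simp: galois_carrier galois_mult galois_tuple_pullback Z2_tuples_def vv)
qed

end

section \<open>An explicit pair of octahedra\<close>

lemma forall_4_mod: "(\<forall>i::4. P i) \<longleftrightarrow> P 0 \<and> P 1 \<and> P 2 \<and> P 3"
proof -
  have "(4 :: 4) = 0" by simp
  then show ?thesis unfolding forall_4 by metis
qed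


lemma nonadj_4:
  fixes u v :: "4 vertex"
  assumes "u \<noteq> v" "\<not> adj u v"
  shows "{u, v} = {Apex_T, Apex_B} \<or> (\<exists>i. {u, v} = {Rim i, Rim (i + 2)})"
proof -
  have "\<forall>i j :: 4. i \<noteq> j \<longrightarrow> j \<noteq> i + 1 \<longrightarrow> i \<noteq> j + 1 \<longrightarrow> j = i + 2"
    unfolding forall_4_mod by simp
  then show ?thesis using assms by (cases u; cases v) auto
qed

lemma nonadj_5:
  fixes u v :: "5 vertex"
  assumes "u \<noteq> v" "\<not> adj u v"
  shows "{u, v} = {Apex_T, Apex_B} \<or> (\<exists>i. {u, v} = {Rim i, Rim (i + 2)})"
proof -
  have "\<forall>i j :: 5. i \<noteq> j \<longrightarrow> j \<noteq> i + 1 \<longrightarrow> i \<noteq> j + 1 \<longrightarrow> j = i + 2 \<or> i = j + 2"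
    unfolding forall_5 by simp
  then show ?thesis using assms by (cases u; cases v) (auto simp: insert_commute)
qed

lemma edge_length_commute: "edge_length \<rho> u v = edge_length \<rho> v u"
  by (simp add: edge_length_def norm_minus_commute)

lemma inducesI:
  fixes \<rho> \<sigma> :: "'n::comm_ring_1 vertex \<Rightarrow> real ^ 3"
  assumes "\<And>i. edge_length \<rho> (Rim i) (Rim (i + 1)) = edge_length \<sigma> (Rim i) (Rim (i + 1))"
    "\<And>i. edge_length \<rho> (Rim i) Apex_T = edge_length \<sigma> (Rim i) Apex_T"
    "\<And>i. edge_length \<rho> (Rim i) Apex_B = edge_length \<sigma> (Rim i) Apex_B"
  shows "induces \<rho> (edge_length \<sigma>)"
  unfolding induces_def
proof (intro allI impI)
  fix u v :: "'n vertex" assume "adj u v"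
  then show "edge_length \<rho> u v = edge_length \<sigma> u v"
    using assms by (cases u; cases v) (auto, (metis edge_length_commute)+)
qed

lemma realizationI:
  fixes \<rho> :: "'n::comm_ring_1 vertex \<Rightarrow> real ^ 3"
  assumes "\<And>i. edge_length \<rho> (Rim i) (Rim (i + 1)) \<noteq> 0"
    "\<And>i. edge_length \<rho> (Rim i) Apex_T \<noteq> 0" "\<And>i. edge_length \<rho> (Rim i) Apex_B \<noteq> 0"
  shows "realization \<rho>"
  unfolding realization_def
proof (intro allI impI)
  fix u v :: "'n vertex" assume "adj u v"
  then have "edge_length \<rho> u v \<noteq> 0"
    using assms by (cases u; cases v) (auto, (metis edge_length_commute)+)
  then show "\<rho> u \<noteq> \<rho> v" by (auto simp: edge_length_def)
qed

text \<open>Heron's formula: four times the squared area of the triangle with squared sides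
  \<open>b\<^sup>2\<close>, \<open>t\<^sup>2\<close> and \<open>x\<close>. The roots in
  \<open>x\<close> are its degenerate cases.\<close>

lemma off_axis_factored:
  fixes x b t :: real
  shows "x * b\<^sup>2 - ((b\<^sup>2 + x - t\<^sup>2) / 2)\<^sup>2 = (x - (b - t)\<^sup>2) * ((b + t)\<^sup>2 - x) / 4"
  by (simp add: power2_eq_square field_simps)

text \<open>
  Vertex 0 is placed at the origin with \<open>|T| = 3\<close>, \<open>|B| = 7\<close>. A point \<open>w\<close> is given by
  \<open>(w \<bullet> T, w \<bullet> B, \<gamma>)\<close> where \<open>w \<bullet> (T \<times> B) = \<gamma> y\<close>. The squared length of the axis is \<open>x\<close>,
  hence \<open>T \<bullet> B = (58 - x) / 2\<close> and \<open>|T \<times> B|\<^sup>2 = (100 - x) (x - 16) / 4\<close>.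
\<close>

definition gram_root :: "real \<Rightarrow> real" where
  "gram_root x = sqrt ((100 - x) * (x - 16) / 4)"

text \<open>Cartesian coordinates in the orthonormal basis obtained by Gram-Schmidt from T and B and
  completed by the direction of T \<times> B. The part of B orthogonal to T has length
  \<open>gram_root x / 3\<close>.\<close>

definition frame :: "real \<Rightarrow> real \<Rightarrow> real \<times> real \<times> real \<Rightarrow> real ^ 3" where
  "frame x y = (\<lambda>(\<alpha>, \<beta>, \<gamma>).
     vector [\<alpha> / 3, 3 * (\<beta> - (58 - x) / 2 * \<alpha> / 9) / gram_root x, \<gamma> * y / gram_root x])"

definition conic :: "real \<Rightarrow> real \<Rightarrow> bool" where
  "conic x y \<longleftrightarrow> y\<^sup>2 = (x - 25) * (97 - x)"

lemma conic_bounds: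
  assumes "conic x y"
  shows "25 \<le> x" "x \<le> 97"
proof -
  have "(x - 25) * (97 - x) \<ge> 0" using assms unfolding conic_def by (metis zero_le_power2)
  then show "25 \<le> x" "x \<le> 97" by (auto simp: zero_le_mult_iff)
qed

lemma gram_root:
  assumes "16 < x" "x < 100"
  shows "gram_root x \<noteq> 0" "(gram_root x)\<^sup>2 = (100 - x) * (x - 16) / 4"
proof -
  have "(100 - x) * (x - 16) / 4 > 0" using assms by simp
  then show "gram_root x \<noteq> 0" "(gram_root x)\<^sup>2 = (100 - x) * (x - 16) / 4"
    unfolding gram_root_def by (auto simp del: zero_less_divide_iff)
qed

text \<open>The quadratic form of the inverse Gram matrix of T, B and T \<times> B, with squared
  lengths 9 and 49 and twice the inner product of T and B equal to \<open>58 - x\<close>;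
  \<open>y\<^sup>2\<close> is rewritten by the conic.\<close>

lemma frame_dist:
  assumes "conic x y"
  shows "(norm (frame x y (\<alpha>, \<beta>, \<gamma>) - frame x y (\<alpha>', \<beta>', \<gamma>')))\<^sup>2 =
    (49 * (\<alpha> - \<alpha>')\<^sup>2 - (58 - x) * (\<alpha> - \<alpha>') * (\<beta> - \<beta>') + 9 * (\<beta> - \<beta>')\<^sup>2
      + (\<gamma> - \<gamma>')\<^sup>2 * ((x - 25) * (97 - x))) / ((100 - x) * (x - 16) / 4)"
proof -
  note b = conic_bounds[OF assms]
  define h where "h = gram_root x"
  have h: "h \<noteq> 0" "h\<^sup>2 = (100 - x) * (x - 16) / 4" unfolding h_def using gram_root[of x] b by auto
  define a where "a = \<alpha> - \<alpha>'"
  define c where "c = \<beta> - \<beta>'"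
  define d where "d = \<gamma> - \<gamma>'"
  define v where "v = frame x y (\<alpha>, \<beta>, \<gamma>) - frame x y (\<alpha>', \<beta>', \<gamma>')"
  have "v $ 1 = a / 3" "v $ 2 = 3 * (c - (58 - x) / 2 * a / 9) / h" "v $ 3 = d * y / h"
    unfolding v_def frame_def a_def c_def d_def h_def[symmetric] using h(1) by (simp_all add: field_simps)
  note comps = this
  have "(norm v)\<^sup>2 = (a / 3)\<^sup>2 + (3 * (c - (58 - x) / 2 * a / 9) / h)\<^sup>2 + (d * y / h)\<^sup>2"
    unfolding power2_norm_eq_inner unfolding inner_vec_def sum_3 comps inner_real_def power2_eq_square by (rule refl)
  also have "\<dots> = a\<^sup>2 / 9 + (9 * (c - (58 - x) * a / 18)\<^sup>2 + d\<^sup>2 * y\<^sup>2) / h\<^sup>2"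
  proof -
    have "3 * (c - (58 - x) / 2 * a / 9) / h = 3 * (c - (58 - x) * a / 18) / h" by simp
    then show ?thesis by (simp only: power_divide power_mult_distrib add_divide_distrib) simp
  qed
  also have "\<dots> = (a\<^sup>2 / 9 * h\<^sup>2 + 9 * (c - (58 - x) * a / 18)\<^sup>2 + d\<^sup>2 * y\<^sup>2) / h\<^sup>2"
    using h(1) by (simp add: add_divide_distrib)
  also have "a\<^sup>2 / 9 * h\<^sup>2 + 9 * (c - (58 - x) * a / 18)\<^sup>2 + d\<^sup>2 * y\<^sup>2 =
      49 * a\<^sup>2 - (58 - x) * a * c + 9 * c\<^sup>2 + d\<^sup>2 * ((x - 25) * (97 - x))"
    unfolding h(2) assms[unfolded conic_def] by (simp add: power2_eq_square field_simps)
  finally show ?thesis unfolding h(2) a_def c_def d_def v_def .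
qed

text \<open>Up to a shear, \<open>frame\<close> scales the three coordinates by 1/3,
  \<open>3 / h\<close> and \<open>y / h\<close>, where \<open>h = gram_root x\<close>; hence the
  factor \<open>y / h\<^sup>2\<close>.\<close>

lemma frame_det:
  assumes "conic x y"
  shows "det (vector [frame x y (a1, b1, c1) - frame x y (a0, b0, c0), frame x y (a2, b2, c2) - frame x y (a0, b0, c0),
      frame x y (a3, b3, c3) - frame x y (a0, b0, c0)] :: real ^ 3 ^ 3) =
    y * det (vector [vector [a1 - a0, b1 - b0, c1 - c0], vector [a2 - a0, b2 - b0, c2 - c0],
      vector [a3 - a0, b3 - b0, c3 - c0]] :: real ^ 3 ^ 3) / ((100 - x) * (x - 16) / 4)"
proof -
  note b = conic_bounds[OF assms]
  define h where "h = gram_root x"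
  have h: "h \<noteq> 0" "h\<^sup>2 = (100 - x) * (x - 16) / 4" unfolding h_def using gram_root[of x] b by auto
  show ?thesis
    unfolding h(2)[symmetric] using h(1)
    by (simp add: det_3 frame_def vector_3 flip: h_def) (simp add: field_simps power2_eq_square)
qed

text \<open>
  The points \<open>p1\<close>, \<open>p3\<close>, \<open>p5\<close> are adjacent to 0, so their first two coordinates are constant; \<open>p5\<close> is
  \<open>99 / 35\<close> times \<open>p1\<close>. The coordinates of \<open>p2\<close> and \<open>p4\<close> solve the linear equations imposed by their
  distances to \<open>p1, p3\<close> and \<open>p3, p5\<close>; their squared distances to 0 are
  \<open>(144 * x - 16400) / (x - 225)\<close> and \<open>4 * (x + 11879) / (25 * (x - 1))\<close>.
\<close>

definition pT :: "real \<Rightarrow> real \<times> real \<times> real" where "pT x = (9, (58 - x) / 2, 0)"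
definition pB :: "real \<Rightarrow> real \<times> real \<times> real" where "pB x = ((58 - x) / 2, 49, 0)"
definition p0 :: "real \<Rightarrow> real \<times> real \<times> real" where "p0 x = (0, 0, 0)"
definition p1 :: "real \<Rightarrow> real \<times> real \<times> real" where "p1 x = (- 15 / 2, 5, 5 / 2)"
definition p2 :: "real \<Rightarrow> real \<times> real \<times> real" where
  "p2 x = ((52 * x - 3700) / (x - 225), (92 * x - 12700) / (x - 225), 6 * (x - 100) / (x - 225))"
definition p3 :: "real \<Rightarrow> real \<times> real \<times> real" where "p3 x = (- 3, 49 / 2, 7 / 2)"
definition p4 :: "real \<Rightarrow> real \<times> real \<times> real" where
  "p4 x = ((4866 - 114 * x) / (5 * (x - 1)), (106 * x + 4646) / (5 * (x - 1)), (x - 100) / (5 * (x - 1)))"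
definition p5 :: "real \<Rightarrow> real \<times> real \<times> real" where "p5 x = (- 297 / 14, 99 / 7, 99 / 14)"

lemmas vertex_defs = pT_def pB_def p0_def p1_def p2_def p3_def p4_def p5_def

lemma frame_norm:
  assumes "conic x y" "0 \<le> d"
    and "25 \<le> x \<Longrightarrow> x \<le> 97 \<Longrightarrow> 4 * (49 * (\<alpha> - \<alpha>')\<^sup>2 - (58 - x) * (\<alpha> - \<alpha>') * (\<beta> - \<beta>') + 9 * (\<beta> - \<beta>')\<^sup>2
      + (\<gamma> - \<gamma>')\<^sup>2 * ((x - 25) * (97 - x))) = d\<^sup>2 * ((100 - x) * (x - 16))"
  shows "norm (frame x y (\<alpha>, \<beta>, \<gamma>) - frame x y (\<alpha>', \<beta>', \<gamma>')) = d"
proof -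
  note b = conic_bounds[OF assms(1)]
  have nz: "(100 - x) * (x - 16) \<noteq> 0" using b by simp
  have "(norm (frame x y (\<alpha>, \<beta>, \<gamma>) - frame x y (\<alpha>', \<beta>', \<gamma>')))\<^sup>2 = d\<^sup>2"
    unfolding frame_dist[OF assms(1)] using assms(3)[OF b] nz by (simp add: divide_eq_eq)
  then show ?thesis using assms(2) by (simp add: power2_eq_iff_nonneg)
qed

lemma axis_norm:
  assumes "conic x y"
  shows "(norm (frame x y (pT x) - frame x y (pB x)))\<^sup>2 = x"
proof -
  have "norm (frame x y (pT x) - frame x y (pB x)) = sqrt x"
    unfolding vertex_defs using conic_bounds[OF assms]
    by (intro frame_norm assms) (auto simp: power2_eq_square field_simps)
  then show ?thesis using conic_bounds[OF assms] by simp
qed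

lemma edge_norms:
  assumes "conic x y"
  shows
    "norm (frame x y (p0 x) - frame x y (pT x)) = 3"
    "norm (frame x y (p0 x) - frame x y (pB x)) = 7"
    "norm (frame x y (p0 x) - frame x y (p1 x)) = 5"
    "norm (frame x y (p3 x) - frame x y (p0 x)) = 7"
    "norm (frame x y (p1 x) - frame x y (pT x)) = 7"
    "norm (frame x y (p1 x) - frame x y (pB x)) = 8"
    "norm (frame x y (p3 x) - frame x y (pT x)) = 8"
    "norm (frame x y (p3 x) - frame x y (pB x)) = 7"
    "norm (frame x y (p2 x) - frame x y (pT x)) = 7"
    "norm (frame x y (p2 x) - frame x y (pB x)) = 3"
    "norm (frame x y (p1 x) - frame x y (p2 x)) = 7"
    "norm (frame x y (p2 x) - frame x y (p3 x)) = 5"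
    "norm (frame x y (p3 x) - frame x y (p4 x)) = 33 / 5"
    "norm (frame x y (p4 x) - frame x y (p5 x)) = 481 / 35"
    "norm (frame x y (p5 x) - frame x y (p0 x)) = 99 / 7"
    "norm (frame x y (p4 x) - frame x y (pT x)) = 37 / 5"
    "norm (frame x y (p4 x) - frame x y (pB x)) = 13 / 5"
    "norm (frame x y (p5 x) - frame x y (pT x)) = 111 / 7"
    "norm (frame x y (p5 x) - frame x y (pB x)) = 104 / 7"
    "norm (frame x y (p5 x) - frame x y (p1 x)) = 64 / 7"
    "norm (frame x y (p0 x) - frame x y (p3 x)) = 7"
  unfolding vertex_defs
  by (rule frame_norm[OF assms]; simp add: power2_eq_square divide_simps; simp add: algebra_simps)+

text \<open>The second hypothesis is \<open>4 * det = 6 * d * ((100 - x) * (x - 16))\<close>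
  multiplied by 12, a factor of the denominators used for \<open>d\<close>.\<close>

lemma frame_volume:
  assumes "conic x y"
    and "25 \<le> x \<Longrightarrow> x \<le> 97 \<Longrightarrow> 48 * det (vector [vector [a1 - a0, b1 - b0, c1 - c0], vector [a2 - a0, b2 - b0, c2 - c0],
      vector [a3 - a0, b3 - b0, c3 - c0]] :: real ^ 3 ^ 3) = 72 * d * ((100 - x) * (x - 16))"
  shows "oriented_volume (frame x y (a1, b1, c1)) (frame x y (a2, b2, c2)) (frame x y (a3, b3, c3)) (frame x y (a0, b0, c0)) =
    d * y"
proof -
  note b = conic_bounds[OF assms(1)]
  have nz: "(100 - x) * (x - 16) \<noteq> 0" using b by simp
  show ?thesis
    unfolding oriented_volume_def frame_det[OF assms(1)] using assms(2)[OF b] nz by (simp add: divide_simps)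
qed

text \<open>As a quadratic in the squared axis length, a squared volume has leading coefficient
  minus the squared opposite edge over 144. With roots 25 and 97 the constants are therefore the
  edge lengths over 12, up to orientation.\<close>

lemma volumes:
  assumes "conic x y"
  shows
    "oriented_volume (frame x y (p0 x)) (frame x y (p1 x)) (frame x y (pT x)) (frame x y (pB x)) = - 5 / 12 * y"
    "oriented_volume (frame x y (p1 x)) (frame x y (p2 x)) (frame x y (pT x)) (frame x y (pB x)) = - 7 / 12 * y"
    "oriented_volume (frame x y (p2 x)) (frame x y (p3 x)) (frame x y (pT x)) (frame x y (pB x)) = 5 / 12 * y"
    "oriented_volume (frame x y (p3 x)) (frame x y (p0 x)) (frame x y (pT x)) (frame x y (pB x)) = 7 / 12 * y"
    "oriented_volume (frame x y (p0 x)) (frame x y (p3 x)) (frame x y (pT x)) (frame x y (pB x)) = - 7 / 12 * y"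
    "oriented_volume (frame x y (p3 x)) (frame x y (p4 x)) (frame x y (pT x)) (frame x y (pB x)) = 33 / 5 / 12 * y"
    "oriented_volume (frame x y (p4 x)) (frame x y (p5 x)) (frame x y (pT x)) (frame x y (pB x)) = - 481 / 35 / 12 * y"
    "oriented_volume (frame x y (p5 x)) (frame x y (p0 x)) (frame x y (pT x)) (frame x y (pB x)) = 99 / 7 / 12 * y"
    "oriented_volume (frame x y (p5 x)) (frame x y (p1 x)) (frame x y (pT x)) (frame x y (pB x)) = 64 / 7 / 12 * y"
  unfolding vertex_defs
  by (rule frame_volume[OF assms]; simp add: det_3 divide_simps; simp add: algebra_simps)+

section \<open>Motions given by coordinates in the frame\<close>

locale frame_motion =
  fixes P :: "real \<Rightarrow> 'n::{finite,comm_ring_1} vertex \<Rightarrow> real \<times> real \<times> real" and r t b k :: "'n \<Rightarrow> real"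
  assumes two: "(2 :: 'n) \<noteq> 0"
    and nonadjacent: "\<And>u v :: 'n vertex. u \<noteq> v \<Longrightarrow> \<not> adj u v \<Longrightarrow>
      {u, v} = {Apex_T, Apex_B} \<or> (\<exists>i. {u, v} = {Rim i, Rim (i + 2)})"
    and apex: "P x Apex_T = pT x" "P x Apex_B = pB x"
    and lengths: "conic x y \<Longrightarrow> edge_length (\<lambda>v. frame x y (P x v)) (Rim i) (Rim (i + 1)) = r i"
      "conic x y \<Longrightarrow> edge_length (\<lambda>v. frame x y (P x v)) (Rim i) Apex_T = t i"
      "conic x y \<Longrightarrow> edge_length (\<lambda>v. frame x y (P x v)) (Rim i) Apex_B = b i"
    and volume: "conic x y \<Longrightarrow> s_coord i (cm_point (\<lambda>v. frame x y (P x v))) = k i * y"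
    and positive: "r i > 0" "t i > 0" "b i > 0"
    and range: "(b i - t i)\<^sup>2 < 25" "97 < (b i + t i)\<^sup>2"
    and k_nonzero: "k i \<noteq> 0"
    and continuous: "continuous_on {25..97} (\<lambda>x. P x v)"
begin

definition conf :: "real \<Rightarrow> real \<Rightarrow> 'n vertex \<Rightarrow> real ^ 3" where
  "conf x y v = frame x y (P x v)"

lemma conf_eq: "conf x y = (\<lambda>v. frame x y (P x v))"
  by (simp add: fun_eq_iff conf_def)

text \<open>Starts at the top \<open>(61, 36)\<close> of the ellipse, where
  \<open>1296 = 36\<^sup>2\<close>. Using the squared axis length as time makes the axis injective,
  and moving it by less than 1 stays away from the flat poses.\<close>

definition path :: "real \<Rightarrow> 'n vertex \<Rightarrow> real ^ 3" where
  "path s = conf (61 + s) (sqrt (1296 - s\<^sup>2))"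

abbreviation l :: "'n vertex \<Rightarrow> 'n vertex \<Rightarrow> real" where "l \<equiv> edge_length (path 0)"

lemma conic_path: "s \<in> {0..<1} \<Longrightarrow> conic (61 + s) (sqrt (1296 - s\<^sup>2))"
proof -
  assume "s \<in> {0..<1}"
  then have "s\<^sup>2 \<le> 1" by (simp add: power_le_one)
  then show ?thesis by (simp add: conic_def power2_eq_square algebra_simps)
qed

lemma l_eq: "l (Rim i) (Rim (i + 1)) = r i" "l (Rim i) Apex_T = t i" "l (Rim i) Apex_B = b i"
  using conic_path[of 0] lengths by (simp_all add: path_def conf_eq)

lemma induces_conf: "conic x y \<Longrightarrow> induces (conf x y) l"
  using lengths l_eq by (intro inducesI) (simp_all add: conf_eq)

lemma realization_conf: "conic x y \<Longrightarrow> realization (conf x y)"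
  using lengths positive by (intro realizationI) (simp_all add: conf_eq less_imp_neq[symmetric])

lemma axis_conf: "conic x y \<Longrightarrow> (norm (conf x y Apex_T - conf x y Apex_B))\<^sup>2 = x"
  by (simp add: conf_def apex axis_norm)

lemma volume_conf: "conic x y \<Longrightarrow> s_coord i (cm_point (conf x y)) = k i * y"
  by (simp add: conf_eq volume)

sublocale elliptic_motion l 25 97 k
proof
  \<comment> \<open>By \<open>range\<close> both roots of Heron's product lie outside the interval
    from 25 to 97.\<close>
  show "x * (l (Rim i) Apex_B)\<^sup>2 - (((l (Rim i) Apex_B)\<^sup>2 + x - (l (Rim i) Apex_T)\<^sup>2) / 2)\<^sup>2 \<noteq> 0"
    if "25 \<le> x" "x \<le> 97" for x i
    unfolding off_axis_factored l_eq using that range[of i] by auto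
  show "\<exists>\<rho>. realization \<rho> \<and> induces \<rho> l \<and> (norm (\<rho> Apex_T - \<rho> Apex_B))\<^sup>2 = x \<and>
      (\<forall>i. s_coord i (cm_point \<rho>) = k i * y)" if "y\<^sup>2 = (x - 25) * (97 - x)" for x y
    using that realization_conf induces_conf axis_conf volume_conf unfolding conic_def by blast
qed (use two nonadjacent k_nonzero in auto)

lemma conf_M:
  assumes "conic x y"
  shows "cm_point (conf x y) \<in> M" "ax (cm_point (conf x y)) = x"
proof -
  show ax: "ax (cm_point (conf x y)) = x" using axis_conf[OF assms] by (simp add: d_coord_cm_point)
  show "cm_point (conf x y) \<in> M"
    using config_M(1)[OF induces_conf[OF assms] volume_conf[OF assms]] assms by (simp add: ax conic_def)
qed

lemma flex_path: "flex (path 0) path"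
proof (rule flexI)
  have "continuous_on {0..<1} (\<lambda>s. path s v)" for v
  proof -
    have cP: "continuous_on {0..<1} (\<lambda>s. P (61 + s) v)"
      by (rule continuous_on_compose2[OF continuous[of v], of _ "\<lambda>s. 61 + s"]) (auto intro!: continuous_intros)
    have nz: "gram_root (61 + s) \<noteq> 0" if "s \<in> {0..<1}" for s using gram_root(1)[of "61 + s"] that by auto
    have "continuous_on {0..<1} (\<lambda>s. gram_root (61 + s))"
      unfolding gram_root_def by (intro continuous_intros) simp
    then have comps: "\<forall>i. continuous_on {0..<1} (\<lambda>s. path s v $ i)"
      unfolding forall_3 path_def conf_def frame_def case_prod_unfold vector_3
      using cP nz by (intro conjI continuous_intros) auto
    have "continuous_on {0..<1} (\<lambda>s. \<chi> i. path s v $ i)"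
      by (rule continuous_on_vec_lambda) (rule comps[rule_format])
    then show ?thesis by simp
  qed
  then show "continuous_on {0..<1} path" by (rule continuous_on_coordinatewise_then_product)
  show "realization (path s) \<and> induces (path s) l" if "s \<in> {0..<1}" for s
    using realization_conf induces_conf conic_path[OF that] by (simp add: path_def)
  show "inj_on (\<lambda>s. norm (path s Apex_T - path s Apex_B)) {0..<1}"
  proof (rule inj_onI)
    fix s s' assume *: "s \<in> {0..<1}" "s' \<in> {0..<1}"
      "norm (path s Apex_T - path s Apex_B) = norm (path s' Apex_T - path s' Apex_B)"
    show "s = s'"
      using axis_conf[OF conic_path[OF *(1)], folded path_def]
        axis_conf[OF conic_path[OF *(2)], folded path_def] unfolding *(3) by linarith
  qed
qed

lemma contains_path: "contains_flex M path"
  unfolding contains_flex_def using conf_M(1)[OF conic_path, folded path_def] by blast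

lemma two_flat_poses: "card (flat_poses l M) = 2"
proof (rule card_flat_poses)
  fix x :: real assume x: "x \<in> {25, 97}"
  then have c: "conic x 0" by (auto simp: conic_def)
  \<comment> \<open>For \<open>y = 0\<close> the third frame coordinate of every vertex
    vanishes.\<close>
  have "coplanar (range (conf x 0))"
  proof -
    have "conf x 0 v \<in> affine hull {0, axis 1 1, axis 2 1}" for v
    proof -
      define p q where "p = conf x 0 v $ 1" and "q = conf x 0 v $ 2"
      have "conf x 0 v $ 3 = 0" by (simp add: conf_def frame_def case_prod_unfold)
      then have "conf x 0 v = (1 - p - q) *\<^sub>R 0 + p *\<^sub>R axis 1 1 + q *\<^sub>R axis 2 1"
        by (simp add: vec_eq_iff forall_3 p_def q_def axis_def)
      then show ?thesis unfolding affine_hull_3 by (intro CollectI exI[of _ "1 - p - q"] exI[of _ p] exI[of _ q]) simp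
    qed
    then show ?thesis unfolding coplanar_def by blast
  qed
  then show "\<exists>\<rho>. realization \<rho> \<and> induces \<rho> l \<and> cm_point \<rho> \<in> M \<and> ax (cm_point \<rho>) = x \<and> coplanar (range \<rho>)"
    using realization_conf[OF c] induces_conf[OF c] conf_M[OF c] by blast
qed

end

section \<open>The two octahedra and the pentagonal bipyramid\<close>

definition kite :: "real \<Rightarrow> 4 vertex \<Rightarrow> real \<times> real \<times> real" where
  "kite x v = (case v of Apex_T \<Rightarrow> pT x | Apex_B \<Rightarrow> pB x
    | Rim i \<Rightarrow> if i = 1 then p1 x else if i = 2 then p2 x else if i = 3 then p3 x else p0 x)"

definition pentagon_part :: "real \<Rightarrow> 4 vertex \<Rightarrow> real \<times> real \<times> real" where
  "pentagon_part x v = (case v of Apex_T \<Rightarrow> pT x | Apex_B \<Rightarrow> pB x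
    | Rim i \<Rightarrow> if i = 1 then p3 x else if i = 2 then p4 x else if i = 3 then p5 x else p0 x)"

text \<open>Label 5 is the index 0 of the type \<open>5\<close>: it is the default branch here and
  the first entry of every \<open>values5\<close>.\<close>

definition pentagon :: "real \<Rightarrow> 5 vertex \<Rightarrow> real \<times> real \<times> real" where
  "pentagon x v = (case v of Apex_T \<Rightarrow> pT x | Apex_B \<Rightarrow> pB x
    | Rim i \<Rightarrow> if i = 1 then p1 x else if i = 2 then p2 x else if i = 3 then p3 x else if i = 4 then p4 x
        else p5 x)"

definition values4 :: "'a \<Rightarrow> 'a \<Rightarrow> 'a \<Rightarrow> 'a \<Rightarrow> 4 \<Rightarrow> 'a" where
  "values4 a0 a1 a2 a3 i = (if i = 0 then a0 else if i = 1 then a1 else if i = 2 then a2 else a3)"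

definition values5 :: "'a \<Rightarrow> 'a \<Rightarrow> 'a \<Rightarrow> 'a \<Rightarrow> 'a \<Rightarrow> 5 \<Rightarrow> 'a" where
  "values5 a0 a1 a2 a3 a4 i =
    (if i = 0 then a0 else if i = 1 then a1 else if i = 2 then a2 else if i = 3 then a3 else a4)"

text \<open>The poles lie outside the interval: 225 for \<open>p2\<close>, where the neighbours 1
  and 3 reach the axis (\<open>(7 + 8)\<^sup>2\<close>), and 1 for \<open>p4\<close>, where 3 and 5
  do (\<open>(8 - 7)\<^sup>2\<close>, also \<open>(111 / 7 - 104 / 7)\<^sup>2\<close>).\<close>

lemma continuous_vertices:
  "continuous_on {25..97} pT" "continuous_on {25..97} pB" "continuous_on {25..97} p0"
  "continuous_on {25..97} p1" "continuous_on {25..97} p2" "continuous_on {25..97} p3"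
  "continuous_on {25..97} p4" "continuous_on {25..97} p5"
  unfolding vertex_defs by (auto intro!: continuous_intros)

lemma combine_frame:
  "combine (\<lambda>v. frame x y (kite x v)) (\<lambda>v. frame x y (pentagon_part x v)) = (\<lambda>v. frame x y (pentagon x v))"
  by (auto simp: fun_eq_iff combine_def kite_def pentagon_part_def pentagon_def split: vertex.split)

interpretation K: frame_motion kite "values4 5 7 5 7" "values4 3 7 7 8" "values4 7 8 3 7"
  "values4 (- 5 / 12) (- 7 / 12) (5 / 12) (7 / 12)"
proof
  fix x y :: real assume c: "conic x y"
  let ?\<rho> = "\<lambda>v. frame x y (kite x v)"
  have "\<forall>i. edge_length ?\<rho> (Rim i) (Rim (i + 1)) = values4 5 7 5 7 i"
    "\<forall>i. edge_length ?\<rho> (Rim i) Apex_T = values4 3 7 7 8 i"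
    "\<forall>i. edge_length ?\<rho> (Rim i) Apex_B = values4 7 8 3 7 i"
    "\<forall>i. s_coord i (cm_point ?\<rho>) = values4 (- 5 / 12) (- 7 / 12) (5 / 12) (7 / 12) i * y"
    unfolding forall_4_mod by (simp_all add: edge_length_def kite_def values4_def s_coord_cm_point edge_norms[OF c] volumes[OF c])
  then show "edge_length ?\<rho> (Rim i) (Rim (i + 1)) = values4 5 7 5 7 i"
    "edge_length ?\<rho> (Rim i) Apex_T = values4 3 7 7 8 i"
    "edge_length ?\<rho> (Rim i) Apex_B = values4 7 8 3 7 i"
    "s_coord i (cm_point ?\<rho>) = values4 (- 5 / 12) (- 7 / 12) (5 / 12) (7 / 12) i * y" for i
    by blast+
next
  show "continuous_on {25..97} (\<lambda>x. kite x v)" for v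
  proof (cases v)
    case (Rim i)
    then show ?thesis
      using continuous_vertices by (cases "i = 1"; cases "i = 2"; cases "i = 3") (simp_all add: kite_def)
  qed (use continuous_vertices in \<open>simp_all add: kite_def\<close>)
qed (simp_all add: nonadj_4 kite_def, auto simp: values4_def power2_eq_square)

interpretation Q: frame_motion pentagon_part "values4 7 (33 / 5) (481 / 35) (99 / 7)"
  "values4 3 8 (37 / 5) (111 / 7)" "values4 7 7 (13 / 5) (104 / 7)"
  "values4 (- 7 / 12) (33 / 60) (- 481 / 420) (99 / 84)"
proof
  fix x y :: real assume c: "conic x y"
  let ?\<rho> = "\<lambda>v. frame x y (pentagon_part x v)"
  have "\<forall>i. edge_length ?\<rho> (Rim i) (Rim (i + 1)) = values4 7 (33 / 5) (481 / 35) (99 / 7) i"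
    "\<forall>i. edge_length ?\<rho> (Rim i) Apex_T = values4 3 8 (37 / 5) (111 / 7) i"
    "\<forall>i. edge_length ?\<rho> (Rim i) Apex_B = values4 7 7 (13 / 5) (104 / 7) i"
    "\<forall>i. s_coord i (cm_point ?\<rho>) = values4 (- 7 / 12) (33 / 60) (- 481 / 420) (99 / 84) i * y"
    unfolding forall_4_mod by (simp_all add: edge_length_def pentagon_part_def values4_def s_coord_cm_point edge_norms[OF c] volumes[OF c])
  then show "edge_length ?\<rho> (Rim i) (Rim (i + 1)) = values4 7 (33 / 5) (481 / 35) (99 / 7) i"
    "edge_length ?\<rho> (Rim i) Apex_T = values4 3 8 (37 / 5) (111 / 7) i"
    "edge_length ?\<rho> (Rim i) Apex_B = values4 7 7 (13 / 5) (104 / 7) i"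
    "s_coord i (cm_point ?\<rho>) = values4 (- 7 / 12) (33 / 60) (- 481 / 420) (99 / 84) i * y" for i
    by blast+
next
  show "continuous_on {25..97} (\<lambda>x. pentagon_part x v)" for v
  proof (cases v)
    case (Rim i)
    then show ?thesis
      using continuous_vertices by (cases "i = 1"; cases "i = 2"; cases "i = 3") (simp_all add: pentagon_part_def)
  qed (use continuous_vertices in \<open>simp_all add: pentagon_part_def\<close>)
qed (simp_all add: nonadj_4 pentagon_part_def, auto simp: values4_def power2_eq_square)

text \<open>The edge from 5 to 1 lies on a ray from the forgotten vertex 0, so its length is
  \<open>99 / 7 - 5 = 64 / 7\<close>. The volume constants of (5, 0) and (0, 1) add up likewise:
  \<open>99 / 84 - 5 / 12 = 64 / 84\<close>.\<close>

interpretation N: frame_motion pentagon "values5 (64 / 7) 7 5 (33 / 5) (481 / 35)"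
  "values5 (111 / 7) 7 7 8 (37 / 5)" "values5 (104 / 7) 8 3 7 (13 / 5)"
  "values5 (64 / 84) (- 7 / 12) (5 / 12) (33 / 60) (- 481 / 420)"
proof
  fix x y :: real assume c: "conic x y"
  let ?\<rho> = "\<lambda>v. frame x y (pentagon x v)"
  have "\<forall>i. edge_length ?\<rho> (Rim i) (Rim (i + 1)) = values5 (64 / 7) 7 5 (33 / 5) (481 / 35) i"
    "\<forall>i. edge_length ?\<rho> (Rim i) Apex_T = values5 (111 / 7) 7 7 8 (37 / 5) i"
    "\<forall>i. edge_length ?\<rho> (Rim i) Apex_B = values5 (104 / 7) 8 3 7 (13 / 5) i"
    "\<forall>i. s_coord i (cm_point ?\<rho>) = values5 (64 / 84) (- 7 / 12) (5 / 12) (33 / 60) (- 481 / 420) i * y"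
    unfolding forall_5 by (simp_all add: edge_length_def pentagon_def values5_def s_coord_cm_point edge_norms[OF c] volumes[OF c])
  then show "edge_length ?\<rho> (Rim i) (Rim (i + 1)) = values5 (64 / 7) 7 5 (33 / 5) (481 / 35) i"
    "edge_length ?\<rho> (Rim i) Apex_T = values5 (111 / 7) 7 7 8 (37 / 5) i"
    "edge_length ?\<rho> (Rim i) Apex_B = values5 (104 / 7) 8 3 7 (13 / 5) i"
    "s_coord i (cm_point ?\<rho>) = values5 (64 / 84) (- 7 / 12) (5 / 12) (33 / 60) (- 481 / 420) i * y" for i
    by blast+
next
  show "continuous_on {25..97} (\<lambda>x. pentagon x v)" for v
  proof (cases v)
    case (Rim i)
    then show ?thesis
      using continuous_vertices by (cases "i = 1"; cases "i = 2"; cases "i = 3"; cases "i = 4") (simp_all add: pentagon_def)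
  qed (use continuous_vertices in \<open>simp_all add: pentagon_def\<close>)
qed (simp_all add: nonadj_5 pentagon_def, auto simp: values5_def power2_eq_square)


definition antipode :: "4 vertex \<Rightarrow> 4 vertex" where
  "antipode v = (case v of Apex_T \<Rightarrow> Apex_B | Apex_B \<Rightarrow> Apex_T | Rim i \<Rightarrow> Rim (i + 2))"

lemma antipode_unique:
  assumes "u \<noteq> v" "\<not> adj u v"
  shows "v = antipode u"
proof -
  have "\<forall>i j :: 4. i \<noteq> j \<longrightarrow> j \<noteq> i + 1 \<longrightarrow> i \<noteq> j + 1 \<longrightarrow> j = i + 2"
    unfolding forall_4_mod by simp
  then show ?thesis using assms by (cases u; cases v) (auto simp: antipode_def)
qed

lemma forall_vertex: "(\<forall>v. R v) \<longleftrightarrow> R Apex_T \<and> R Apex_B \<and> (\<forall>i. R (Rim i))"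
  by (metis vertex.exhaust)

definition signed_zero :: "real \<Rightarrow> real \<Rightarrow> real \<Rightarrow> real \<Rightarrow> bool" where
  "signed_zero a b c d \<longleftrightarrow> (\<exists>\<epsilon>\<^sub>1\<in>{1, -1}. \<exists>\<epsilon>\<^sub>2\<in>{1, -1}. \<exists>\<epsilon>\<^sub>3\<in>{1, -1}. \<exists>\<epsilon>\<^sub>4\<in>{1, -1}.
     \<epsilon>\<^sub>1 * a + \<epsilon>\<^sub>2 * b + \<epsilon>\<^sub>3 * c + \<epsilon>\<^sub>4 * d = 0)"

text \<open>Every vertex has a single non-neighbour, its antipode, so an induced 4-cycle is
  determined by its first edge. Up to rotation and reversal, under which a vanishing signed sum is
  preserved, there are three cycles: the rim and two through both apices.\<close>

lemma signed_zero_cycles: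
  fixes \<rho> :: "4 vertex \<Rightarrow> real ^ 3"
  assumes "\<And>i. edge_length \<rho> (Rim i) (Rim (i + 1)) = r i"
    "\<And>i. edge_length \<rho> (Rim i) Apex_T = t i" "\<And>i. edge_length \<rho> (Rim i) Apex_B = b i"
    and zero: "signed_zero (r 0) (r 1) (r 2) (r 3)" "signed_zero (t 0) (b 0) (b 2) (t 2)"
      "signed_zero (t 1) (b 1) (b 3) (t 3)"
    and cyc: "induced_4_cycle u v w z"
  shows "signed_zero (edge_length \<rho> u v) (edge_length \<rho> v w) (edge_length \<rho> w z) (edge_length \<rho> z u)"
proof -
  have rot: "signed_zero a2 a3 a4 a1" and rev: "signed_zero a4 a3 a2 a1" if "signed_zero a1 a2 a3 a4" for a1 a2 a3 a4
    using that unfolding signed_zero_def by (auto simp: algebra_simps)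
  note zero1 = zero rot[OF zero(1)] rot[OF zero(2)] rot[OF zero(3)]
  note zero2 = zero1 rot[OF rot[OF zero(1)]] rot[OF rot[OF zero(2)]] rot[OF rot[OF zero(3)]]
  note zero3 = zero2 rot[OF rot[OF rot[OF zero(1)]]] rot[OF rot[OF rot[OF zero(2)]]] rot[OF rot[OF rot[OF zero(3)]]]
  note zeros = zero3 zero3[THEN rev]
  have w: "w = antipode u" "z = antipode v" and uv: "adj u v"
    using cyc antipode_unique unfolding induced_4_cycle_def by auto
  have mod4: "(4 :: 4) = 0" "(5 :: 4) = 1" "(6 :: 4) = 2" by simp_all
  have rim: "edge_length \<rho> (Rim 0) (Rim 1) = r 0" "edge_length \<rho> (Rim 1) (Rim 2) = r 1"
    "edge_length \<rho> (Rim 2) (Rim 3) = r 2" "edge_length \<rho> (Rim 3) (Rim 0) = r 3"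
    using assms(1)[of 0] assms(1)[of 1] assms(1)[of 2] assms(1)[of 3] by (simp_all add: mod4)
  have rim': "edge_length \<rho> (Rim 1) (Rim 0) = r 0" "edge_length \<rho> (Rim 2) (Rim 1) = r 1"
    "edge_length \<rho> (Rim 3) (Rim 2) = r 2" "edge_length \<rho> (Rim 0) (Rim 3) = r 3"
    using rim edge_length_commute[of \<rho>] by metis+
  have apex: "edge_length \<rho> Apex_T (Rim i) = t i" "edge_length \<rho> Apex_B (Rim i) = b i" for i
    using assms(2,3) edge_length_commute[of \<rho>] by metis+
  have "\<forall>u v. adj u v \<longrightarrow> signed_zero (edge_length \<rho> u v) (edge_length \<rho> v (antipode u))
      (edge_length \<rho> (antipode u) (antipode v)) (edge_length \<rho> (antipode v) u)"
    unfolding forall_vertex forall_4_mod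
    by (simp add: antipode_def rim rim' apex assms(2,3) zeros mod4)
  from this[rule_format, OF uv] show ?thesis unfolding w .
qed

text \<open>Antipodal edges have equal lengths; the relations are \<open>5 + 7 = 5 + 7\<close>,
  \<open>3 + 7 = 3 + 7\<close> and \<open>7 + 8 = 7 + 8\<close>.\<close>

lemma type_III_kite: "type_III K.l K.M"
  unfolding type_III_def
proof (intro conjI allI impI K.flexible K.motion K.two_flat_poses)
  fix u v w z :: "4 vertex" assume "induced_4_cycle u v w z"
  then have "signed_zero (K.l u v) (K.l v w) (K.l w z) (K.l z u)"
    by (rule signed_zero_cycles[OF K.l_eq, rotated -1]) (simp_all add: signed_zero_def values4_def)
  then show "\<exists>\<epsilon>\<^sub>1\<in>{1, -1}. \<exists>\<epsilon>\<^sub>2\<in>{1, -1}. \<exists>\<epsilon>\<^sub>3\<in>{1, -1}. \<exists>\<epsilon>\<^sub>4\<in>{1, -1}.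
      \<epsilon>\<^sub>1 * K.l u v + \<epsilon>\<^sub>2 * K.l v w + \<epsilon>\<^sub>3 * K.l w z + \<epsilon>\<^sub>4 * K.l z u = 0"
    unfolding signed_zero_def .
qed

text \<open>The relations are \<open>7 + 481 / 35 = 33 / 5 + 99 / 7\<close>,
  \<open>3 + 7 = 13 / 5 + 37 / 5\<close> and \<open>8 - 7 = 111 / 7 - 104 / 7\<close>.\<close>

lemma type_III_pentagon_part: "type_III Q.l Q.M"
  unfolding type_III_def
proof (intro conjI allI impI Q.flexible Q.motion Q.two_flat_poses)
  fix u v w z :: "4 vertex" assume "induced_4_cycle u v w z"
  then have "signed_zero (Q.l u v) (Q.l v w) (Q.l w z) (Q.l z u)"
    by (rule signed_zero_cycles[OF Q.l_eq, rotated -1]) (simp_all add: signed_zero_def values4_def)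
  then show "\<exists>\<epsilon>\<^sub>1\<in>{1, -1}. \<exists>\<epsilon>\<^sub>2\<in>{1, -1}. \<exists>\<epsilon>\<^sub>3\<in>{1, -1}. \<exists>\<epsilon>\<^sub>4\<in>{1, -1}.
      \<epsilon>\<^sub>1 * Q.l u v + \<epsilon>\<^sub>2 * Q.l v w + \<epsilon>\<^sub>3 * Q.l w z + \<epsilon>\<^sub>4 * Q.l z u = 0"
    unfolding signed_zero_def .
qed

lemma path_combine: "N.path = (\<lambda>t. combine (K.path t) (Q.path t))"
  unfolding N.path_def K.path_def Q.path_def N.conf_eq K.conf_eq Q.conf_eq combine_frame ..

lemma fitting_paths: "fitting_pair (K.path s) (Q.path s)"
proof -
  define x y where "x = 61 + s" and "y = sqrt (1296 - s\<^sup>2)"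
  have p0: "frame x y (p0 x) = 0"
    by (simp add: frame_def p0_def vec_eq_iff forall_3)
  \<comment> \<open>Any fixed multiple of \<open>p1\<close> keeps constant distances to 0, T and B;
    the factor \<open>99 / 35\<close> makes all three rational, namely \<open>99 / 7\<close>,
    \<open>111 / 7\<close> and \<open>104 / 7\<close>.\<close>
  have p5: "frame x y (p5 x) = (99 / 35) *\<^sub>R frame x y (p1 x)"
    by (simp add: frame_def p1_def p5_def vec_eq_iff forall_3)
  have "collinear {frame x y (p0 x), frame x y (p1 x), frame x y (p5 x)}"
    unfolding p0 p5 collinear_lemma by blast
  then show ?thesis
    unfolding fitting_pair_def K.path_def Q.path_def K.conf_def Q.conf_def x_def y_def
    by (simp add: kite_def pentagon_part_def)
qed

text \<open>A flat pose and the top of the ellipse; comparing these two configurations shows that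
  every diagonal varies.\<close>

lemma conic_samples: "conic 25 0" "conic 61 36"
  by (simp_all add: conic_def)

lemma diagonals_vary:
  "\<exists>p\<in>N.M. \<exists>q\<in>N.M. d_coord (Rim i) (Rim (i + 2)) p \<noteq> d_coord (Rim i) (Rim (i + 2)) q"
proof -
  have "i \<noteq> i + 2" by simp
  have "\<forall>i. (norm (N.conf 25 0 (Rim i) - N.conf 25 0 (Rim (i + 2))))\<^sup>2 \<noteq>
      (norm (N.conf 61 36 (Rim i) - N.conf 61 36 (Rim (i + 2))))\<^sup>2"
    unfolding forall_5 N.conf_def
    by (simp add: pentagon_def vertex_defs frame_dist[OF conic_samples(1)] frame_dist[OF conic_samples(2)] power_divide)
  then show ?thesis
    using \<open>i \<noteq> i + 2\<close> N.conf_M(1)[OF conic_samples(1)] N.conf_M(1)[OF conic_samples(2)]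
    by (intro bexI[of _ "cm_point (N.conf 25 0)"] bexI[of _ "cm_point (N.conf 61 36)"])
      (simp_all add: d_coord_cm_point)
qed

lemma nondegenerate_pentagon: "nondegenerate N.l N.M"
proof (rule N.nondegenerate[OF _ _ diagonals_vary])
  show "(3 :: 5) \<noteq> 0" by simp
  fix i and A :: "5 vertex" assume A: "A \<in> {Apex_T, Apex_B}"
  have "\<forall>i. N.l (Rim i) (Rim (i + 1)) < N.l (Rim i) A + N.l (Rim (i + 1)) A \<and>
      N.l (Rim i) A < N.l (Rim i) (Rim (i + 1)) + N.l (Rim (i + 1)) A \<and>
      N.l (Rim (i + 1)) A < N.l (Rim i) (Rim (i + 1)) + N.l (Rim i) A"
    using A unfolding N.l_eq forall_5 by (auto simp: N.l_eq values5_def)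
  then show "N.l (Rim i) (Rim (i + 1)) < N.l (Rim i) A + N.l (Rim (i + 1)) A \<and>
      N.l (Rim i) A < N.l (Rim i) (Rim (i + 1)) + N.l (Rim (i + 1)) A \<and>
      N.l (Rim (i + 1)) A < N.l (Rim i) (Rim (i + 1)) + N.l (Rim i) A" by blast
qed

theorem theorem3p20:
  shows "\<exists>(\<rho>\<^sub>k :: 4 vertex \<Rightarrow> real ^ 3) f\<^sub>k M\<^sub>k (\<rho>\<^sub>p :: 4 vertex \<Rightarrow> real ^ 3) f\<^sub>p M\<^sub>p
            (\<rho> :: 5 vertex \<Rightarrow> real ^ 3) f M.
    nelson_construction \<rho>\<^sub>k f\<^sub>k \<rho>\<^sub>p f\<^sub>p \<rho> f \<and>
    type_III (edge_length \<rho>\<^sub>k) M\<^sub>k \<and> contains_flex M\<^sub>k f\<^sub>k \<and>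
    type_III (edge_length \<rho>\<^sub>p) M\<^sub>p \<and> contains_flex M\<^sub>p f\<^sub>p \<and>
    flexible (edge_length \<rho>) \<and>
    motion (edge_length \<rho>) M \<and> contains_flex M f \<and>
    nondegenerate (edge_length \<rho>) M \<and>
    has_galois_group M (generate Z2_tuples {vector [1, 1, 1, 1, 1]})"
proof (intro exI conjI)
  show "nelson_construction (K.path 0) K.path (Q.path 0) Q.path (N.path 0) N.path"
    unfolding nelson_construction_def
    using K.flex_path Q.flex_path N.flex_path fitting_paths path_combine by simp
  show "type_III K.l K.M" "contains_flex K.M K.path" "type_III Q.l Q.M" "contains_flex Q.M Q.path"
    by (rule type_III_kite K.contains_path type_III_pentagon_part Q.contains_path)+
  show "flexible N.l" "motion N.l N.M" "contains_flex N.M N.path" "nondegenerate N.l N.M"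
    by (rule N.flexible N.motion N.contains_path nondegenerate_pentagon)+
  show "has_galois_group N.M (generate Z2_tuples {vector [1, 1, 1, 1, 1]})"
    by (rule pentagonal_motion.has_galois_group[OF pentagonal_motion.intro[OF N.elliptic_motion_axioms]])
qed

end
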